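(* Let $\omega(s)$ be the meromorphic continuation to $\mathbb{C}$ of $\sum_{j,k=1}^\infty \big(jk(j+k)\big)^{-s}$ (convergent for $\mathrm{Re}(s)>2/3$), and let $\gamma$ be the Euler–Mascheroni constant. Then $$\omega'(0)=\frac{1}{12}(1+\gamma)+\frac34\log(2\pi)-2\zeta'(-1)+\frac12\int_{-\infty}^{\infty}\frac{\zeta\!\left(\tfrac32+it\right)\zeta\!\left(-\tfrac32-it\right)}{\left(\tfrac32+it\right)\cosh(\pi t)}\,dt=1.83787706640934548356\ldots.$$
   Context: $\zeta$ is the Riemann zeta function (meromorphically continued), $i=\sqrt{-1}$. *)

theory Defs
  imports "HOL-Complex_Analysis.Complex_Analysis"
begin

(* "Nicely" normalises F at removable singularities (continuity) and at poles (value 0). For S a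
   right half-plane this makes the continuation unique as a total function, so that THE is
   meaningful as soon as a continuation exists. *)
definition is_meromorphic_continuation ::
    "complex set \<Rightarrow> (complex \<Rightarrow> complex) \<Rightarrow> (complex \<Rightarrow> complex) \<Rightarrow> bool" where
  "is_meromorphic_continuation S f F \<longleftrightarrow>
     F nicely_meromorphic_on UNIV \<and> (\<forall>s\<in>S. F s = f s)"

definition meromorphic_continuation ::
    "complex set \<Rightarrow> (complex \<Rightarrow> complex) \<Rightarrow> complex \<Rightarrow> complex" where
  "meromorphic_continuation S f = (THE F. is_meromorphic_continuation S f F)"

definition zeta :: "complex \<Rightarrow> complex" where
  "zeta = meromorphic_continuation {s. Re s > 1} (\<lambda>s. \<Sum>n. of_nat (Suc n) powr (-s))"

definition omega_term :: "complex \<Rightarrow> nat \<times> nat \<Rightarrow> complex" where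
  "omega_term s = (\<lambda>(j, k). of_nat (j * k * (j + k)) powr (-s))"

definition omega_series :: "complex \<Rightarrow> complex" where
  "omega_series s = (\<Sum>\<^sub>\<infinity>p\<in>{1..} \<times> {1..}. omega_term s p)"

definition omega :: "complex \<Rightarrow> complex" where
  "omega = meromorphic_continuation {s. Re s > 2/3} omega_series"

definition omega_integrand :: "real \<Rightarrow> complex" where
  "omega_integrand t =
     zeta (3/2 + \<i> * of_real t) * zeta (- 3/2 - \<i> * of_real t) /
       ((3/2 + \<i> * of_real t) * of_real (cosh (pi * t)))"

end

theory Submission
  imports Defs "HOL-Real_Asymp.Real_Asymp" "HOL-Probability.Sinc_Integral"
begin


text \<open>Both sides are evaluated in closed form and both equal ln (2 pi); the decimal expansion
  is then a matter of bounding pi and a few logarithms. What links the two sides is the Stirling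
  error E(n) = \<open>stirling_err n\<close>, the part of ln n! left over by Stirling's formula
  including its 1/(12 n) term.

  The integral. On the line Re z = 3/2 expand zeta(z) as the sum of n^(-z), and write zeta(-z)/z as
  a sum over k >= 0 of Euler-Maclaurin cells of the function x^z / z
  (\<open>zeta_cell_sums\<close>). The Fourier transform of sech (\<open>fourier_sech\<close>), once
  integrated, sends (x/n)^z / z to 2 (x/n - ln (1 + x/n)) (\<open>mellin_integrated_0\<close>).
  Euler-Maclaurin cells vanish on linear functions, so the k-th cell becomes that of -2 ln (n + x),
  which is 2 (E(n+k) - E(n+k+1)). Summing over k gives 2 E(n) (\<open>integral_zeta_power\<close>),
  and summing over n shows that the integral is twice the sum of E
  (\<open>omega_integrand_integral\<close>). The sum of E is elementary up to the Glaisher-Kinkelin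
  constant, that is, up to zeta'(-1) (\<open>stirling_err_sums\<close>), and with it the right-hand
  side collapses to ln (2 pi) (\<open>ln_2pi_eq_formula\<close>).

  The derivative. By symmetry the double series is twice the sum over j <= k with half weight on the
  diagonal, which is the shape Euler-Maclaurin wants for the row y^(-s) (y + j)^(-s), y >= j. The
  rows are homogeneous in j, so summing over j turns the integral terms into
  \<open>beta_int s * zeta (3 * s - 1)\<close> and the boundary terms into multiples of zeta(3 s +
  r); what is left is a double series of remainders that converges further to the left the higher
  the order (\<open>omega_series_formula\<close>). With a recursion continuing
  \<open>beta_int\<close> this yields the continuation of omega
  (\<open>omega_is_continuation\<close>) and an explicit formula near 0
  (\<open>omega_eq_local\<close>). The remainders can be differentiated term by term at 0 and again
  produce differences of E; row j telescopes to E(j) + E(2j)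
  (\<open>deriv_em_lattice_rem_0\<close>). The sums of both are known, and gamma, ln 2 and zeta'(-1)
  cancel against the explicit terms (\<open>omega_has_derivative_ln_2pi\<close>).\<close>

section \<open>Uniqueness and construction of meromorphic continuations\<close>

text \<open>The difference with its singularities removed vanishes on an open set, hence on all of
  the connected \<open>A\<close>. So f and g agree near z away from z itself, and niceness then
  determines the value at z: the limit if there is one, 0 at a pole.\<close>

lemma nicely_meromorphic_eqI:
  assumes f: "f nicely_meromorphic_on A" and g: "g nicely_meromorphic_on A"
    and A: "open A" "connected A" and S: "open S" "S \<noteq> {}" "S \<subseteq> A"
    and eq: "\<And>z. z \<in> S \<Longrightarrow> f z = g z" and z: "z \<in> A"
  shows "f z = g z"
proof -
  define d where "d = remove_sings (\<lambda>z. f z - g z)"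
  have mero: "(\<lambda>z. f z - g z) meromorphic_on A"
    using f g by (auto intro!: meromorphic_intros simp: nicely_meromorphic_on_def)
  have nd: "d nicely_meromorphic_on A"
    unfolding d_def using mero by (rule remove_sings_nicely_meromorphic)
  obtain z0 where z0: "z0 \<in> S" using S by blast
  have evS: "eventually (\<lambda>z. z \<in> S) (nhds w)" if "w \<in> S" for w
    using S that by (simp add: eventually_nhds_in_open)
  have dS: "d w = 0" if w: "w \<in> S" for w
    unfolding d_def
  proof (rule remove_sings_eqI)
    have "eventually (\<lambda>z. f z - g z = 0) (at w)"
      using evS[OF w] unfolding eventually_at_filter by eventually_elim (simp add: eq)
    thus "((\<lambda>z. f z - g z) \<longlongrightarrow> 0) (at w)" by (rule tendsto_eventually)
  qed
  have "eventually (\<lambda>w. d w = 0) (at z0)"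
    using evS[OF z0] unfolding eventually_at_filter by eventually_elim (simp add: dS)
  hence "frequently (\<lambda>w. d w = 0) (at z0)"
    by (rule eventually_frequently[rotated]) simp
  hence d0: "d w = 0" if "w \<in> A" for w
    using frequently_eq_meromorphic_imp_constant[OF _ nd A, of 0 z0 w] z0 S that by blast
  have "isolated_singularity_at (\<lambda>z. f z - g z) z"
    by (rule meromorphic_on_isolated_singularity[OF meromorphic_on_subset[OF mero]]) (use z in auto)
  hence "eventually (\<lambda>w. d w = f w - g w) (at z)"
    unfolding d_def by (rule eventually_remove_sings_eq_at)
  moreover have "eventually (\<lambda>w. w \<in> A) (at z)"
    using A z eventually_at_in_open' by blast
  ultimately have ev: "eventually (\<lambda>w. f w = g w) (at z)"
    by eventually_elim (use d0 in auto)
  hence pole: "is_pole f z \<longleftrightarrow> is_pole g z"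
    by (rule is_pole_cong) simp
  show ?thesis
  proof (cases "is_pole f z")
    case True
    \<comment> \<open>A function with a pole has no finite limit there, so only the value 0 is left
      by the definition of niceness.\<close>
    have not_lim: "\<not> h \<midarrow>z\<rightarrow> l" if "is_pole h z" for h :: "complex \<Rightarrow> complex" and l
      using that not_tendsto_and_filterlim_at_infinity[OF trivial_limit_at, of h l z]
      unfolding is_pole_def by blast
    have "f z = 0" using True not_lim[OF True] f z unfolding nicely_meromorphic_on_def by metis
    moreover have "is_pole g z" using True pole by simp
    hence "g z = 0" using not_lim[of g] g z unfolding nicely_meromorphic_on_def by metis
    ultimately show ?thesis by simp
  next
    case False
    hence lim: "f \<midarrow>z\<rightarrow> f z" "g \<midarrow>z\<rightarrow> g z" using pole f g z unfolding nicely_meromorphic_on_def by metis+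
    from lim(1) have "g \<midarrow>z\<rightarrow> f z" using tendsto_cong[OF ev, of "f z"] by simp
    from tendsto_unique[OF trivial_limit_at this lim(2)] show ?thesis .
  qed
qed

text \<open>Niceness is a local property; this is what permits gluing continuations from different
  half-planes.\<close>

lemma nicely_meromorphic_on_local:
  assumes "\<And>z. z \<in> A \<Longrightarrow> \<exists>U g. open U \<and> z \<in> U \<and> g nicely_meromorphic_on U \<and> (\<forall>w\<in>U. f w = g w)"
  shows "f nicely_meromorphic_on A"
  unfolding nicely_meromorphic_on_def
proof (intro conjI ballI)
  have "f meromorphic_on {z} \<and> (is_pole f z \<and> f z = 0 \<or> f \<midarrow>z\<rightarrow> f z)" if z: "z \<in> A" for z
  proof -
    obtain U g where U: "open U" "z \<in> U" "g nicely_meromorphic_on U" "\<forall>w\<in>U. f w = g w"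
      using assms[OF z] by (elim exE conjE) (rule that)
    have ev: "eventually (\<lambda>w. f w = g w) (at z)"
      using eventually_at_in_open'[OF U(1,2)] by eventually_elim (use U(4) in auto)
    have "g meromorphic_on {z}"
      using U by (auto simp: nicely_meromorphic_on_def intro: meromorphic_on_subset)
    hence "f meromorphic_on {z}"
      using meromorphic_on_cong[of "{z}" f g "{z}"] ev by simp
    moreover have "is_pole f z \<longleftrightarrow> is_pole g z" by (rule is_pole_cong[OF ev refl])
    moreover have "f \<midarrow>z\<rightarrow> f z \<longleftrightarrow> g \<midarrow>z\<rightarrow> g z" using tendsto_cong[OF ev] U(2,4) by simp
    ultimately show ?thesis using U(2,3,4) unfolding nicely_meromorphic_on_def by metis
  qed
  note * = this
  show "f meromorphic_on A" using * meromorphic_on_meromorphic_at by blast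
  show "\<And>z. z \<in> A \<Longrightarrow> is_pole f z \<and> f z = 0 \<or> f \<midarrow>z\<rightarrow> f z"
    using * by blast
qed

lemma is_meromorphic_continuation_unique:
  assumes "is_meromorphic_continuation S f F" "is_meromorphic_continuation S f G" "open S" "S \<noteq> {}"
  shows "F = G"
proof
  fix z
  show "F z = G z"
    by (rule nicely_meromorphic_eqI[where f = F and g = G and A = UNIV and S = S])
      (use assms in \<open>auto simp: is_meromorphic_continuation_def\<close>)
qed

lemma connected_Re_gt: "connected {s. Re s > c}"
  by (intro convex_connected convex_halfspace_Re_gt)

lemma Re_gt_nonempty: "{s. Re s > c} \<noteq> {}"
proof -
  have "complex_of_real (c + 1) \<in> {s. Re s > c}" by simp
  thus ?thesis by blast
qed

text \<open>Continuations to the half-planes Re s > -n, made nice, agree on overlaps by the identity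
  theorem and glue to one function on the plane. Existence together with uniqueness makes the
  \<open>THE\<close> in the definition meaningful.\<close>

lemma meromorphic_continuation_halfplane:
  assumes hol: "f holomorphic_on {s. Re s > c}"
    and F: "\<And>n::nat. \<exists>F. F meromorphic_on {s. Re s > - real n} \<and> (\<forall>s. Re s > c \<longrightarrow> F s = f s)"
    and c: "c \<ge> 0"
  shows "is_meromorphic_continuation {s. Re s > c} f (meromorphic_continuation {s. Re s > c} f)"
proof -
  have "\<exists>F. F nicely_meromorphic_on {s. Re s > - real n} \<and> (\<forall>s. Re s > c \<longrightarrow> F s = f s)" for n
  proof -
    obtain G where G: "G meromorphic_on {s. Re s > - real n}" "\<forall>s. Re s > c \<longrightarrow> G s = f s"
      using F by blast
    have "remove_sings G s = f s" if s: "Re s > c" for s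
    proof -
      have "eventually (\<lambda>w. Re w > c) (nhds s)"
        using s eventually_nhds_in_open[OF open_halfspace_Re_gt, of s c] by simp
      hence ev: "eventually (\<lambda>w. G w = f w) (nhds s)"
        by eventually_elim (use G in auto)
      have "f analytic_on {s}"
        using hol s analytic_on_open[OF open_halfspace_Re_gt] analytic_on_subset by blast
      hence "G analytic_on {s}" using analytic_at_cong[OF ev refl] by simp
      thus ?thesis using G s by simp
    qed
    thus ?thesis using remove_sings_nicely_meromorphic[OF G(1)] by blast
  qed
  then obtain F where "\<forall>n. F n nicely_meromorphic_on {s. Re s > - real n} \<and> (\<forall>s. Re s > c \<longrightarrow> F n s = f s)"
    using choice[of "\<lambda>n F. F nicely_meromorphic_on {s. Re s > - real n} \<and> (\<forall>s. Re s > c \<longrightarrow> F s = f s)"]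
    by blast
  hence F: "\<And>n. F n nicely_meromorphic_on {s. Re s > - real n}"
    "\<And>n s. Re s > c \<Longrightarrow> F n s = f s" by blast+
  have eq: "F m s = F n s" if "m \<le> n" "Re s > - real m" for m n s
  proof (rule nicely_meromorphic_eqI[where f = "F m" and g = "F n" and A = "{s. Re s > - real m}" and S = "{s. Re s > c}"])
    show "F m nicely_meromorphic_on {s. Re s > - real m}" by (rule F)
    show "F n nicely_meromorphic_on {s. Re s > - real m}"
      by (rule nicely_meromorphic_on_subset[OF F(1)]) (use that in auto)
    show "{s. Re s > c} \<noteq> {}" by (rule Re_gt_nonempty)
    show "{s. Re s > c} \<subseteq> {s. Re s > - real m}" using c by auto
    show "F m z = F n z" if "z \<in> {s. Re s > c}" for z using that F(2) by simp
  qed (use that(2) in \<open>simp_all add: connected_Re_gt open_halfspace_Re_gt\<close>)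
  \<comment> \<open>Index of one half-plane that contains s; the extra 1 makes the inequality
    strict.\<close>
  define N where "N s = nat \<lceil>\<bar>Re s\<bar>\<rceil> + 1" for s :: complex
  have N: "Re s > - real (N s)" for s unfolding N_def by (smt (verit) of_nat_add of_nat_1 real_nat_ceiling_ge)
  define G where "G s = F (N s) s" for s
  have GF: "G s = F n s" if "Re s > - real n" for s n
  proof (cases "N s \<le> n")
    case True
    from eq[OF True N] show ?thesis by (simp add: G_def)
  next
    case False
    hence "n \<le> N s" by simp
    from eq[OF this that] show ?thesis by (simp add: G_def)
  qed
  have "G nicely_meromorphic_on UNIV"
  proof (rule nicely_meromorphic_on_local)
    fix z
    have "\<forall>w\<in>{s. Re s > - real (N z)}. G w = F (N z) w" using GF by blast
    thus "\<exists>U g. open U \<and> z \<in> U \<and> g nicely_meromorphic_on U \<and> (\<forall>w\<in>U. G w = g w)"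
      using N[of z] F(1)[of "N z"] open_halfspace_Re_gt[of "- real (N z)"]
      by (intro exI[of _ "{s. Re s > - real (N z)}"] exI[of _ "F (N z)"] conjI) simp_all
  qed
  moreover have "G s = f s" if "Re s > c" for s using F that unfolding G_def by simp
  ultimately have G: "is_meromorphic_continuation {s. Re s > c} f G"
    by (auto simp: is_meromorphic_continuation_def)
  have ne: "{s. Re s > c} \<noteq> {}" by (rule Re_gt_nonempty)
  show ?thesis unfolding meromorphic_continuation_def
  proof (rule theI[of "is_meromorphic_continuation {s. Re s > c} f"])
    show "is_meromorphic_continuation {s. Re s > c} f G" by (rule G)
  next
    fix H assume "is_meromorphic_continuation {s. Re s > c} f H"
    thus "H = G"
      using G open_halfspace_Re_gt ne by (rule is_meromorphic_continuation_unique)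
  qed
qed

text \<open>Lets an explicit formula G on a larger half-plane compute the continuation. Analyticity
  of G at z is required because at a singular point the formula may carry a value different from the
  normalised one.\<close>

lemma meromorphic_continuation_eq:
  assumes F: "is_meromorphic_continuation {s. Re s > c} f F"
    and G: "G meromorphic_on {s. Re s > d}" "\<And>s. Re s > c \<Longrightarrow> G s = f s"
    and hol: "f holomorphic_on {s. Re s > c}" and cd: "c \<ge> d"
    and z: "Re z > d" "G analytic_on {z}"
  shows "F z = G z"
proof -
  have "remove_sings G s = f s" if s: "Re s > c" for s
  proof -
    have "eventually (\<lambda>w. Re w > c) (nhds s)"
      using s eventually_nhds_in_open[OF open_halfspace_Re_gt, of s c] by simp
    hence ev: "eventually (\<lambda>w. G w = f w) (nhds s)"
      by eventually_elim (use G in auto)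
    have "f analytic_on {s}"
      using hol s analytic_on_open[OF open_halfspace_Re_gt] analytic_on_subset by blast
    hence "G analytic_on {s}" using analytic_at_cong[OF ev refl] by simp
    thus ?thesis using G s by simp
  qed
  moreover have "F nicely_meromorphic_on {s. Re s > d}"
    using F nicely_meromorphic_on_subset unfolding is_meromorphic_continuation_def by blast
  moreover have "{s. Re s > c} \<subseteq> {s. Re s > d}" using cd by auto
  ultimately have "F z = remove_sings G z"
    using nicely_meromorphic_eqI[of F "{s. Re s > d}" "remove_sings G" "{s. Re s > c}" z]
      remove_sings_nicely_meromorphic[OF G(1)] F z(1) Re_gt_nonempty connected_Re_gt open_halfspace_Re_gt
    unfolding is_meromorphic_continuation_def by simp
  thus ?thesis using z by simp
qed

section \<open>Euler-Maclaurin summation on unit cells\<close>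

definition poly_antideriv :: "real poly \<Rightarrow> real poly" where
  "poly_antideriv p = (\<Sum>i\<le>degree p. monom (coeff p i / real (Suc i)) (Suc i))"

lemma pderiv_poly_antideriv [simp]: "pderiv (poly_antideriv p) = p"
proof (rule poly_eqI)
  fix n
  have "coeff (poly_antideriv p) (Suc n) = (\<Sum>i\<le>degree p. if i = n then coeff p i / real (Suc i) else 0)"
    unfolding poly_antideriv_def coeff_sum by (intro sum.cong) (auto simp: coeff_monom)
  also have "\<dots> = coeff p n / real (Suc n)"
    by (auto simp: coeff_eq_0)
  finally show "coeff (pderiv (poly_antideriv p)) n = coeff p n"
    by (simp add: coeff_pderiv)
qed

lemma poly_antideriv_0 [simp]: "poly (poly_antideriv p) 0 = 0"
  by (simp add: poly_antideriv_def poly_sum poly_monom)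

lemma poly_antideriv_eqI:
  assumes "pderiv q = p" "poly q 0 = 0"
  shows "poly_antideriv p = q"
proof -
  have "pderiv (poly_antideriv p - q) = 0" using assms by (simp add: pderiv_diff)
  hence "degree (poly_antideriv p - q) = 0" by (simp add: pderiv_eq_0_iff)
  then obtain c where c: "poly_antideriv p - q = [:c:]" by (rule degree_eq_zeroE)
  have "c = 0" using arg_cong[OF c, of "\<lambda>r. poly r 0"] assms by simp
  thus ?thesis using c by simp
qed

lemma poly_antideriv_diff_const: "poly_antideriv (p - [:c:]) = poly_antideriv p - [:0, c:]"
  by (rule poly_antideriv_eqI) (simp_all add: pderiv_diff pderiv_pCons)

text \<open>These are the Bernoulli polynomials B_n(x) / n!: each is an antiderivative of the
  previous one, and the subtracted constant makes its integral over [0, 1] vanish.\<close>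

primrec em_kernel :: "nat \<Rightarrow> real poly" where
  "em_kernel 0 = 1"
| "em_kernel (Suc n) =
     poly_antideriv (em_kernel n) - [:poly (poly_antideriv (poly_antideriv (em_kernel n))) 1:]"

lemma pderiv_em_kernel: "pderiv (em_kernel (Suc n)) = em_kernel n"
  by (simp add: pderiv_diff pderiv_pCons)

declare em_kernel.simps(2) [simp del]

lemma em_kernel_1: "em_kernel 1 = [:-1/2, 1:]"
proof -
  have 1: "poly_antideriv 1 = [:0, 1:]"
    by (rule poly_antideriv_eqI) (simp_all add: pderiv_pCons)
  have 2: "poly_antideriv [:0, 1:] = [:0, 0, 1/2:]"
    by (rule poly_antideriv_eqI) (simp_all add: pderiv_pCons)
  show ?thesis by (simp add: 1 2 em_kernel.simps)
qed

lemma em_kernel_2: "em_kernel 2 = [:1/12, -1/2, 1/2:]"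
proof -
  have 1: "poly_antideriv [:-1/2, 1:] = [:0, -1/2, 1/2:]"
    by (rule poly_antideriv_eqI) (simp_all add: pderiv_pCons)
  have 2: "poly_antideriv [:0, -1/2, 1/2:] = [:0, 0, -1/4, 1/6:]"
    by (rule poly_antideriv_eqI) (simp_all add: pderiv_pCons)
  show ?thesis unfolding numeral_2_eq_2 em_kernel.simps(2)[of "Suc 0"] em_kernel_1[unfolded One_nat_def] 1 2 by simp
qed

lemma em_kernel_3: "em_kernel 3 = [:0, 1/12, -1/4, 1/6:]"
proof -
  have 1: "poly_antideriv [:1/12, -1/2, 1/2:] = [:0, 1/12, -1/4, 1/6:]"
    by (rule poly_antideriv_eqI) (simp_all add: pderiv_pCons)
  have 2: "poly_antideriv [:0, 1/12, -1/4, 1/6:] = [:0, 0, 1/24, -1/12, 1/24:]"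
    by (rule poly_antideriv_eqI) (simp_all add: pderiv_pCons)
  show ?thesis unfolding numeral_3_eq_3 em_kernel.simps(2)[of "Suc (Suc 0)"] em_kernel_2[unfolded numeral_2_eq_2] 1 2 by simp
qed

text \<open>The kernel one index lower has mean zero, so its antiderivative returns to its initial
  value. Equal end values make the boundary terms of neighbouring cells telescope; index 1 is
  different, jumping from -1/2 to 1/2.\<close>

lemma em_kernel_1_eq_0: "poly (em_kernel (Suc (Suc n))) 1 = poly (em_kernel (Suc (Suc n))) 0"
proof -
  define c where "c = poly (poly_antideriv (poly_antideriv (em_kernel n))) 1"
  have "em_kernel (Suc n) = poly_antideriv (em_kernel n) - [:c:]" by (simp add: c_def em_kernel.simps)
  hence "poly (poly_antideriv (em_kernel (Suc n))) 1 = 0"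
    by (simp add: poly_antideriv_diff_const c_def)
  thus ?thesis by (subst (1 2) em_kernel.simps(2)) simp
qed

text \<open>\<open>F\<close> is meant as a family of successive derivatives, F q being the q-th
  derivative of F 0. For q = 0 this is the plain integral of F 0 over the cell [k, k + 1].\<close>

definition em_rem :: "nat \<Rightarrow> (nat \<Rightarrow> real \<Rightarrow> complex) \<Rightarrow> real \<Rightarrow> complex" where
  "em_rem q F k = integral {0..1} (\<lambda>t. of_real (poly (em_kernel q) t) * F q (k + t))"

text \<open>One integration by parts, with \<open>em_kernel (Suc q)\<close> as antiderivative of
  \<open>em_kernel q\<close>.\<close>

lemma em_rem_step:
  assumes der: "\<And>y. y \<in> {k..k+1} \<Longrightarrow> (F q has_vector_derivative F (Suc q) y) (at y)"
    and cont: "continuous_on {k..k+1} (F (Suc q))"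
  shows "em_rem q F k = of_real (poly (em_kernel (Suc q)) 1) * F q (k + 1)
           - of_real (poly (em_kernel (Suc q)) 0) * F q k - em_rem (Suc q) F k"
proof -
  let ?K = "\<lambda>q t. complex_of_real (poly (em_kernel q) t)"
  have shift: "continuous_on {0..1} (\<lambda>t. G (k + t))" if "continuous_on {k..k+1} G" for G :: "real \<Rightarrow> complex"
    by (rule continuous_on_compose2[OF that]) (auto intro!: continuous_intros)
  have contF: "continuous_on {k..k+1} (F q)"
    by (intro continuous_at_imp_continuous_on ballI) (rule has_vector_derivative_continuous[OF der])
  have c1: "(\<lambda>t. ?K q t * F q (k + t)) integrable_on {0..1}"
    by (intro integrable_continuous_real continuous_intros shift contF)
  have c2: "(\<lambda>t. ?K (Suc q) t * F (Suc q) (k + t)) integrable_on {0..1}"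
    by (intro integrable_continuous_real continuous_intros shift cont)
  have "((\<lambda>t. ?K q t * F q (k + t) + ?K (Suc q) t * F (Suc q) (k + t)) has_integral
          ?K (Suc q) 1 * F q (k + 1) - ?K (Suc q) 0 * F q (k + 0)) {0..1}"
  proof (rule fundamental_theorem_of_calculus[where f = "\<lambda>t. ?K (Suc q) t * F q (k + t)"])
    fix t :: real assume t: "t \<in> {0..1}"
    have "((\<lambda>t. poly (em_kernel (Suc q)) t) has_real_derivative poly (em_kernel q) t) (at t)"
      using poly_DERIV[of "em_kernel (Suc q)" t] unfolding pderiv_em_kernel .
    hence 1: "(?K (Suc q) has_vector_derivative ?K q t) (at t)"
      by (intro has_vector_derivative_of_real) (simp add: has_real_derivative_iff_has_vector_derivative)
    have "((\<lambda>t. k + t) has_vector_derivative 1) (at t)"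
      by (auto intro!: derivative_eq_intros)
    from vector_diff_chain_at[OF this, of "F q" "F (Suc q) (k + t)"] der[of "k + t"] t
    have 2: "((\<lambda>t. F q (k + t)) has_vector_derivative F (Suc q) (k + t)) (at t)"
      by (simp add: o_def)
    have "((\<lambda>t. ?K (Suc q) t * F q (k + t)) has_vector_derivative
            ?K (Suc q) t * F (Suc q) (k + t) + ?K q t * F q (k + t)) (at t)"
      by (rule has_vector_derivative_mult[OF 1 2])
    thus "((\<lambda>t. ?K (Suc q) t * F q (k + t)) has_vector_derivative
            ?K q t * F q (k + t) + ?K (Suc q) t * F (Suc q) (k + t)) (at t within {0..1})"
      by (simp add: add.commute has_vector_derivative_at_within)
  qed simp
  from integral_unique[OF this] show ?thesis
    unfolding em_rem_def by (subst (asm) integral_add[OF c1 c2]) (simp add: algebra_simps)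
qed

text \<open>Iterated integration by parts. The first step has end values 1/2 and -1/2 of the kernel
  and creates the trapezoidal mean on the left; every later step has equal end values and creates a
  difference of derivatives.\<close>

lemma em_rem_expand:
  assumes der: "\<And>q y. y \<in> {k..k+1} \<Longrightarrow> (F q has_vector_derivative F (Suc q) y) (at y)"
  shows "(F 0 k + F 0 (k + 1)) / 2 = em_rem 0 F k
    + (\<Sum>r=1..q. (-1) ^ (r - 1) * of_real (poly (em_kernel (Suc r)) 0) * (F r (k + 1) - F r k))
    + (-1) ^ q * em_rem (Suc q) F k"
proof -
  have cont: "continuous_on {k..k+1} (F q)" for q
    by (intro continuous_at_imp_continuous_on ballI) (rule has_vector_derivative_continuous[OF der])
  have step: "em_rem q F k = of_real (poly (em_kernel (Suc q)) 1) * F q (k + 1)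
           - of_real (poly (em_kernel (Suc q)) 0) * F q k - em_rem (Suc q) F k" for q
    by (rule em_rem_step) (auto intro: der cont)
  show ?thesis
  proof (induction q)
    case 0
    show ?case using step[of 0]
      by (simp add: em_kernel_1[unfolded One_nat_def] field_simps)
  next
    case (Suc q)
    define S where "S = (\<Sum>r=1..q. (-1) ^ (r - 1) * of_real (poly (em_kernel (Suc r)) 0) * (F r (k + 1) - F r k))"
    define \<beta> where "\<beta> = complex_of_real (poly (em_kernel (Suc (Suc q))) 0)"
    have e1: "em_rem (Suc q) F k = \<beta> * (F (Suc q) (k + 1) - F (Suc q) k) - em_rem (Suc (Suc q)) F k"
      using step[of "Suc q"] unfolding em_kernel_1_eq_0 \<beta>_def by (simp add: algebra_simps)
    have e2: "(\<Sum>r=1..Suc q. (-1) ^ (r - 1) * of_real (poly (em_kernel (Suc r)) 0) * (F r (k + 1) - F r k))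
       = S + (-1) ^ q * \<beta> * (F (Suc q) (k + 1) - F (Suc q) k)"
      by (simp add: S_def \<beta>_def)
    show ?case using Suc.IH unfolding e2 unfolding S_def [symmetric] e1
      by (simp add: algebra_simps)
  qed
qed

section \<open>Derivatives of w^(-a) (w + c)^(-b) and their Euler-Maclaurin remainders\<close>

text \<open>The q-th derivative in w of w^(-a) (w + c)^(-b). Differentiating a factor raises its
  exponent by one, so the family is closed under differentiation. The case b = c = 0, a = s serves
  zeta; the case a = b = s, c = j serves row j of the double series.\<close>

fun pw_deriv :: "nat \<Rightarrow> complex \<Rightarrow> complex \<Rightarrow> complex \<Rightarrow> complex \<Rightarrow> complex" where
  "pw_deriv 0 a b c w = w powr (-a) * (w + c) powr (-b)"
| "pw_deriv (Suc q) a b c w = - a * pw_deriv q (a + 1) b c w - b * pw_deriv q a (b + 1) c w"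

lemma pw_deriv_has_field_derivative:
  assumes "w \<notin> \<real>\<^sub>\<le>\<^sub>0" "w + c \<notin> \<real>\<^sub>\<le>\<^sub>0"
  shows "(pw_deriv q a b c has_field_derivative pw_deriv (Suc q) a b c w) (at w)"
proof (induction q arbitrary: a b)
  case 0
  have "((\<lambda>w. w powr (-a) * (w + c) powr (-b)) has_field_derivative
     (-a) * w powr (-a-1) * (w + c) powr (-b) + (-b) * (w + c) powr (-b-1) * w powr (-a)) (at w)"
    using assms by (auto intro!: derivative_eq_intros)
  moreover have "pw_deriv 0 a b c = (\<lambda>w. w powr (-a) * (w + c) powr (-b))" by auto
  moreover have "-a-1 = -(a+1)" "-b-1 = -(b+1)" by simp_all
  ultimately show ?case by (simp add: algebra_simps)
next
  case (Suc q)
  have "((\<lambda>w. - a * pw_deriv q (a + 1) b c w - b * pw_deriv q a (b + 1) c w) has_field_derivative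
        - a * pw_deriv (Suc q) (a + 1) b c w - b * pw_deriv (Suc q) a (b + 1) c w) (at w)"
    by (intro DERIV_diff DERIV_cmult Suc.IH)
  moreover have "pw_deriv (Suc q) a b c = (\<lambda>w. - a * pw_deriv q (a + 1) b c w - b * pw_deriv q a (b + 1) c w)"
    by auto
  ultimately show ?case by (simp only: pw_deriv.simps(2)[of "Suc q"])
qed

lemma pw_deriv_has_vector_derivative:
  assumes "y > 0" "c \<ge> 0"
  shows "((\<lambda>y. pw_deriv q a b (of_real c) (of_real y)) has_vector_derivative
            pw_deriv (Suc q) a b (of_real c) (of_real y)) (at y)"
proof -
  have "complex_of_real y \<notin> \<real>\<^sub>\<le>\<^sub>0" "complex_of_real y + of_real c \<notin> \<real>\<^sub>\<le>\<^sub>0"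
    using assms by (auto simp: complex_nonpos_Reals_iff)
  from pw_deriv_has_field_derivative[OF this]
  show ?thesis by (rule has_vector_derivative_real_field)
qed

lemma pw_deriv_holomorphic [holomorphic_intros]:
  assumes "f holomorphic_on A" "g holomorphic_on A" "w \<noteq> 0" "w + c \<noteq> 0"
  shows "(\<lambda>s. pw_deriv q (f s) (g s) c w) holomorphic_on A"
  using assms(1,2)
proof (induction q arbitrary: f g)
  case 0
  thus ?case using assms(3,4) unfolding pw_deriv.simps(1)
    by (auto intro!: holomorphic_intros simp: powr_def)
next
  case (Suc q)
  show ?case unfolding pw_deriv.simps(2) using Suc by (intro holomorphic_intros Suc.IH)
qed

text \<open>The constant in \<open>norm_pw_deriv_le\<close>, where M bounds both exponents: 2^M
  compares (y + c)^(-b) with y^(-b), and each derivative costs a factor |a| + |b| <= 2 M and raises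
  the bound on the exponents to M + 1.\<close>

primrec pw_const :: "nat \<Rightarrow> real \<Rightarrow> real" where
  "pw_const 0 M = 2 powr M"
| "pw_const (Suc q) M = 2 * M * pw_const q (M + 1)"

lemma pw_const_nonneg: "M \<ge> 0 \<Longrightarrow> pw_const q M \<ge> 0"
  by (induction q arbitrary: M) auto

lemma pw_const_mono: "0 \<le> M \<Longrightarrow> M \<le> N \<Longrightarrow> pw_const q M \<le> pw_const q N"
  by (induction q arbitrary: M N) (auto intro!: mult_mono pw_const_nonneg)

text \<open>For c <= y the quotient (y + c) / y lies between 1 and 2, so y + c behaves like y. The
  bound is therefore uniform in c, which is what the double series over j <= k requires.\<close>

lemma norm_pw_deriv_le:
  assumes "0 < y" "0 \<le> c" "c \<le> y" "norm a \<le> M" "norm b \<le> M"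
  shows "norm (pw_deriv q a b (of_real c) (of_real y)) \<le> pw_const q M * y powr (-(Re a + Re b) - real q)"
  using assms(4,5)
proof (induction q arbitrary: a b M)
  case 0
  have "(y + c) powr (- Re b) \<le> 2 powr M * y powr (- Re b)"
  proof -
    have "y + c = y * (1 + c / y)" using assms by (simp add: field_simps)
    hence "(y + c) powr (- Re b) = y powr (- Re b) * (1 + c / y) powr (- Re b)"
      using assms by (simp add: powr_mult)
    also have "(1 + c / y) powr (- Re b) \<le> (1 + c / y) powr M"
      using assms 0 abs_Re_le_cmod[of b] by (intro powr_mono) auto
    also have "(1 + c / y) powr M \<le> 2 powr M"
      using assms 0 norm_ge_zero[of b] by (intro powr_mono2) (auto simp: field_simps simp del: norm_ge_zero)
    finally show ?thesis using assms by (simp add: mult.commute mult_left_mono)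
  qed
  hence "y powr (- Re a) * (y + c) powr (- Re b) \<le> y powr (- Re a) * (2 powr M * y powr (- Re b))"
    by (intro mult_left_mono) auto
  also have "\<dots> = 2 powr M * y powr (- (Re a + Re b))"
    by (simp add: powr_add [symmetric] algebra_simps)
  finally show ?case using assms
    by (simp add: norm_mult norm_powr_real_powr flip: of_real_add)
next
  case (Suc q)
  let ?p = "y powr (-(Re a + Re b) - real (Suc q))"
  have M: "M \<ge> 0" using Suc.prems norm_ge_zero[of a] by linarith
  have n1: "norm (a + 1) \<le> M + 1" "norm (b + 1) \<le> M + 1"
    using norm_triangle_ineq[of a 1] norm_triangle_ineq[of b 1] Suc.prems by auto
  have n2: "norm a \<le> M + 1" "norm b \<le> M + 1" using Suc.prems by auto
  have e: "- (Re (a + 1) + Re b) - real q = -(Re a + Re b) - real (Suc q)"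
          "- (Re a + Re (b + 1)) - real q = -(Re a + Re b) - real (Suc q)" by auto
  have i1: "norm (pw_deriv q (a + 1) b (of_real c) (of_real y)) \<le> pw_const q (M + 1) * ?p"
    using Suc.IH[OF n1(1) n2(2)] unfolding e .
  have i2: "norm (pw_deriv q a (b + 1) (of_real c) (of_real y)) \<le> pw_const q (M + 1) * ?p"
    using Suc.IH[OF n2(1) n1(2)] unfolding e .
  have "norm (pw_deriv (Suc q) a b (of_real c) (of_real y)) \<le>
     norm a * norm (pw_deriv q (a + 1) b (of_real c) (of_real y)) + norm b * norm (pw_deriv q a (b + 1) (of_real c) (of_real y))"
    by (simp only: pw_deriv.simps) (rule order_trans[OF norm_triangle_ineq4], simp add: norm_mult)
  also have "\<dots> \<le> M * (pw_const q (M + 1) * ?p) + M * (pw_const q (M + 1) * ?p)"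
    using Suc.prems M by (intro add_mono mult_mono i1 i2) auto
  finally show ?case by simp
qed

definition pw_rem :: "nat \<Rightarrow> complex \<Rightarrow> complex \<Rightarrow> real \<Rightarrow> real \<Rightarrow> complex" where
  "pw_rem q a b c = em_rem q (\<lambda>q y. pw_deriv q a b (of_real c) (of_real y))"

lemma pw_rem_expand:
  assumes "k > 0" "c \<ge> 0"
  shows "(pw_deriv 0 a b (of_real c) (of_real k) + pw_deriv 0 a b (of_real c) (of_real (k + 1))) / 2 =
      pw_rem 0 a b c k
    + (\<Sum>r=1..q. (-1) ^ (r - 1) * of_real (poly (em_kernel (Suc r)) 0) *
         (pw_deriv r a b (of_real c) (of_real (k + 1)) - pw_deriv r a b (of_real c) (of_real k)))
    + (-1) ^ q * pw_rem (Suc q) a b c k"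
  unfolding pw_rem_def
  by (rule em_rem_expand[where F = "\<lambda>q y. pw_deriv q a b (of_real c) (of_real y)"], rule pw_deriv_has_vector_derivative)
     (use assms in auto)

lemma continuous_on_pw_deriv:
  assumes "\<And>t. t \<in> A \<Longrightarrow> f t > 0" "c \<ge> 0" "continuous_on A f"
  shows "continuous_on A (\<lambda>t. pw_deriv q a b (of_real c) (of_real (f t)))"
proof -
  have "continuous_on {0<..} (\<lambda>y. pw_deriv q a b (of_real c) (of_real y))"
    using assms(2)
    by (intro continuous_at_imp_continuous_on ballI)
       (auto intro: has_vector_derivative_continuous[OF pw_deriv_has_vector_derivative])
  from continuous_on_compose2[OF this assms(3)] assms(1) show ?thesis by auto
qed

text \<open>The sign condition on the exponent makes the power of y decreasing, so its largest value
  on the cell is at the left end k.\<close>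

lemma norm_pw_rem_le:
  assumes "0 < k" "0 \<le> c" "c \<le> k" "norm a \<le> M" "norm b \<le> M" "Re a + Re b + real q \<ge> 0"
    and K: "\<And>t. t \<in> {0..1} \<Longrightarrow> \<bar>poly (em_kernel q) t\<bar> \<le> B"
  shows "norm (pw_rem q a b c k) \<le> B * pw_const q M * k powr (-(Re a + Re b) - real q)"
proof -
  let ?C = "B * pw_const q M * k powr (-(Re a + Re b) - real q)"
  have M: "M \<ge> 0" using assms norm_ge_zero[of a] by linarith
  have B: "B \<ge> 0" using K[of 0] by simp
  have "norm (integral {0..1} (\<lambda>t. complex_of_real (poly (em_kernel q) t) * pw_deriv q a b (of_real c) (of_real (k + t))))
      \<le> ?C * (1 - 0)"
  proof (rule integral_bound)
    show "continuous_on {0..1} (\<lambda>t. complex_of_real (poly (em_kernel q) t) * pw_deriv q a b (of_real c) (of_real (k + t)))"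
      using assms by (intro continuous_intros continuous_on_pw_deriv) auto
  next
    fix t :: real assume t: "t \<in> {0..1}"
    have "norm (complex_of_real (poly (em_kernel q) t) * pw_deriv q a b (of_real c) (of_real (k + t))) \<le>
       B * (pw_const q M * (k + t) powr (-(Re a + Re b) - real q))"
      unfolding norm_mult using t assms B by (intro mult_mono norm_pw_deriv_le) (auto simp: K)
    also have "\<dots> \<le> B * (pw_const q M * k powr (-(Re a + Re b) - real q))"
      using t assms B M by (intro mult_left_mono powr_mono2') (auto intro: pw_const_nonneg)
    finally show "norm (complex_of_real (poly (em_kernel q) t) * pw_deriv q a b (of_real c) (of_real (k + t))) \<le> ?C"
      by simp
  qed simp
  thus ?thesis by (simp add: pw_rem_def em_rem_def)
qed

lemma em_kernel_bounded: "\<exists>B. \<forall>t\<in>{0..1}. \<bar>poly (em_kernel q) t\<bar> \<le> B"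
proof -
  have "compact (poly (em_kernel q) ` {0..1})"
    by (intro compact_continuous_image continuous_intros) auto
  from compact_imp_bounded[OF this] show ?thesis by (auto simp: bounded_iff)
qed

text \<open>Differentiation under the integral sign, after writing both powers as a single
  exponential that is linear in s. The exponents s and e s cover zeta with e = 0 and the double
  series with e = 1.\<close>

lemma pw_rem_0_has_field_derivative:
  assumes "k > 0" "c \<ge> 0"
  shows "((\<lambda>s. pw_rem 0 s (e * s) c k) has_field_derivative
     integral {0..1} (\<lambda>t. - (of_real (ln (k + t)) + e * of_real (ln (k + t + c))) *
        pw_deriv 0 s (e * s) (of_real c) (of_real (k + t)))) (at s)"
proof -
  define f where "f s t = exp (- s * (of_real (ln (k + t)) + e * of_real (ln (k + t + c))))" for s t
  have f: "pw_deriv 0 s (e * s) (of_real c) (of_real (k + t)) = f s t" if "t \<in> {0..1}" for s t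
    using that assms by (simp add: f_def powr_def exp_add [symmetric] Ln_of_real algebra_simps flip: of_real_add)
  have "((\<lambda>s. integral (cbox 0 1) (f s)) has_field_derivative
     integral (cbox 0 1) (\<lambda>t. - (of_real (ln (k + t)) + e * of_real (ln (k + t + c))) * f s t)) (at s within UNIV)"
  proof (rule leibniz_rule_field_derivative)
    fix s t
    show "((\<lambda>s. f s t) has_field_derivative - (of_real (ln (k + t)) + e * of_real (ln (k + t + c))) * f s t) (at s within UNIV)"
      unfolding f_def by (auto intro!: derivative_eq_intros)
  next
    fix s show "f s integrable_on cbox 0 1"
      unfolding f_def using assms by (intro integrable_continuous continuous_intros) auto
  next
    show "continuous_on (UNIV \<times> cbox 0 1) (\<lambda>(s, t). - (of_real (ln (k + t)) + e * of_real (ln (k + t + c))) * f s t)"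
      unfolding f_def case_prod_unfold using assms by (intro continuous_intros) auto
  qed auto
  moreover have "pw_rem 0 s (e * s) c k = integral {0..1} (f s)" for s
    unfolding pw_rem_def em_rem_def by (intro integral_cong) (use f in \<open>simp del: pw_deriv.simps\<close>)
  moreover have "integral {0..1} (\<lambda>t. - (of_real (ln (k + t)) + e * of_real (ln (k + t + c))) *
        pw_deriv 0 s (e * s) (of_real c) (of_real (k + t))) = 
        integral {0..1} (\<lambda>t. - (of_real (ln (k + t)) + e * of_real (ln (k + t + c))) * f s t)"
    by (intro integral_cong) (simp only: f)
  ultimately show ?thesis by simp
qed

text \<open>Only the plain cell integral needs differentiation under the integral; higher remainders
  are holomorphic because integration by parts, read backwards, expresses each through the previous
  one and explicit boundary values.\<close>

lemma pw_rem_holomorphic: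
  assumes "k > 0" "c \<ge> 0"
  shows "(\<lambda>s. pw_rem q s (e * s) c k) holomorphic_on A"
proof -
  have "(\<lambda>s. pw_rem q s (e * s) c k) holomorphic_on UNIV"
  proof (induction q)
    case 0
    show ?case unfolding holomorphic_on_def field_differentiable_def
      using pw_rem_0_has_field_derivative[OF assms] by simp blast
  next
    case (Suc q)
    have "pw_rem (Suc q) s (e * s) c k = of_real (poly (em_kernel (Suc q)) 1) * pw_deriv q s (e * s) (of_real c) (of_real (k + 1))
           - of_real (poly (em_kernel (Suc q)) 0) * pw_deriv q s (e * s) (of_real c) (of_real k) - pw_rem q s (e * s) c k" for s
    proof -
      have "pw_rem q s (e * s) c k = of_real (poly (em_kernel (Suc q)) 1) * pw_deriv q s (e * s) (of_real c) (of_real (k + 1))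
           - of_real (poly (em_kernel (Suc q)) 0) * pw_deriv q s (e * s) (of_real c) (of_real k) - pw_rem (Suc q) s (e * s) c k"
        unfolding pw_rem_def
        using assms by (intro em_rem_step pw_deriv_has_vector_derivative continuous_on_pw_deriv continuous_on_id) auto
      thus ?thesis by simp
    qed
    moreover have "complex_of_real k + of_real c \<noteq> 0" "complex_of_real (k + 1) + of_real c \<noteq> 0"
      using assms by (simp_all flip: of_real_add)
    moreover have "complex_of_real k \<noteq> 0" "complex_of_real (k + 1) \<noteq> 0"
      using assms by (simp_all del: of_real_add)
    ultimately show ?case using Suc by (auto intro!: holomorphic_intros simp del: of_real_add)
  qed
  thus ?thesis by (rule holomorphic_on_subset) simp
qed

text \<open>Weierstrass' theorem for unordered sums with locally uniform majorants. Its second part,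
  termwise differentiation, is how zeta'(-1) and the derivative of the lattice remainder at 0 are
  computed.\<close>

lemma holomorphic_infsum:
  fixes f :: "'a \<Rightarrow> complex \<Rightarrow> complex"
  assumes A: "open A" and f: "\<And>x. x \<in> X \<Longrightarrow> f x holomorphic_on A"
    and bound: "\<And>z. z \<in> A \<Longrightarrow> \<exists>r>0. \<exists>M. cball z r \<subseteq> A \<and> M summable_on X \<and> (\<forall>x\<in>X. \<forall>w\<in>cball z r. norm (f x w) \<le> M x)"
  shows "(\<lambda>z. \<Sum>\<^sub>\<infinity>x\<in>X. f x z) holomorphic_on A"
    and "\<And>z. z \<in> A \<Longrightarrow> ((\<lambda>x. deriv (f x) z) has_sum deriv (\<lambda>z. \<Sum>\<^sub>\<infinity>x\<in>X. f x z) z) X"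
proof -
  let ?g = "\<lambda>z. \<Sum>\<^sub>\<infinity>x\<in>X. f x z"
  have *: "?g field_differentiable (at z) \<and> ((\<lambda>x. deriv (f x) z) has_sum deriv ?g z) X" if z: "z \<in> A" for z
  proof -
    obtain r M where r: "r > 0" "cball z r \<subseteq> A" "M summable_on X" "\<forall>x\<in>X. \<forall>w\<in>cball z r. norm (f x w) \<le> M x"
      using bound[OF z] by blast
    have rb: "ball z r \<subseteq> A" using r by auto
    have ul: "uniform_limit (cball z r) (\<lambda>Y w. \<Sum>x\<in>Y. f x w) ?g (finite_subsets_at_top X)"
      using r by (intro Weierstrass_m_test_general) auto
    have ev: "eventually (\<lambda>Y. finite Y \<and> Y \<subseteq> X) (finite_subsets_at_top X)"
      by (intro eventually_finite_subsets_at_top_weakI) auto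
    have ev1: "eventually (\<lambda>Y. continuous_on (cball z r) (\<lambda>w. \<Sum>x\<in>Y. f x w) \<and> (\<lambda>w. \<Sum>x\<in>Y. f x w) holomorphic_on ball z r) (finite_subsets_at_top X)"
      using ev
    proof eventually_elim
      case (elim Y)
      have "f x holomorphic_on cball z r" "f x holomorphic_on ball z r" if "x \<in> Y" for x
        using holomorphic_on_subset[OF f] r rb elim that by blast+
      thus ?case by (intro conjI continuous_on_sum holomorphic_on_sum holomorphic_on_imp_continuous_on) auto
    qed
    obtain hol: "?g holomorphic_on ball z r"
      using holomorphic_uniform_limit[OF ev1 ul] by auto
    hence d: "?g field_differentiable (at z)"
      using r(1) by (auto intro: holomorphic_on_imp_differentiable_at)
    have "((\<lambda>Y. (deriv ^^ 1) (\<lambda>w. \<Sum>x\<in>Y. f x w) z) \<longlongrightarrow> (deriv ^^ 1) ?g z) (finite_subsets_at_top X)"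
    proof (rule higher_deriv_complex_uniform_limit)
      show "uniform_limit (ball z r) (\<lambda>Y w. \<Sum>x\<in>Y. f x w) ?g (finite_subsets_at_top X)"
        by (rule uniform_limit_on_subset[OF ul]) auto
      show "\<forall>\<^sub>F Y in finite_subsets_at_top X. (\<lambda>w. \<Sum>x\<in>Y. f x w) holomorphic_on ball z r"
        using ev1 by eventually_elim simp
    qed (use r in auto)
    moreover have "\<forall>\<^sub>F Y in finite_subsets_at_top X. (deriv ^^ 1) (\<lambda>w. \<Sum>x\<in>Y. f x w) z = (\<Sum>x\<in>Y. deriv (f x) z)"
      using ev
    proof eventually_elim
      case (elim Y)
      have "(f x has_field_derivative deriv (f x) z) (at z)" if "x \<in> Y" for x
        using f[of x] elim that A z by (auto intro: holomorphic_derivI)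
      hence "((\<lambda>w. \<Sum>x\<in>Y. f x w) has_field_derivative (\<Sum>x\<in>Y. deriv (f x) z)) (at z)"
        by (intro DERIV_sum)
      thus ?case by (simp add: DERIV_imp_deriv)
    qed
    ultimately have "((\<lambda>Y. \<Sum>x\<in>Y. deriv (f x) z) \<longlongrightarrow> deriv ?g z) (finite_subsets_at_top X)"
      by (simp add: tendsto_cong)
    thus ?thesis using d by (simp add: has_sum_def)
  qed
  show "?g holomorphic_on A"
    unfolding holomorphic_on_def using * field_differentiable_at_within by blast
  show "((\<lambda>x. deriv (f x) z) has_sum deriv ?g z) X" if "z \<in> A" for z using *[OF that] by blast
qed

lemma summable_powr_shift:
  assumes "p < -1" shows "summable (\<lambda>i. real (m + i) powr p)"
  using assms summable_iff_shift[of "\<lambda>i. real i powr p" m] by (simp add: summable_real_powr_iff add.commute)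

lemma pw_rem_summable:
  assumes "m \<ge> 1" "0 \<le> c" "c \<le> real m" "Re a + Re b + real q > 1"
  shows "summable (\<lambda>i. norm (pw_rem q a b c (real (m + i))))"
proof -
  obtain B where B: "\<And>t. t \<in> {0..1} \<Longrightarrow> \<bar>poly (em_kernel q) t\<bar> \<le> B" using em_kernel_bounded by blast
  let ?M = "max (norm a) (norm b)"
  have "norm (pw_rem q a b c (real (m + i))) \<le> B * pw_const q ?M * real (m + i) powr (-(Re a + Re b) - real q)" for i
    by (rule norm_pw_rem_le) (use assms B in auto)
  moreover have "summable (\<lambda>i. B * pw_const q ?M * real (m + i) powr (-(Re a + Re b) - real q))"
    using assms by (intro summable_mult summable_powr_shift) auto
  ultimately show ?thesis by (intro summable_comparison_test[OF _ \<open>summable _\<close>] exI[of _ 0]) auto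
qed

lemma pw_deriv_0_summable:
  assumes "m \<ge> 1" "0 \<le> c" "c \<le> real m" "Re a + Re b > 1"
  shows "summable (\<lambda>i. norm (pw_deriv 0 a b (of_real c) (of_real (real (m + i)))))"
proof -
  let ?M = "max (norm a) (norm b)"
  have "norm (pw_deriv 0 a b (of_real c) (of_real (real (m + i)))) \<le> pw_const 0 ?M * real (m + i) powr (-(Re a + Re b) - real 0)" for i
    by (rule norm_pw_deriv_le) (use assms in auto)
  moreover have "summable (\<lambda>i. pw_const 0 ?M * real (m + i) powr (-(Re a + Re b) - real 0))"
    using assms by (intro summable_mult summable_powr_shift) auto
  ultimately show ?thesis by (intro summable_comparison_test[OF _ \<open>summable _\<close>] exI[of _ 0]) auto
qed

lemma pw_deriv_tendsto_0:
  assumes "0 \<le> c" "c \<le> real m" "m \<ge> 1" "Re a + Re b + real r > 0"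
  shows "(\<lambda>i. pw_deriv r a b (of_real c) (of_real (real (m + i)))) \<longlonglongrightarrow> 0"
proof (rule Lim_null_comparison)
  let ?M = "max (norm a) (norm b)"
  show "\<forall>\<^sub>F i in sequentially. norm (pw_deriv r a b (of_real c) (of_real (real (m + i)))) \<le>
      pw_const r ?M * real (m + i) powr (-(Re a + Re b) - real r)"
    by (intro always_eventually allI norm_pw_deriv_le) (use assms in auto)
  have "filterlim (\<lambda>i. real (m + i)) at_top sequentially"
    by real_asymp
  hence "(\<lambda>i. real (m + i) powr (-(Re a + Re b) - real r)) \<longlonglongrightarrow> 0"
    using assms by (intro tendsto_neg_powr) auto
  thus "(\<lambda>i. pw_const r ?M * real (m + i) powr (-(Re a + Re b) - real r)) \<longlonglongrightarrow> 0"
    by (rule tendsto_mult_right_zero)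
qed

text \<open>Sum \<open>pw_rem_expand\<close> over all cells. The trapezoidal means add up to the
  full series minus half its first term, and each boundary term telescopes to minus its value at m
  because the derivatives tend to 0.\<close>

lemma euler_maclaurin_series:
  assumes m: "m \<ge> 1" "0 \<le> c" "c \<le> real m" and ab: "Re a + Re b > 1"
  shows "(\<Sum>i. pw_deriv 0 a b (of_real c) (of_real (real (m + i)))) - pw_deriv 0 a b (of_real c) (of_real (real m)) / 2
    = (\<Sum>i. pw_rem 0 a b c (real (m + i)))
      - (\<Sum>r=1..q. (-1) ^ (r - 1) * of_real (poly (em_kernel (Suc r)) 0) * pw_deriv r a b (of_real c) (of_real (real m)))
      + (-1) ^ q * (\<Sum>i. pw_rem (Suc q) a b c (real (m + i)))"
proof -
  define F where "F r i = pw_deriv r a b (of_real c) (of_real (real (m + i)))" for r i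
  define \<beta> where "\<beta> r = (-1) ^ (r - 1) * complex_of_real (poly (em_kernel (Suc r)) 0)" for r
  have cell: "(F 0 i + F 0 (Suc i)) / 2 = pw_rem 0 a b c (real (m + i))
     + (\<Sum>r=1..q. \<beta> r * (F r (Suc i) - F r i)) + (-1) ^ q * pw_rem (Suc q) a b c (real (m + i))" for i
    using pw_rem_expand[of "real (m + i)" c a b q] m unfolding F_def \<beta>_def by (simp add: add_ac)
  have sF: "summable (F 0)" unfolding F_def
    using pw_deriv_0_summable[OF m ab] by (rule summable_norm_cancel)
  have sR: "summable (\<lambda>i. pw_rem 0 a b c (real (m + i)))" "summable (\<lambda>i. pw_rem (Suc q) a b c (real (m + i)))"
    using pw_rem_summable[OF m, of a b] ab by (auto intro: summable_norm_cancel)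
  have "(\<lambda>i. (F 0 i + F 0 (Suc i)) / 2) sums ((suminf (F 0) + (suminf (F 0) - F 0 0)) / 2)"
  proof (intro sums_divide sums_add summable_sums sF)
    show "(\<lambda>i. F 0 (Suc i)) sums (suminf (F 0) - F 0 0)"
      using summable_sums[OF sF] by (subst sums_Suc_iff) simp
  qed
  moreover have "(\<lambda>i. \<Sum>r=1..q. \<beta> r * (F r (Suc i) - F r i)) sums (\<Sum>r=1..q. \<beta> r * (0 - F r 0))"
  proof (intro sums_sum sums_mult)
    fix r assume r: "r \<in> {1..q}"
    have "F r \<longlonglongrightarrow> 0" unfolding F_def using m ab by (intro pw_deriv_tendsto_0) auto
    thus "(\<lambda>i. F r (Suc i) - F r i) sums (0 - F r 0)" by (rule telescope_sums)
  qed
  hence "(\<lambda>i. pw_rem 0 a b c (real (m + i)) + (\<Sum>r=1..q. \<beta> r * (F r (Suc i) - F r i)) + (-1) ^ q * pw_rem (Suc q) a b c (real (m + i)))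
    sums ((\<Sum>i. pw_rem 0 a b c (real (m + i))) + (\<Sum>r=1..q. \<beta> r * (0 - F r 0)) + (-1) ^ q * (\<Sum>i. pw_rem (Suc q) a b c (real (m + i))))"
    by (intro sums_add sums_mult summable_sums sR)
  ultimately have "(suminf (F 0) + (suminf (F 0) - F 0 0)) / 2 =
     (\<Sum>i. pw_rem 0 a b c (real (m + i))) + (\<Sum>r=1..q. \<beta> r * (0 - F r 0)) + (-1) ^ q * (\<Sum>i. pw_rem (Suc q) a b c (real (m + i)))"
    unfolding cell by (rule sums_unique2)
  thus ?thesis unfolding F_def \<beta>_def by (simp add: sum_negf field_simps)
qed

text \<open>The region of convergence moves to the left as q grows; this is the source of all
  continuations below.\<close>

lemma pw_rem_infsum:
  fixes e :: real and q :: nat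
  assumes e: "e \<ge> 0" and c: "0 \<le> c" "c \<le> 1"
  defines "A \<equiv> {s. (1 + e) * Re s + real q > 1}"
  shows "(\<lambda>s. \<Sum>\<^sub>\<infinity>i. pw_rem q s (of_real e * s) c (real (1 + i))) holomorphic_on A" (is ?th1)
    and "s \<in> A \<Longrightarrow> ((\<lambda>i. deriv (\<lambda>s. pw_rem q s (of_real e * s) c (real (1 + i))) s) has_sum
            deriv (\<lambda>s. \<Sum>\<^sub>\<infinity>i. pw_rem q s (of_real e * s) c (real (1 + i))) s) UNIV" (is "_ \<Longrightarrow> ?th2")
    and "s \<in> A \<Longrightarrow> (\<Sum>\<^sub>\<infinity>i. pw_rem q s (of_real e * s) c (real (1 + i))) = (\<Sum>i. pw_rem q s (of_real e * s) c (real (1 + i)))"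
proof -
  have A: "open A"
  proof -
    have "A = {s. Re s > (1 - real q) / (1 + e)}" using e unfolding A_def by (auto simp: field_simps)
    thus ?thesis using open_halfspace_Re_gt by metis
  qed
  have bound: "\<exists>r>0. \<exists>M. cball z r \<subseteq> A \<and> M summable_on UNIV \<and>
      (\<forall>i\<in>UNIV. \<forall>w\<in>cball z r. norm (pw_rem q w (of_real e * w) c (real (1 + i))) \<le> M i)" if z: "z \<in> A" for z
  proof -
    obtain r where r: "r > 0" "cball z r \<subseteq> A" using A z by (meson open_contains_cball)
    obtain B where B: "\<And>t. t \<in> {0..1} \<Longrightarrow> \<bar>poly (em_kernel q) t\<bar> \<le> B" using em_kernel_bounded by blast
    have B0: "B \<ge> 0" using B[of 0] by simp
    define N where "N = (1 + e) * (norm z + r)"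
    \<comment> \<open>The exponent at the leftmost point z - r of the disc, where the decay is
      slowest. That this point still lies in \<open>A\<close> gives p < -1.\<close>
    define p where "p = - ((1 + e) * (Re z - r)) - real q"
    have "z - of_real r \<in> cball z r" using r by (simp add: dist_norm)
    hence "z - of_real r \<in> A" using r by blast
    hence p: "p < -1" unfolding p_def A_def by (simp add: algebra_simps)
    have N: "N \<ge> 0" using e r unfolding N_def by simp
    define M where "M i = B * pw_const q N * real (1 + i) powr p" for i
    have "M summable_on UNIV"
    proof (rule norm_summable_imp_summable_on)
      have "summable M" unfolding M_def by (intro summable_mult summable_powr_shift p)
      moreover have "norm (M i) = M i" for i using B0 N unfolding M_def by (simp add: pw_const_nonneg abs_mult)
      ultimately show "summable (\<lambda>i. norm (M i))" by presburger
    qed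
    moreover have "norm (pw_rem q w (of_real e * w) c (real (1 + i))) \<le> M i" if w: "w \<in> cball z r" for i w
    proof -
      have nw: "norm w \<le> norm z + r" using w norm_triangle_ineq2[of w z] by (simp add: dist_norm norm_minus_commute)
      have 1: "norm w \<le> N" "norm (complex_of_real e * w) \<le> N"
      proof -
        have "norm w + e * norm w \<le> N" using mult_left_mono[OF nw, of "1 + e"] e unfolding N_def by (simp add: algebra_simps)
        thus "norm w \<le> N" "norm (complex_of_real e * w) \<le> N" using e
          by (auto simp: norm_mult intro: order_trans[rotated] add_nonneg_nonneg)
      qed
      have "w \<in> A" using r w by blast
      hence "Re w + Re (complex_of_real e * w) + real q \<ge> 0" unfolding A_def by (simp add: algebra_simps)
      hence "norm (pw_rem q w (of_real e * w) c (real (1 + i))) \<le> B * pw_const q N * real (1 + i) powr (-(Re w + Re (complex_of_real e * w)) - real q)"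
        by (intro norm_pw_rem_le) (use c 1 B in auto)
      also have "\<dots> \<le> B * pw_const q N * real (1 + i) powr p"
      proof -
        have "Re z - r \<le> Re w" using w abs_Re_le_cmod[of "z - w"] by (simp add: dist_norm)
        from mult_left_mono[OF this, of "1 + e"] e
        have "-(Re w + Re (complex_of_real e * w)) - real q \<le> p" unfolding p_def by (simp add: algebra_simps)
        thus ?thesis using B0 N by (intro mult_left_mono powr_mono) (auto intro!: mult_nonneg_nonneg pw_const_nonneg)
      qed
      finally show ?thesis unfolding M_def .
    qed
    ultimately show ?thesis using r by blast
  qed
  have hol: "(\<lambda>s. pw_rem q s (of_real e * s) c (real (1 + i))) holomorphic_on A" for i
    using c by (intro pw_rem_holomorphic) auto
  note H = holomorphic_infsum[of A UNIV "\<lambda>i s. pw_rem q s (of_real e * s) c (real (1 + i))", OF A hol bound]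
  show ?th1 by (rule H(1))
  show ?th2 if "s \<in> A" using H(2)[OF _ that] by simp
  show "(\<Sum>\<^sub>\<infinity>i. pw_rem q s (of_real e * s) c (real (1 + i))) = (\<Sum>i. pw_rem q s (of_real e * s) c (real (1 + i)))" if "s \<in> A"
  proof -
    have "summable (\<lambda>i. norm (pw_rem q s (of_real e * s) c (real (1 + i))))"
      using that c unfolding A_def by (intro pw_rem_summable) (auto simp: algebra_simps)
    from norm_summable_imp_has_sum[OF this summable_sums[OF summable_norm_cancel[OF this]]]
    show ?thesis by (rule infsumI)
  qed
qed

section \<open>Zeta by Euler-Maclaurin: continuation and data at 1 and -1\<close>

lemma pw_deriv_0_0 [simp]: "w \<noteq> 0 \<Longrightarrow> pw_deriv 0 a 0 0 w = w powr (-a)"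
  by simp

lemma pw_rem_0_closed:
  assumes "k > 0" "s \<noteq> 1"
  shows "pw_rem 0 s 0 0 k = (of_real k powr (1 - s) - of_real (k + 1) powr (1 - s)) / (s - 1)"
proof -
  have "((\<lambda>t. pw_deriv 0 s 0 (of_real 0) (of_real (k + t))) has_integral
      (of_real (k + 1) powr (1 - s) / (1 - s) - of_real (k + 0) powr (1 - s) / (1 - s))) {0..1}"
  proof (rule fundamental_theorem_of_calculus[where f = "\<lambda>t. of_real (k + t) powr (1 - s) / (1 - s)"])
    fix t :: real assume t: "t \<in> {0..1}"
    have "complex_of_real (k + t) \<notin> \<real>\<^sub>\<le>\<^sub>0" using t assms by (subst complex_nonpos_Reals_iff) auto
    hence "((\<lambda>w. (of_real k + w) powr (1 - s) / (1 - s)) has_field_derivative (of_real (k + t)) powr (- s)) (at (of_real t))"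
      using assms by (auto intro!: derivative_eq_intros)
    from has_vector_derivative_real_field[OF this] t assms
    show "((\<lambda>t. of_real (k + t) powr (1 - s) / (1 - s)) has_vector_derivative
            pw_deriv 0 s 0 (of_real 0) (of_real (k + t))) (at t within {0..1})"
      by (simp flip: of_real_add)
  qed simp
  from integral_unique[OF this] show ?thesis using assms
    unfolding pw_rem_def em_rem_def by (simp add: divide_simps) (simp add: algebra_simps)
qed

text \<open>The cell integrals add up to the integral of y^(-s) over [1, infinity), which supplies
  the pole of zeta.\<close>

lemma pw_rem_0_sum:
  assumes "Re s > 1"
  shows "(\<Sum>i. pw_rem 0 s 0 0 (real (1 + i))) = 1 / (s - 1)"
proof -
  have "s \<noteq> 1" using assms by auto
  define F where "F i = complex_of_real (real (1 + i)) powr (1 - s) / (s - 1)" for i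
  have "(\<lambda>i. pw_deriv 0 (s - 1) 0 (of_real 0) (of_real (real (1 + i)))) \<longlonglongrightarrow> 0"
    by (rule pw_deriv_tendsto_0) (use assms in auto)
  hence "(\<lambda>i. complex_of_real (real (1 + i)) powr (1 - s)) \<longlonglongrightarrow> 0"
  proof -
    have "pw_deriv 0 (s - 1) 0 (of_real 0) (complex_of_real (real (1 + i))) = complex_of_real (real (1 + i)) powr (1 - s)" for i
    proof -
      have "complex_of_real (real (1 + i)) \<noteq> 0" by (simp only: of_real_eq_0_iff of_nat_eq_0_iff)
      from pw_deriv_0_0[OF this, of "s - 1"] show ?thesis by (simp only: of_real_0 minus_diff_eq)
    qed
    with \<open>_ \<longlonglongrightarrow> 0\<close> show ?thesis by (simp only: )
  qed
  hence "F \<longlonglongrightarrow> 0 / (s - 1)" unfolding F_def by (intro tendsto_divide) (use \<open>s \<noteq> 1\<close> in auto)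
  hence "(\<lambda>i. F i - F (Suc i)) sums (F 0 - 0 / (s - 1))" by (intro telescope_sums') simp
  moreover have "F i - F (Suc i) = pw_rem 0 s 0 0 (real (1 + i))" for i
    using pw_rem_0_closed[of "real (1 + i)" s] \<open>s \<noteq> 1\<close> unfolding F_def by (simp add: diff_divide_distrib add_ac)
  ultimately show ?thesis by (simp add: sums_iff F_def)
qed

text \<open>The Euler-Maclaurin expression of order q for zeta(s) - 1/(s - 1), holomorphic for Re s
  > -q.\<close>

definition zeta_em :: "nat \<Rightarrow> complex \<Rightarrow> complex" where
  "zeta_em q s = 1 / 2 - (\<Sum>r=1..q. (-1) ^ (r - 1) * of_real (poly (em_kernel (Suc r)) 0) * pw_deriv r s 0 0 1)
      + (-1) ^ q * (\<Sum>\<^sub>\<infinity>i. pw_rem (Suc q) s 0 0 (real (1 + i)))"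

definition zeta_series :: "complex \<Rightarrow> complex" where
  "zeta_series = (\<lambda>s. \<Sum>n. of_nat (Suc n) powr (-s))"

lemma pw_rem_infsum_eq_suminf:
  assumes "Re s + real q > 1"
  shows "(\<Sum>\<^sub>\<infinity>i. pw_rem q s 0 0 (real (1 + i))) = (\<Sum>i. pw_rem q s 0 0 (real (1 + i)))"
  using pw_rem_infsum(3)[of 0 0 s q] assms by simp

lemma zeta_em_holomorphic: "zeta_em q holomorphic_on {s. Re s > - real q}"
proof -
  have "(\<lambda>s. \<Sum>\<^sub>\<infinity>i. pw_rem (Suc q) s (of_real 0 * s) 0 (real (1 + i))) holomorphic_on {s. Re s > - real q}"
    by (rule holomorphic_on_subset[OF pw_rem_infsum(1)]) auto
  hence "(\<lambda>s. \<Sum>\<^sub>\<infinity>i. pw_rem (Suc q) s 0 0 (real (1 + i))) holomorphic_on {s. Re s > - real q}"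
    by simp
  thus ?thesis unfolding zeta_em_def by (intro holomorphic_intros) auto
qed

lemma zeta_series_eq:
  assumes "Re s > 1"
  shows "zeta_series s = 1 / (s - 1) + zeta_em q s"
proof -
  have "(\<Sum>i. pw_deriv 0 s 0 (of_real 0) (of_real (real (1 + i)))) = zeta_series s"
    unfolding zeta_series_def by (simp flip: of_nat_Suc)
  moreover have "pw_deriv 0 s 0 (of_real 0) (of_real (real 1)) = 1" by simp
  moreover define S where "S = (\<Sum>r=1..q. (-1) ^ (r - 1) * of_real (poly (em_kernel (Suc r)) 0) * pw_deriv r s 0 0 1)"
  moreover define T where "T = (-1) ^ q * (\<Sum>\<^sub>\<infinity>i. pw_rem (Suc q) s 0 0 (real (1 + i)))"
  ultimately have "zeta_series s - 1 / 2 = 1 / (s - 1) - S + T"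
    using euler_maclaurin_series[of 1 0 s 0 q] pw_rem_0_sum[OF assms] assms
      pw_rem_infsum_eq_suminf[of s "Suc q"] by (simp del: pw_deriv.simps)
  thus ?thesis unfolding zeta_em_def S_def [symmetric] T_def [symmetric] by (simp add: algebra_simps)
qed

lemma zeta_series_holomorphic: "zeta_series holomorphic_on {s. Re s > 1}"
proof (rule holomorphic_transform)
  show "(\<lambda>s. 1 / (s - 1) + zeta_em 0 s) holomorphic_on {s. Re s > 1}"
    by (intro holomorphic_intros holomorphic_on_subset[OF zeta_em_holomorphic]) auto
qed (use zeta_series_eq in auto)

lemma zeta_em_meromorphic: "(\<lambda>s. 1 / (s - 1) + zeta_em q s) meromorphic_on {s. Re s > - real q}"
  by (intro meromorphic_intros analytic_on_imp_meromorphic_on[of "zeta_em q"])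
     (use zeta_em_holomorphic in \<open>simp add: analytic_on_open open_halfspace_Re_gt\<close>)

lemma zeta_is_continuation: "is_meromorphic_continuation {s. Re s > 1} zeta_series zeta"
  unfolding zeta_def zeta_series_def [symmetric]
proof (rule meromorphic_continuation_halfplane)
  fix n
  show "\<exists>F. F meromorphic_on {s. - real n < Re s} \<and> (\<forall>s. 1 < Re s \<longrightarrow> F s = zeta_series s)"
  proof (intro exI conjI allI impI)
    show "(\<lambda>s. 1 / (s - 1) + zeta_em n s) meromorphic_on {s. - real n < Re s}"
      by (rule zeta_em_meromorphic)
  qed (rule zeta_series_eq [symmetric])
qed (simp_all add: zeta_series_holomorphic)

lemma zeta_eq_series: "Re s > 1 \<Longrightarrow> zeta s = zeta_series s"
  using zeta_is_continuation by (auto simp: is_meromorphic_continuation_def)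

lemma zeta_meromorphic: "zeta meromorphic_on A"
  using zeta_is_continuation meromorphic_on_subset[of zeta UNIV A]
  unfolding is_meromorphic_continuation_def nicely_meromorphic_on_def by simp

lemma zeta_eq:
  assumes "Re s > - real q" "s \<noteq> 1"
  shows "zeta s = 1 / (s - 1) + zeta_em q s"
proof (rule meromorphic_continuation_eq[OF zeta_is_continuation])
  show "(\<lambda>s. 1 / (s - 1) + zeta_em q s) analytic_on {s}"
  proof (intro analytic_intros)
    show "zeta_em q analytic_on {s}"
      by (rule analytic_on_subset[of _ "{s. Re s > - real q}"])
         (use zeta_em_holomorphic[of q] assms in \<open>auto simp: analytic_on_open open_halfspace_Re_gt\<close>)
  qed (use assms in auto)
  show "(\<lambda>s. 1 / (s - 1) + zeta_em q s) meromorphic_on {s. Re s > - real q}"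
    by (rule zeta_em_meromorphic)
  show "1 / (w - 1) + zeta_em q w = zeta_series w" if "Re w > 1" for w
    using zeta_series_eq[OF that] by simp
qed (use assms zeta_series_holomorphic in auto)

text \<open>Not the Dirichlet eta function, but zeta(s) - 1/(s - 1) on Re s > -2. Order 2 reaches
  both the point -1 and the line Re s = -3/2.\<close>

abbreviation eta :: "complex \<Rightarrow> complex" where "eta \<equiv> zeta_em 2"

text \<open>Only the r = 1 correction survives, with coefficient B_2 / 2! = 1/12; the r = 2 term
  vanishes since \<open>em_kernel 3\<close> is 0 at 0.\<close>

lemma eta_eq: "eta s = 1 / 2 + s / 12 + (\<Sum>\<^sub>\<infinity>i. pw_rem 3 s 0 0 (real (1 + i)))"
proof -
  have "{1..2::nat} = {1, 2}" by auto
  hence "(\<Sum>r=1..2. (-1) ^ (r - 1) * of_real (poly (em_kernel (Suc r)) 0) * pw_deriv r s 0 0 1) = - s / 12"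
    using em_kernel_2 em_kernel_3 by (simp add: numeral_3_eq_3 numeral_2_eq_2)
  thus ?thesis unfolding zeta_em_def by (simp add: numeral_3_eq_3 numeral_2_eq_2)
qed

lemma zeta_eq_eta: "Re s > -2 \<Longrightarrow> s \<noteq> 1 \<Longrightarrow> zeta s = 1 / (s - 1) + eta s"
  using zeta_eq[of 2 s] by simp

lemma eta_has_field_derivative: "Re s > -2 \<Longrightarrow> (eta has_field_derivative deriv eta s) (at s)"
  using zeta_em_holomorphic[of 2] by (intro holomorphic_derivI[of _ "{s. Re s > -2}"]) (auto simp: open_halfspace_Re_gt)

lemma zeta_has_field_derivative:
  assumes "Re s > -2" "s \<noteq> 1"
  shows "(zeta has_field_derivative (- 1 / (s - 1)^2 + deriv eta s)) (at s)"
proof (rule has_field_derivative_transform_within_open)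
  show "((\<lambda>s. 1 / (s - 1) + eta s) has_field_derivative (- 1 / (s - 1)^2 + deriv eta s)) (at s)"
    using assms by (auto intro!: derivative_eq_intros eta_has_field_derivative simp: power2_eq_square)
  show "open ({s. Re s > -2} - {1})" by (auto simp: open_halfspace_Re_gt)
qed (use assms zeta_eq_eta in auto)

text \<open>\<open>pw_rem_expand\<close> with q = 2 solved for the remainder. In this form the
  remainder can be evaluated at s = 1 and differentiated at s = -1.\<close>

lemma pw_rem_3_eq:
  assumes "k > 0"
  shows "pw_rem 3 s 0 0 k = (of_real k powr (-s) + of_real (k + 1) powr (-s)) / 2 - pw_rem 0 s 0 0 k
     + s / 12 * (of_real (k + 1) powr (-(s + 1)) - of_real k powr (-(s + 1)))"
proof -
  have "{1..2::nat} = {1, 2}" by auto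
  moreover have "complex_of_real k \<noteq> 0" "complex_of_real (k + 1) \<noteq> 0" using assms by (simp_all del: of_real_add)
  ultimately have "(of_real k powr (-s) + of_real (k + 1) powr (-s)) / 2 = pw_rem 0 s 0 0 k
     - s / 12 * of_real (k + 1) powr (-(s + 1)) + s / 12 * of_real k powr (-(s + 1)) + pw_rem 3 s 0 0 k"
    using pw_rem_expand[of k 0 s 0 2] assms em_kernel_2 em_kernel_3
    by (simp add: numeral_3_eq_3 numeral_2_eq_2 algebra_simps)
  thus ?thesis by (simp add: algebra_simps)
qed

lemma pw_deriv_3_0:
  assumes "w \<noteq> 0"
  shows "pw_deriv 3 s 0 0 w = - (s * (s + 1) * (s + 2)) * w powr (-s-3)"
proof -
  have "s + 1 + 1 + 1 = -(-s-3)" "s + 1 + 1 = s + 2" by simp_all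
  thus ?thesis using assms by (simp add: numeral_3_eq_3 algebra_simps)
qed

text \<open>For s = -1 the summand is linear in y, so its third derivative and all remainders
  vanish, leaving -1/2 + 1/2 - 1/12.\<close>

lemma zeta_minus_1: "zeta (-1) = - 1 / 12"
proof -
  have "pw_rem 3 (-1) 0 0 (real (1 + i)) = 0" for i
  proof -
    have "integral {0..1} (\<lambda>t. of_real (poly (em_kernel 3) t) * pw_deriv 3 (-1) 0 (of_real 0) (of_real (real (1 + i) + t))) 
        = integral {0..1} (\<lambda>t::real. 0 :: complex)"
    proof (rule integral_cong)
      fix t :: real assume "t \<in> {0..1}"
      hence "complex_of_real (real (1 + i) + t) \<noteq> 0" by (simp del: of_real_add)
      from pw_deriv_3_0[OF this, of "-1"]
      show "of_real (poly (em_kernel 3) t) * pw_deriv 3 (-1) 0 (of_real 0) (of_real (real (1 + i) + t)) = 0" by simp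
    qed
    thus ?thesis by (simp add: pw_rem_def em_rem_def)
  qed
  hence "(\<Sum>\<^sub>\<infinity>i. pw_rem 3 (-1) 0 0 (real (1 + i))) = 0" by simp
  moreover have "(- 1 :: complex) \<noteq> 1" by auto
  ultimately show ?thesis using zeta_eq_eta[of "-1"] eta_eq[of "-1"] by simp
qed

text \<open>At s = 1 the remainders are the increments of H_n - ln n - 1/(2 n) + 1/(12 n^2), which
  tends to gamma. The initial value 1/2 + 1/12 cancels the explicit terms of
  \<open>eta_eq\<close>.\<close>

lemma eta_1: "eta 1 = of_real euler_mascheroni"
proof -
  define P :: "nat \<Rightarrow> real" where "P n = harm n - 1 / (2 * n) - ln n + 1 / (12 * n^2)" for n
  have cell: "pw_rem 3 1 0 0 (real (1 + i)) = of_real (P (Suc (Suc i)) - P (Suc i))" for i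
  proof -
    define k where "k = real (1 + i)"
    have k: "k > 0" by (simp add: k_def)
    have "((\<lambda>t. complex_of_real (1 / (k + t))) has_integral of_real (ln (k + 1) - ln (k + 0))) {0..1}"
    proof (rule has_integral_of_real)
      show "((\<lambda>t. 1 / (k + t)) has_integral (ln (k + 1) - ln (k + 0))) {0..1}"
        by (rule fundamental_theorem_of_calculus)
           (use k in \<open>auto intro!: derivative_eq_intros simp flip: has_real_derivative_iff_has_vector_derivative\<close>)
    qed
    moreover have eq: "pw_deriv 0 1 0 (of_real 0) (of_real (k + t)) = complex_of_real (1 / (k + t))" if "t \<in> {0..1}" for t
      using k that by (simp add: powr_minus_divide del: of_real_add)
    have "pw_rem 0 1 0 0 k = integral {0..1} (\<lambda>t. complex_of_real (1 / (k + t)))"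
      unfolding pw_rem_def em_rem_def
      by (intro integral_cong) (simp only: em_kernel.simps(1) poly_1 of_real_1 mult_1 eq)
    ultimately have r0: "pw_rem 0 1 0 0 k = of_real (ln (k + 1) - ln k)"
      by (simp add: integral_unique del: of_real_divide of_real_add)
    have "pw_rem 3 1 0 0 k = of_real ((1 / k + 1 / (k + 1)) / 2 - (ln (k + 1) - ln k) + 1 / 12 * (1 / (k + 1)^2 - 1 / k^2))"
    proof -
      have "complex_of_real x powr - 1 = of_real (1 / x)" "complex_of_real x powr (- (1 + 1)) = of_real (1 / x^2)" if "x > 0" for x
        using that powr_minus_divide[of "complex_of_real x" 2] by (simp_all add: powr_minus_divide)
      from this[of k] this[of "k + 1"] show ?thesis
        using k pw_rem_3_eq[of k 1] r0 by (simp del: of_real_add) simp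
    qed
    also have "(1 / k + 1 / (k + 1)) / 2 - (ln (k + 1) - ln k) + 1 / 12 * (1 / (k + 1)^2 - 1 / k^2) = P (Suc (Suc i)) - P (Suc i)"
    proof -
      have r: "real (Suc i) = k" "real (Suc (Suc i)) = k + 1" by (simp_all add: k_def)
      have d: "1 / (2 * x) = (1 / x) / 2" "1 / (12 * x^2) = (1 / x^2) / 12" for x :: real by simp_all
      have "(u + v) / 2 - (y - x) + 1 / 12 * (w - z) = h + v - v / 2 - y + w / 12 - (h - u / 2 - x + z / 12)"
        for u v w x y z h :: real by (simp add: field_simps)
      thus ?thesis unfolding P_def harm_Suc[of "Suc i"] r d inverse_eq_divide .
    qed
    finally show ?thesis unfolding k_def .
  qed
  have "(\<lambda>n. 1 / (2 * real n)) \<longlonglongrightarrow> 0" "(\<lambda>n. 1 / (12 * (real n)\<^sup>2)) \<longlonglongrightarrow> 0" by real_asymp+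
  from tendsto_add[OF tendsto_diff[OF euler_mascheroni_LIMSEQ this(1)] this(2)]
  have "P \<longlonglongrightarrow> euler_mascheroni" unfolding P_def by (simp add: algebra_simps)
  hence "(\<lambda>n. P (Suc n)) \<longlonglongrightarrow> euler_mascheroni" by (simp add: filterlim_sequentially_Suc)
  hence "(\<lambda>n. P (Suc (Suc n)) - P (Suc n)) sums (euler_mascheroni - P (Suc 0))" by (rule telescope_sums)
  hence "(\<lambda>n. complex_of_real (P (Suc (Suc n)) - P (Suc n))) sums of_real (euler_mascheroni - P (Suc 0))" by (rule sums_of_real)
  hence "(\<lambda>i. pw_rem 3 1 0 0 (real (1 + i))) sums of_real (euler_mascheroni - P (Suc 0))" unfolding cell .
  moreover have "P (Suc 0) = 1/2 + 1/12" by (simp add: P_def harm_expand)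
  ultimately show ?thesis using pw_rem_infsum_eq_suminf[of 1 3] eta_eq[of 1] by (simp add: sums_iff)
qed

lemma of_real_powr_exp: "k > 0 \<Longrightarrow> complex_of_real k powr z = exp (z * of_real (ln k))"
  by (simp add: powr_def Ln_of_real)

lemma exp_of_real_ln: "k > 0 \<Longrightarrow> exp (of_real (ln k)) = (of_real k :: complex)"
  by (simp add: exp_of_real)

text \<open>Its limit is 1/12 - ln A with A the Glaisher-Kinkelin constant, which is zeta'(-1);
  \<open>deriv_zeta_minus_1\<close> proves the identification with zeta'(-1).\<close>

definition glaisher_seq :: "nat \<Rightarrow> real" where
  "glaisher_seq n = - (\<Sum>k=1..n. real k * ln (real k))
     + (real n ^ 2 / 2 + real n / 2 + 1 / 12) * ln (real n) - real n ^ 2 / 4 + 1 / 12"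

text \<open>Differentiates the closed form of the remainder, which is available near -1 because that
  point stays away from the excluded s = 1.\<close>

lemma deriv_pw_rem_3_minus_1:
  fixes k :: real
  assumes k: "k > 0"
  defines "P \<equiv> \<lambda>x::real. (x ^ 2 / 2 + 1 / 12) * ln x - x ^ 2 / 4 + 1 / 12"
  shows "deriv (\<lambda>s. pw_rem 3 s 0 0 k) (-1) =
     of_real (- (k * ln k + (k + 1) * ln (k + 1)) / 2 + P (k + 1) - P k)"
proof -
  define a b where "a = complex_of_real (ln k)" and "b = complex_of_real (ln (k + 1))"
  define F where "F s = (exp (-s * a) + exp (-s * b)) / 2 - (exp ((1 - s) * a) - exp ((1 - s) * b)) / (s - 1)
     + s / 12 * (exp (-(s + 1) * b) - exp (-(s + 1) * a))" for s
  have eq: "F s = pw_rem 3 s 0 0 k" if "s \<in> - {1}" for s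
  proof -
    have "s \<noteq> 1" "k + 1 > 0" using that k by auto
    thus ?thesis unfolding F_def a_def b_def pw_rem_3_eq[OF k] pw_rem_0_closed[OF k \<open>s \<noteq> 1\<close>]
        of_real_powr_exp[OF k] of_real_powr_exp[OF \<open>k + 1 > 0\<close>] by simp
  qed
  have ea: "exp a = of_real k" "exp b = of_real (k + 1)"
    using k exp_of_real_ln[of k] exp_of_real_ln[of "k + 1"] by (simp_all add: a_def b_def)
  have ea2: "exp (2 * a) = of_real k ^ 2" "exp (2 * b) = of_real (k + 1) ^ 2"
    by (simp_all add: exp_double ea)
  have "(F has_field_derivative (-a * exp a + -b * exp b) / 2
      - ((-a * exp (2 * a) + b * exp (2 * b)) * (-2) - (exp (2 * a) - exp (2 * b))) / 4
      + (0 / 12 + -1 / 12 * (a - b))) (at (-1))"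
    unfolding F_def
    by (auto intro!: derivative_eq_intros simp: algebra_simps add_divide_distrib diff_divide_distrib)
  hence "((\<lambda>s. pw_rem 3 s 0 0 k) has_field_derivative (-a * exp a + -b * exp b) / 2
      - ((-a * exp (2 * a) + b * exp (2 * b)) * (-2) - (exp (2 * a) - exp (2 * b))) / 4
      + (0 / 12 + -1 / 12 * (a - b))) (at (-1))"
    by (rule has_field_derivative_transform_within_open[where S = "- {1}"]) (use eq in auto)
  note DERIV_imp_deriv[OF this]
  also have "(-a * exp a + -b * exp b) / 2
      - ((-a * exp (2 * a) + b * exp (2 * b)) * (-2) - (exp (2 * a) - exp (2 * b))) / 4
      + (0 / 12 + -1 / 12 * (a - b)) =
      of_real (- (k * ln k + (k + 1) * ln (k + 1)) / 2 + P (k + 1) - P k)"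
    unfolding ea ea2 by (simp add: a_def b_def P_def field_simps power2_eq_square)
  finally show ?thesis .
qed

text \<open>Termwise differentiation turns the remainder series into the telescoping series of
  increments of \<open>glaisher_seq\<close>. The starting value -1/4 + 1/12 is exactly what 1/(s -
  1) and s/12 contribute to the derivative at -1.\<close>

lemma deriv_zeta_minus_1:
  obtains z where "deriv zeta (-1) = of_real z" "glaisher_seq \<longlonglongrightarrow> z"
proof -
  define f where "f i s = pw_rem 3 s 0 0 (real (1 + i))" for i s
  define P :: "real \<Rightarrow> real" where "P x = (x ^ 2 / 2 + 1 / 12) * ln x - x ^ 2 / 4 + 1 / 12" for x
  have m1: "-1 \<in> {s. (1 + 0) * Re s + real 3 > 1}" by simp
  have hol: "(\<lambda>s. \<Sum>\<^sub>\<infinity>i. f i s) holomorphic_on {s. (1 + 0) * Re s + real 3 > 1}"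
    using pw_rem_infsum(1)[of 0 0 3] unfolding f_def by simp
  have op: "open {s. (1 + 0) * Re s + real 3 > 1}"
  proof -
    have "{s. (1 + 0) * Re s + real 3 > 1} = {s. Re s > -2}" by auto
    thus ?thesis by (simp add: open_halfspace_Re_gt)
  qed
  define L where "L = deriv (\<lambda>s. \<Sum>\<^sub>\<infinity>i. f i s) (-1)"
  have hs: "((\<lambda>i. deriv (f i) (-1)) has_sum L) UNIV"
    using pw_rem_infsum(2)[OF _ _ _ m1, of 0] unfolding f_def L_def by simp
  have d: "deriv (f i) (-1) = of_real (glaisher_seq (Suc (Suc i)) - glaisher_seq (Suc i))" for i
  proof -
    define k where "k = real (1 + i)"
    have r: "real (Suc i) = k" "real (Suc (Suc i)) = k + 1" by (simp_all add: k_def)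
    have "deriv (f i) (-1) = of_real (- (k * ln k + (k + 1) * ln (k + 1)) / 2 + P (k + 1) - P k)"
      using deriv_pw_rem_3_minus_1[of k] unfolding f_def k_def P_def by simp
    also have "- (k * ln k + (k + 1) * ln (k + 1)) / 2 + P (k + 1) - P k = glaisher_seq (Suc (Suc i)) - glaisher_seq (Suc i)"
      unfolding glaisher_seq_def P_def sum.cl_ivl_Suc[of _ 1 "Suc i"] r
      by (simp add: algebra_simps add_divide_distrib diff_divide_distrib r)
    finally show ?thesis .
  qed
  have lim: "(\<lambda>n. complex_of_real (glaisher_seq (Suc n) - glaisher_seq (Suc 0))) \<longlonglongrightarrow> L"
  proof -
    have "(\<lambda>n. \<Sum>i<n. deriv (f i) (-1)) \<longlonglongrightarrow> L"
      using has_sum_imp_sums[OF hs] by (simp add: sums_def)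
    also have "(\<lambda>n. \<Sum>i<n. deriv (f i) (-1)) = (\<lambda>n. complex_of_real (glaisher_seq (Suc n) - glaisher_seq (Suc 0)))"
      unfolding d of_real_sum [symmetric] by (subst sum_lessThan_telescope[where f = "\<lambda>n. glaisher_seq (Suc n)"]) rule
    finally show ?thesis .
  qed
  have limR: "(\<lambda>n. glaisher_seq (Suc n) - glaisher_seq (Suc 0)) \<longlonglongrightarrow> Re L"
    using tendsto_Re[OF lim] by simp
  \<comment> \<open>A limit of real numbers is real, so zeta'(-1) is real.\<close>
  have L: "L = of_real (Re L)"
    using tendsto_unique[OF _ lim tendsto_of_real[OF limR]] by simp
  from tendsto_add[OF limR tendsto_const[of "glaisher_seq (Suc 0)"]]
  have "glaisher_seq \<longlonglongrightarrow> Re L + glaisher_seq (Suc 0)"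
    by (simp add: filterlim_sequentially_Suc)
  moreover have "glaisher_seq (Suc 0) = -1 / 4 + 1 / 12" by (simp add: glaisher_seq_def)
  moreover have "deriv zeta (-1) = of_real (Re L + (-1 / 4 + 1 / 12))"
  proof -
    have "((\<lambda>s. \<Sum>\<^sub>\<infinity>i. f i s) has_field_derivative L) (at (-1))"
      unfolding L_def using hol op m1 by (rule holomorphic_derivI)
    hence "(eta has_field_derivative (0 + 1 / 12 + L)) (at (-1))"
      unfolding eta_eq[abs_def] f_def by (auto intro!: derivative_eq_intros)
    hence "deriv eta (-1) = 1 / 12 + L" by (simp add: DERIV_imp_deriv)
    moreover have "(-1 :: complex) \<noteq> 1" by simp
    ultimately have "deriv zeta (-1) = - 1 / 4 + (1 / 12 + L)"
      using DERIV_imp_deriv[OF zeta_has_field_derivative[of "-1"]] by simp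
    thus ?thesis using L by simp
  qed
  ultimately show ?thesis by (intro that[of "Re L + (-1 / 4 + 1 / 12)"]) simp_all
qed

section \<open>The Fourier transform of sech\<close>

lemma integrable_inverse_1_plus_square_lborel: "integrable lborel (\<lambda>x::real. inverse (1 + x ^ 2))"
  using integrable_inverse_1_plus_square by (simp add: set_integrable_def)

text \<open>Makes sech beat every polynomial with an integrable factor 1 / (1 + t^2) to spare. The
  key inequality is (1 + |t|/N)^N <= exp |t| with N = m + 2.\<close>

lemma power_le_cosh: "(1 + \<bar>t\<bar>) ^ m * (1 + t ^ 2) \<le> 2 * real (m + 2) ^ (m + 2) * cosh (pi * t)"
proof -
  have "(1 + \<bar>t\<bar>) ^ m * (1 + t ^ 2) \<le> (1 + \<bar>t\<bar>) ^ m * (1 + \<bar>t\<bar>) ^ 2"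
    by (intro mult_left_mono) (auto simp: power2_sum)
  also have "\<dots> = (1 + \<bar>t\<bar>) ^ (m + 2)" by (simp only: power_add)
  also have "\<dots> \<le> (real (m + 2) * (1 + \<bar>t\<bar> / real (m + 2))) ^ (m + 2)"
    by (intro power_mono) (auto simp: field_simps)
  also have "\<dots> = real (m + 2) ^ (m + 2) * (1 + \<bar>t\<bar> / real (m + 2)) ^ (m + 2)"
    by (rule power_mult_distrib)
  finally have 1: "(1 + \<bar>t\<bar>) ^ m * (1 + t ^ 2) \<le> real (m + 2) ^ (m + 2) * (1 + \<bar>t\<bar> / real (m + 2)) ^ (m + 2)" .
  have "(1 + \<bar>t\<bar> / real (m + 2)) ^ (m + 2) \<le> exp \<bar>t\<bar>"
    by (rule exp_ge_one_plus_x_over_n_power_n) auto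
  also have "exp \<bar>t\<bar> \<le> exp (pi * \<bar>t\<bar>)"
    using pi_gt3 mult_right_mono[of 1 pi "\<bar>t\<bar>"] by simp
  also have "\<dots> \<le> 2 * cosh (pi * t)"
    by (cases "t \<ge> 0") (auto simp: cosh_def)
  finally have "real (m + 2) ^ (m + 2) * (1 + \<bar>t\<bar> / real (m + 2)) ^ (m + 2) \<le> real (m + 2) ^ (m + 2) * (2 * cosh (pi * t))"
    by (intro mult_left_mono) auto
  with 1 show ?thesis by (simp only: mult_ac)
qed

lemma sech_integrable:
  fixes f :: "real \<Rightarrow> complex"
  assumes [measurable]: "f \<in> borel_measurable borel" and f: "\<And>t. norm (f t) \<le> K * (1 + \<bar>t\<bar>) ^ m"
  shows "integrable lborel (\<lambda>t. f t / of_real (cosh (pi * t)))"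
proof (rule Bochner_Integration.integrable_bound)
  define C where "C = 2 * real (m + 2) ^ (m + 2)"
  show "integrable lborel (\<lambda>t::real. K * C * inverse (1 + t ^ 2))"
    by (intro integrable_mult_right integrable_inverse_1_plus_square_lborel)
  have K: "K \<ge> 0" by (rule order_trans[OF norm_ge_zero[of "f 0"]]) (use f[of 0] in simp)
  show "AE t in lborel. norm (f t / of_real (cosh (pi * t))) \<le> norm (K * C * inverse (1 + t ^ 2))"
  proof (rule AE_I2)
    fix t :: real
    have p: "1 + t ^ 2 > 0" by (simp add: add_pos_nonneg)
    have "(1 + \<bar>t\<bar>) ^ m / cosh (pi * t) \<le> C / (1 + t ^ 2)"
      using power_le_cosh[of t m] p by (simp add: C_def field_simps)
    hence "K * ((1 + \<bar>t\<bar>) ^ m / cosh (pi * t)) \<le> K * (C / (1 + t ^ 2))" using K by (rule mult_left_mono)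
    moreover have "norm (f t / of_real (cosh (pi * t))) \<le> K * ((1 + \<bar>t\<bar>) ^ m / cosh (pi * t))"
      by (simp add: norm_divide divide_right_mono f)
    moreover have "K * (C / (1 + t ^ 2)) \<le> norm (K * C * inverse (1 + t ^ 2))"
      unfolding real_norm_def by (rule order_trans[OF _ abs_ge_self]) (simp add: divide_inverse)
    ultimately show "norm (f t / of_real (cosh (pi * t))) \<le> norm (K * C * inverse (1 + t ^ 2))"
      by linarith
  qed
  have [measurable]: "(\<lambda>t. cosh (pi * t)) \<in> borel_measurable borel"
    by (intro borel_measurable_continuous_onI continuous_intros)
  show "(\<lambda>t. f t / complex_of_real (cosh (pi * t))) \<in> borel_measurable lborel"
    by measurable
qed

text \<open>Reduces integrals over the line to compact intervals, where primitives apply.\<close>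

lemma integral_symmetric_tendsto:
  fixes f :: "real \<Rightarrow> complex"
  assumes f: "integrable lborel f"
  shows "(\<lambda>n. integral {- real n..real n} f) \<longlonglongrightarrow> (LINT t|lborel. f t)"
proof -
  have "(\<lambda>n. LINT t|lborel. indicator {- real n..real n} t *\<^sub>R f t) \<longlonglongrightarrow> (LINT t|lborel. f t)"
  proof (rule integral_dominated_convergence)
    show "integrable lborel (\<lambda>t. norm (f t))" using f by simp
    show "AE t in lborel. (\<lambda>n. indicator {- real n..real n} t *\<^sub>R f t) \<longlonglongrightarrow> f t"
    proof (rule AE_I2)
      fix t :: real
      have "eventually (\<lambda>n. indicator {- real n..real n} t *\<^sub>R f t = f t) sequentially"
        using eventually_ge_at_top[of "nat \<lceil>\<bar>t\<bar>\<rceil>"]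
      proof eventually_elim
        case (elim n)
        hence "\<bar>t\<bar> \<le> real n" using real_nat_ceiling_ge[of "\<bar>t\<bar>"] by linarith
        thus ?case by (auto simp: indicator_def)
      qed
      thus "(\<lambda>n. indicator {- real n..real n} t *\<^sub>R f t) \<longlonglongrightarrow> f t" by (rule tendsto_eventually)
    qed
    show "AE t in lborel. norm (indicator {- real n..real n} t *\<^sub>R f t) \<le> norm (f t)" for n
      by (rule AE_I2) (auto simp: indicator_def)
  qed (use f in measurable)
  moreover have "(LINT t|lborel. indicator {- real n..real n} t *\<^sub>R f t) = integral {- real n..real n} f" for n
  proof -
    have "set_integrable lborel {- real n..real n} f" unfolding set_integrable_def
      by (rule integrable_mult_indicator[OF _ f]) simp
    from set_borel_integral_eq_integral(2)[OF this] show ?thesis by (simp add: set_lebesgue_integral_def)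
  qed
  ultimately show ?thesis by simp
qed

lemma integrable_exp_sech: "integrable lborel (\<lambda>t. exp (\<i> * of_real (u * t)) / of_real (cosh (pi * t)))"
proof (rule sech_integrable[where K = 1 and m = 0])
  show "(\<lambda>t. exp (\<i> * complex_of_real (u * t))) \<in> borel_measurable borel"
    by (intro borel_measurable_continuous_onI continuous_intros)
qed simp

lemma integrable_sech: "integrable lborel (\<lambda>t. 1 / complex_of_real (cosh (pi * t)))"
  using integrable_exp_sech[of 0] by simp

lemma integral_sech: "(LINT t|lborel. 1 / complex_of_real (cosh (pi * t))) = 1"
proof -
  have "integral {- real n..real n} (\<lambda>t. 1 / complex_of_real (cosh (pi * t)))
      = of_real (2 / pi * arctan (exp (pi * real n)) - 2 / pi * arctan (exp (pi * - real n)))" for n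
  proof -
    have "((\<lambda>t. 1 / cosh (pi * t)) has_integral
        2 / pi * arctan (exp (pi * real n)) - 2 / pi * arctan (exp (pi * - real n))) {- real n..real n}"
    proof (rule fundamental_theorem_of_calculus)
      fix t assume "t \<in> {- real n..real n}"
      have "((\<lambda>t. 2 / pi * arctan (exp (pi * t))) has_real_derivative 2 / pi * (inverse (1 + (exp (pi * t))^2) * (exp (pi * t) * pi))) (at t)"
        by (auto intro!: derivative_eq_intros)
      also have "2 / pi * (inverse (1 + (exp (pi * t))^2) * (exp (pi * t) * pi)) = 1 / cosh (pi * t)"
      proof -
        have "exp (pi * t) * exp (- (pi * t)) = 1" by (simp flip: exp_add)
        hence "1 + (exp (pi * t))^2 = exp (pi * t) * (exp (pi * t) + exp (- (pi * t)))"
          by (simp add: power2_eq_square algebra_simps)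
        moreover have "exp (pi * t) + exp (- (pi * t)) > 0" by (intro add_pos_pos) auto
        moreover have "2 / pi * (inverse (a * s) * (a * pi)) = 2 / s" if "a > 0" "s > 0" for a s :: real
          using that by (simp add: field_simps)
        ultimately show ?thesis by (simp add: cosh_def)
      qed
      finally show "((\<lambda>t. 2 / pi * arctan (exp (pi * t))) has_vector_derivative 1 / cosh (pi * t)) (at t within {- real n..real n})"
        by (simp add: has_real_derivative_iff_has_vector_derivative has_vector_derivative_at_within)
    qed simp
    hence "((\<lambda>t. complex_of_real (1 / cosh (pi * t))) has_integral
        complex_of_real (2 / pi * arctan (exp (pi * real n)) - 2 / pi * arctan (exp (pi * - real n)))) {- real n..real n}"
      by (rule has_integral_of_real)
    from integral_unique[OF this] show ?thesis by simp
  qed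
  moreover have "(\<lambda>n. complex_of_real (2 / pi * arctan (exp (pi * real n)) - 2 / pi * arctan (exp (pi * - real n)))) \<longlonglongrightarrow>
      of_real (2 / pi * (pi / 2) - 2 / pi * arctan 0)"
  proof (intro tendsto_intros)
    have "filterlim (\<lambda>n. exp (pi * real n)) at_top sequentially" by real_asymp
    thus "(\<lambda>n. arctan (exp (pi * real n))) \<longlonglongrightarrow> pi / 2"
      by (rule filterlim_compose[OF tendsto_arctan_at_top])
    show "(\<lambda>n. exp (pi * - real n)) \<longlonglongrightarrow> 0" by real_asymp
  qed
  ultimately show ?thesis
    using LIMSEQ_unique[OF integral_symmetric_tendsto[OF integrable_sech]] by simp
qed

lemma cosh_pi_eq_0_strip:
  assumes "cosh (of_real pi * z) = 0" "- 1 / 2 < Im z" "Im z < 3 / 2"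
  shows "z = \<i> / 2"
proof -
  have "cos (\<i> * (of_real pi * z)) = 0" using assms by (simp add: cosh_conv_cos)
  then obtain n :: int where "\<i> * (of_real pi * z) = of_int n * of_real pi + of_real pi / 2"
    by (auto simp: cos_eq_0)
  hence "of_real pi * (\<i> * z) = of_real pi * (of_int n + 1 / 2)" by (simp add: algebra_simps)
  hence iz: "\<i> * z = of_int n + 1 / 2" by simp
  hence "Re (\<i> * z) = Re (of_int n + 1 / 2)" "Im (\<i> * z) = Im (of_int n + 1 / 2)" by simp_all
  hence "- Im z = of_int n + 1 / 2" "Re z = 0" by simp_all
  moreover from this have "n = -1" using assms by linarith
  ultimately show ?thesis by (simp add: complex_eq_iff)
qed

lemma cosh_complex_of_real: "cosh (complex_of_real x) = of_real (cosh x)"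
  and sinh_complex_of_real: "sinh (complex_of_real x) = of_real (sinh x)"
  by (simp_all add: cosh_field_def sinh_field_def exp_of_real flip: of_real_minus)

lemma cosh_i_of_real: "cosh (\<i> * of_real y) = of_real (cos y)"
  and sinh_i_of_real: "sinh (\<i> * of_real y) = \<i> * of_real (sin y)"
  by (simp_all add: cosh_conv_cos sinh_conv_sin cos_of_real sin_of_real flip: mult.assoc)

lemma norm_cosh_ge_sinh: "norm (cosh (of_real x + \<i> * of_real y)) \<ge> \<bar>sinh x\<bar>"
proof -
  have "cosh (of_real x + \<i> * of_real y) = of_real (cosh x * cos y) + \<i> * of_real (sinh x * sin y)"
    by (simp add: cosh_add cosh_complex_of_real sinh_complex_of_real cosh_i_of_real sinh_i_of_real)
  hence "(norm (cosh (of_real x + \<i> * of_real y)))^2 = (cosh x * cos y)^2 + (sinh x * sin y)^2"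
    by (simp add: cmod_power2)
  also have "\<dots> = (sinh x)^2 + (cos y)^2"
    unfolding power_mult_distrib cosh_square_eq[of x] sin_squared_eq[of y] by (simp add: algebra_simps)
  finally have "\<bar>sinh x\<bar> ^ 2 \<le> (norm (cosh (of_real x + \<i> * of_real y)))^2" by simp
  thus ?thesis by (rule power2_le_imp_le) simp
qed

text \<open>In this strip cosh(pi z) has the single, simple zero i/2. Subtracting from exp(i u z)
  its value exp(-u/2) at that point removes the pole of the quotient, so the contour shift in
  \<open>fourier_sech\<close> meets no residue.\<close>

lemma strip_quotient_holomorphic:
  obtains h where "h holomorphic_on {z. - 1 / 2 < Im z \<and> Im z < 3 / 2}"
    "\<And>z. - 1 / 2 < Im z \<Longrightarrow> Im z < 3 / 2 \<Longrightarrow> z \<noteq> \<i> / 2 \<Longrightarrow>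
       h z = (exp (\<i> * of_real u * z) - exp (- of_real u / 2)) / cosh (of_real pi * z)"
proof -
  define S where "S = {z. - 1 / 2 < Im z \<and> Im z < 3 / 2}"
  define a where "a = \<i> / 2"
  define N where "N z = exp (\<i> * of_real u * z) - exp (- of_real u / 2)" for z
  define C where "C z = cosh (of_real pi * z)" for z :: complex
  \<comment> \<open>Difference quotients of numerator and denominator at i/2. Both are holomorphic,
    the second has no zero in the strip, and their quotient equals N / C away from i/2.\<close>
  define N1 where "N1 z = (if z = a then deriv N a else (N z - N a) / (z - a))" for z
  define C1 where "C1 z = (if z = a then deriv C a else (C z - C a) / (z - a))" for z
  have op: "open S" unfolding S_def
    by (intro open_Collect_conj open_Collect_less continuous_intros)
  have aS: "a \<in> interior S" using op by (simp add: interior_open) (simp add: S_def a_def)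
  have "\<i> * of_real u * a = - of_real u / 2" by (simp add: a_def complex_eq_iff)
  hence Na: "N a = 0" by (simp add: N_def)
  have "of_real pi * a = \<i> * of_real (pi / 2)" by (simp add: a_def complex_eq_iff)
  hence Ca: "C a = 0" unfolding C_def by (simp only: cosh_i_of_real) simp
  have "N1 holomorphic_on S" unfolding N1_def
    by (rule pole_lemma[OF _ aS]) (auto simp: N_def[abs_def] intro!: holomorphic_intros)
  moreover have "C1 holomorphic_on S" unfolding C1_def
    by (rule pole_lemma[OF _ aS]) (auto simp: C_def[abs_def] cosh_field_def intro!: holomorphic_intros)
  moreover have "C1 z \<noteq> 0" if "z \<in> S" for z
  proof (cases "z = a")
    case True
    have "(C has_field_derivative (sinh (of_real pi * a) * of_real pi)) (at a)"
      unfolding C_def[abs_def] by (auto intro!: derivative_eq_intros)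
    hence "deriv C a = sinh (of_real pi * a) * of_real pi" by (rule DERIV_imp_deriv)
    moreover have "sinh (of_real pi * a) \<noteq> 0"
      using cosh_square_eq[of "of_real pi * a"] Ca unfolding C_def by auto
    ultimately show ?thesis using True by (simp add: C1_def)
  next
    case False
    hence "C z \<noteq> 0" using cosh_pi_eq_0_strip[of z] that unfolding C_def S_def a_def by auto
    thus ?thesis using False Ca by (simp add: C1_def)
  qed
  ultimately have "(\<lambda>z. N1 z / C1 z) holomorphic_on S" by (intro holomorphic_intros) auto
  moreover have "N1 z / C1 z = N z / C z" if "z \<noteq> a" for z
    using that by (simp add: N1_def C1_def Na Ca)
  ultimately show ?thesis using that[of "\<lambda>z. N1 z / C1 z"] unfolding S_def N_def C_def a_def by blast
qed

text \<open>Shift the line of integration of h up by i. There cosh changes sign and exp(i u z) gains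
  the factor E^2 with E = exp(-u/2), so with I the wanted integral and 1 the integral of sech the
  shift gives I - E = -(E^2 I - E), hence I = 2 E / (1 + E^2). A primitive P on the convex strip
  replaces Cauchy's theorem for rectangles.\<close>

lemma fourier_sech:
  "(LINT t|lborel. exp (\<i> * of_real (u * t)) / of_real (cosh (pi * t))) = 1 / of_real (cosh (u / 2))"
proof -
  define S where "S = {z. - 1 / 2 < Im z \<and> Im z < 3 / 2}"
  define E where "E = exp (- complex_of_real u / 2)"
  obtain h where h': "h holomorphic_on {z. - 1 / 2 < Im z \<and> Im z < 3 / 2}"
    "\<And>z. - 1 / 2 < Im z \<Longrightarrow> Im z < 3 / 2 \<Longrightarrow> z \<noteq> \<i> / 2 \<Longrightarrow>
       h z = (exp (\<i> * of_real u * z) - exp (- of_real u / 2)) / cosh (of_real pi * z)"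
    by (rule strip_quotient_holomorphic[of u]) (rule that)
  have h: "h holomorphic_on S"
    "\<And>z. z \<in> S \<Longrightarrow> z \<noteq> \<i> / 2 \<Longrightarrow>
       h z = (exp (\<i> * of_real u * z) - E) / cosh (of_real pi * z)"
    using h' by (simp_all add: S_def E_def)
  have op: "open S" unfolding S_def
    by (intro open_Collect_conj open_Collect_less continuous_intros)
  have cv: "convex S"
  proof -
    have "S = {z. Im z > - 1 / 2} \<inter> {z. Im z < 3 / 2}" by (auto simp: S_def)
    thus ?thesis
      by (simp only:) (intro convex_Int convex_halfspace_Im_gt convex_halfspace_Im_lt)
  qed
  obtain P where P': "\<And>z. z \<in> S \<Longrightarrow> (P has_field_derivative h z) (at z within S)"
    using holomorphic_convex_primitive'[OF cv op h(1)] by blast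
  have P: "(P has_field_derivative h z) (at z)" if "z \<in> S" for z
    using P'[OF that] at_within_open[OF that op] by simp
  define f where "f t = exp (\<i> * of_real (u * t)) / complex_of_real (cosh (pi * t))" for t
  define g where "g t = 1 / complex_of_real (cosh (pi * t))" for t
  have real_S: "of_real t \<in> S" "of_real t + \<i> \<in> S" for t by (auto simp: S_def)
  have h0: "h (of_real t) = f t - E * g t" for t
  proof -
    have "complex_of_real t \<noteq> \<i> / 2" by (auto simp: complex_eq_iff)
    from h(2)[OF real_S(1) this] show ?thesis
      by (simp add: f_def g_def cosh_complex_of_real diff_divide_distrib mult_ac flip: of_real_mult)
  qed
  have h1: "h (of_real t + \<i>) = - (E ^ 2 * f t - E * g t)" for t
  proof -
    have ne: "complex_of_real t + \<i> \<noteq> \<i> / 2" by (auto simp: complex_eq_iff)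
    have 1: "cosh (of_real pi * (of_real t + \<i>)) = - complex_of_real (cosh (pi * t))"
      using cosh_i_of_real[of pi] sinh_i_of_real[of pi] cosh_complex_of_real[of "pi * t"]
      by (simp add: distrib_left cosh_add mult.commute[of _ \<i>])
    have 2: "exp (\<i> * of_real u * (of_real t + \<i>)) = E ^ 2 * exp (\<i> * of_real (u * t))"
      by (simp add: E_def exp_double [symmetric] exp_add [symmetric] algebra_simps)
    show ?thesis using h(2)[OF real_S(2) ne] unfolding 1 2 f_def g_def
      by (simp add: diff_divide_distrib)
  qed
  have int_fg: "integrable lborel f" "integrable lborel g"
    unfolding f_def g_def by (rule integrable_exp_sech, rule integrable_sech)
  have g1: "(LINT t|lborel. g t) = 1" unfolding g_def by (rule integral_sech)
  have int0: "(LINT t|lborel. f t - E * g t) = (LINT t|lborel. f t) - E"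
    using int_fg by (simp add: g1)
  have int1: "(LINT t|lborel. - (E ^ 2 * f t - E * g t)) = - (E ^ 2 * (LINT t|lborel. f t) - E)"
    using int_fg by (simp add: g1)
  have lim0: "(\<lambda>n. integral {- real n..real n} (\<lambda>t. f t - E * g t)) \<longlonglongrightarrow> (LINT t|lborel. f t) - E"
    unfolding int0 [symmetric] by (rule integral_symmetric_tendsto) (use int_fg in auto)
  have lim1: "(\<lambda>n. integral {- real n..real n} (\<lambda>t. - (E ^ 2 * f t - E * g t))) \<longlonglongrightarrow> - (E ^ 2 * (LINT t|lborel. f t) - E)"
    unfolding int1 [symmetric] by (rule integral_symmetric_tendsto) (use int_fg in auto)
  have F0: "integral {- real n..real n} (\<lambda>t. f t - E * g t) = P (of_real (real n)) - P (of_real (- real n))" for n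
  proof (rule integral_unique, rule fundamental_theorem_of_calculus)
    fix t assume "t \<in> {- real n..real n}"
    from has_vector_derivative_real_field[OF P[OF real_S(1)]]
    show "((\<lambda>t. P (of_real t)) has_vector_derivative (f t - E * g t)) (at t within {- real n..real n})"
      unfolding h0 .
  qed simp
  have F1: "integral {- real n..real n} (\<lambda>t. - (E ^ 2 * f t - E * g t)) = P (of_real (real n) + \<i>) - P (of_real (- real n) + \<i>)" for n
  proof (rule integral_unique, rule fundamental_theorem_of_calculus)
    fix t assume "t \<in> {- real n..real n}"
    have "((\<lambda>z. P (z + \<i>)) has_field_derivative h (of_real t + \<i>)) (at (of_real t))"
      using P[OF real_S(2)] by (simp add: DERIV_shift)
    from has_vector_derivative_real_field[OF this]
    show "((\<lambda>t. P (of_real t + \<i>)) has_vector_derivative (- (E ^ 2 * f t - E * g t))) (at t within {- real n..real n})"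
      unfolding h1 .
  qed simp
  \<comment> \<open>The vertical sides: a segment of length 1 on which h is small because |cosh(pi
    z)| >= |sinh(pi x)|.\<close>
  have vert: "norm (P (of_real x + \<i>) - P (of_real x)) \<le> (exp \<bar>u\<bar> + norm E) / \<bar>sinh (pi * x)\<bar>" if x: "x \<noteq> 0" for x
  proof -
    have seg: "closed_segment (of_real x) (of_real x + \<i>) \<subseteq> S"
      using real_S by (intro closed_segment_subset cv) auto
    have "norm (P (of_real x + \<i>) - P (of_real x)) \<le> (exp \<bar>u\<bar> + norm E) / \<bar>sinh (pi * x)\<bar> * norm (of_real x + \<i> - of_real x)"
    proof (rule field_differentiable_bound[where S = "closed_segment (of_real x) (of_real x + \<i>)" and f' = h])
      fix z assume z: "z \<in> closed_segment (of_real x) (of_real x + \<i>)"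
      show "(P has_field_derivative h z) (at z within closed_segment (of_real x) (of_real x + \<i>))"
        by (rule has_field_derivative_at_within[OF P]) (use z seg in auto)
      obtain y where y: "0 \<le> y" "y \<le> 1" "z = of_real x + \<i> * of_real y"
        using z by (auto simp: closed_segment_def scaleR_conv_of_real algebra_simps)
      have "z \<noteq> \<i> / 2" using y x by (auto simp: complex_eq_iff)
      hence hz: "h z = (exp (\<i> * of_real u * z) - E) / cosh (of_real pi * z)" using h(2) z seg by blast
      have "norm (exp (\<i> * of_real u * z)) \<le> exp \<bar>u\<bar>"
      proof -
        have "- (u * y) \<le> \<bar>u\<bar> * 1" using y by (intro order_trans[OF abs_ge_minus_self]) (auto simp: abs_mult mult_left_le)
        thus ?thesis using y by simp
      qed
      hence "norm (exp (\<i> * of_real u * z) - E) \<le> exp \<bar>u\<bar> + norm E"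
        by (intro order_trans[OF norm_triangle_ineq4]) auto
      moreover have "norm (cosh (of_real pi * z)) \<ge> \<bar>sinh (pi * x)\<bar>"
        using norm_cosh_ge_sinh[of "pi * x" "pi * y"] y by (simp add: algebra_simps)
      moreover have "\<bar>sinh (pi * x)\<bar> > 0" using x by simp
      ultimately show "norm (h z) \<le> (exp \<bar>u\<bar> + norm E) / \<bar>sinh (pi * x)\<bar>"
        unfolding hz norm_divide by (intro frac_le) auto
    qed auto
    thus ?thesis by simp
  qed
  have v: "(\<lambda>n. P (of_real (s * real n) + \<i>) - P (of_real (s * real n))) \<longlonglongrightarrow> 0" if s: "s = 1 \<or> s = -1" for s
  proof (rule Lim_null_comparison)
    show "\<forall>\<^sub>F n in sequentially. norm (P (of_real (s * real n) + \<i>) - P (of_real (s * real n))) \<le> (exp \<bar>u\<bar> + norm E) / sinh (pi * real n)"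
      using eventually_gt_at_top[of 0]
    proof eventually_elim
      case (elim n)
      have "\<bar>sinh (pi * (s * real n))\<bar> = sinh (pi * real n)" using s elim by auto
      thus ?case using vert[of "s * real n"] elim s by auto
    qed
    have "filterlim (\<lambda>n. sinh (pi * real n)) at_top sequentially"
      unfolding sinh_field_def by real_asymp
    thus "(\<lambda>n. (exp \<bar>u\<bar> + norm E) / sinh (pi * real n)) \<longlonglongrightarrow> 0"
      by (intro tendsto_divide_0[OF tendsto_const] filterlim_at_top_imp_at_infinity)
  qed
  have "(\<lambda>n. (P (of_real (real n) + \<i>) - P (of_real (- real n) + \<i>)) - (P (of_real (real n)) - P (of_real (- real n)))) \<longlonglongrightarrow> 0 - 0"
    using tendsto_diff[OF v[of 1] v[of "-1"]] by (simp add: algebra_simps)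
  from tendsto_unique[OF _ this tendsto_diff[OF lim1[unfolded F1] lim0[unfolded F0]]]
  have *: "(1 + E ^ 2) * (LINT t|lborel. f t) = 2 * E" by (simp add: algebra_simps)
  have **: "complex_of_real (cosh (u / 2)) * (2 * E) = 1 + E ^ 2"
  proof -
    have Er: "E = of_real (exp (- u / 2))" by (simp add: E_def flip: exp_of_real)
    have "cosh (u / 2) * (2 * exp (- u / 2)) = 1 + exp (- u / 2) ^ 2"
      by (simp add: cosh_def algebra_simps power2_eq_square flip: exp_add)
    hence "complex_of_real (cosh (u / 2) * (2 * exp (- u / 2))) = of_real (1 + exp (- u / 2) ^ 2)"
      by (simp only:)
    thus ?thesis by (simp only: Er of_real_mult of_real_add of_real_1 of_real_power of_real_numeral)
  qed
  have "(2 * E) * (complex_of_real (cosh (u / 2)) * (LINT t|lborel. f t)) =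
      (complex_of_real (cosh (u / 2)) * (2 * E)) * (LINT t|lborel. f t)" by (simp only: mult_ac)
  also have "\<dots> = (2 * E) * 1" unfolding ** * by simp
  finally have "(2 * E) * (complex_of_real (cosh (u / 2)) * (LINT t|lborel. f t)) = (2 * E) * 1" .
  moreover have "2 * E \<noteq> 0" by (simp add: E_def)
  ultimately have "complex_of_real (cosh (u / 2)) * (LINT t|lborel. f t) = 1"
    unfolding mult_cancel_left by simp
  moreover have "complex_of_real (cosh (u / 2)) \<noteq> 0" by simp
  ultimately show ?thesis unfolding f_def by (simp add: field_simps)
qed

section \<open>Mellin integrals against sech\<close>

text \<open>\<open>fourier_sech\<close> at u = ln v, multiplied by v^(3/2): v^(3/2) / cosh(ln v / 2)
  = 2 v^2 / (1 + v).\<close>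

lemma mellin_base:
  assumes v: "v > 0"
  shows "(LINT t|lborel. exp ((3/2 + \<i> * of_real t) * of_real (ln v)) / of_real (cosh (pi * t))) = of_real (2 * v ^ 2 / (1 + v))"
proof -
  have eq: "exp ((3/2 + \<i> * of_real t) * of_real (ln v)) / of_real (cosh (pi * t))
      = of_real (v powr (3/2)) * (exp (\<i> * of_real (ln v * t)) / of_real (cosh (pi * t)))" for t
  proof -
    have "complex_of_real (v powr (3/2)) = exp (3/2 * of_real (ln v))" using v by (simp add: powr_def exp_of_real [symmetric])
    moreover have "(3/2 + \<i> * of_real t) * complex_of_real (ln v) = 3/2 * of_real (ln v) + \<i> * of_real (ln v * t)"
      by (simp add: algebra_simps)
    ultimately show ?thesis by (simp only: exp_add) simp
  qed
  have "(LINT t|lborel. exp ((3/2 + \<i> * of_real t) * of_real (ln v)) / of_real (cosh (pi * t))) =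
      of_real (v powr (3/2)) * (1 / of_real (cosh (ln v / 2)))"
    unfolding eq integral_mult_right_zero fourier_sech ..
  also have "\<dots> = of_real (v powr (3/2) / cosh (ln v / 2))" by simp
  also have "v powr (3/2) / cosh (ln v / 2) = 2 * v ^ 2 / (1 + v)"
  proof -
    define a where "a = v powr (1/2)"
    have a: "a > 0" using v by (simp add: a_def)
    have va: "v = a * a" using v by (simp add: a_def flip: powr_add)
    have "v powr (3/2) = v powr (1/2 + 1/2 + 1/2)" by simp
    also have "\<dots> = a * a * a" unfolding powr_add a_def by simp
    finally have 2: "v powr (3/2) = a * a * a" .
    have "exp (ln v / 2) = a" "exp (- (ln v / 2)) = 1 / a" using v by (simp_all add: a_def powr_def exp_minus field_simps)
    hence 1: "cosh (ln v / 2) = (a + 1 / a) / 2" by (simp add: cosh_field_def)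
    have "a + 1 / a = (1 + a * a) / a" using a by (simp add: field_simps)
    moreover have "1 + a * a > 0" by (intro add_pos_nonneg) auto
    ultimately show ?thesis unfolding 1 2 using a by (simp add: va field_simps power2_eq_square)
  qed
  finally show ?thesis .
qed

text \<open>The integral of y^(w - 1) over (0, v], with the power written as an exponential so that
  it can be combined with the integrands on the line.\<close>

lemma integral_exp_ln:
  assumes v: "v > 0" and w: "Re w \<ge> 1"
  shows "set_integrable lborel {0<..v} (\<lambda>y. exp ((w - 1) * of_real (ln y)))"
    and "(LINT y:{0<..v}|lborel. exp ((w - 1) * of_real (ln y))) = exp (w * of_real (ln v)) / w"
proof -
  have w0: "w \<noteq> 0" using w by auto
  \<comment> \<open>The value 0 at the origin is the limit that makes F continuous on [0, v]; the
    exponential formula itself never takes the value 0.\<close>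
  define F where "F y = (if y > 0 then exp (w * of_real (ln y)) / w else 0)" for y :: real
  show int: "set_integrable lborel {0<..v} (\<lambda>y. exp ((w - 1) * of_real (ln y)))"
    unfolding set_integrable_def
  proof (rule Bochner_Integration.integrable_bound)
    show "integrable lborel (\<lambda>y. indicator {0<..v} y *\<^sub>R (v powr (Re w - 1)))"
      using v by (intro integrable_real_indicator integrable_scaleR_left) (auto simp: emeasure_lborel_Ioc)
    show "AE y in lborel. norm (indicator {0<..v} y *\<^sub>R exp ((w - 1) * complex_of_real (ln y)))
        \<le> norm (indicator {0<..v} y *\<^sub>R (v powr (Re w - 1)))"
      using w v by (intro AE_I2) (auto simp: indicator_def powr_def mult_left_mono)
  qed measurable
  have "((\<lambda>y. exp ((w - 1) * of_real (ln y))) has_integral (F v - F 0)) {0..v}"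
  proof (rule fundamental_theorem_of_calculus_interior)
    fix x assume x: "x \<in> {0<..<v}"
    have "((\<lambda>y. exp (w * of_real (ln y)) / w) has_vector_derivative exp ((w - 1) * of_real (ln x))) (at x)"
    proof -
      have "((\<lambda>y. complex_of_real (ln y)) has_vector_derivative of_real (1 / x)) (at x)"
        using x by (intro has_vector_derivative_of_real) (auto intro!: derivative_eq_intros simp flip: has_real_derivative_iff_has_vector_derivative)
      moreover have "((\<lambda>z. exp (w * z) / w) has_field_derivative exp (w * of_real (ln x))) (at (of_real (ln x)))"
        using w0 by (auto intro!: derivative_eq_intros)
      ultimately have "((\<lambda>z. exp (w * z) / w) \<circ> (\<lambda>y. complex_of_real (ln y)) has_vector_derivative of_real (1 / x) * exp (w * of_real (ln x))) (at x)"
        by (rule field_vector_diff_chain_at)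
      moreover have "of_real (1 / x) * exp (w * of_real (ln x)) = exp ((w - 1) * of_real (ln x))"
        using x by (simp add: left_diff_distrib exp_diff exp_of_real field_simps)
      ultimately show ?thesis by (simp add: o_def)
    qed
    thus "(F has_vector_derivative exp ((w - 1) * of_real (ln x))) (at x)"
      by (rule has_vector_derivative_transform_within_open[where S = "{0<..}"]) (use x in \<open>auto simp: F_def\<close>)
  next
    have c0: "(F \<longlongrightarrow> 0) (at 0 within {0..v})"
    proof (rule Lim_null_comparison)
      show "\<forall>\<^sub>F x in at 0 within {0..v}. norm (F x) \<le> x powr Re w / norm w"
        by (rule always_eventually) (auto simp: F_def norm_divide powr_def)
      have "((\<lambda>x. x powr Re w / norm w) \<longlongrightarrow> 0 powr Re w / norm w) (at 0 within {0..v})"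
        using w w0 by (intro tendsto_intros) (auto simp: eventually_at_filter)
      thus "((\<lambda>x. x powr Re w / norm w) \<longlongrightarrow> 0) (at 0 within {0..v})" using w by simp
    qed
    show "continuous_on {0..v} F"
      unfolding continuous_on_def
    proof
      fix x assume x: "x \<in> {0..v}"
      show "(F \<longlongrightarrow> F x) (at x within {0..v})"
      proof (cases "x = 0")
        case True thus ?thesis using c0 by (simp add: F_def)
      next
        case False
        hence "x > 0" using x by simp
        have "((\<lambda>y. exp (w * of_real (ln y)) / w) \<longlongrightarrow> exp (w * of_real (ln x)) / w) (at x within {0..v})"
          using \<open>x > 0\<close> w0 by (intro tendsto_intros) auto
        moreover have "eventually (\<lambda>y. exp (w * of_real (ln y)) / w = F y) (at x within {0..v})"
        proof -
          have "eventually (\<lambda>y. y \<in> {0<..}) (at x within {0..v})"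
            using \<open>x > 0\<close> eventually_nhds_in_open[of "{0<..}" x]
            unfolding eventually_at_filter by (auto elim: eventually_mono)
          thus ?thesis by eventually_elim (simp add: F_def)
        qed
        ultimately show ?thesis using \<open>x > 0\<close> by (simp add: F_def Lim_transform_eventually)
      qed
    qed
  qed (use v in simp)
  hence "((\<lambda>y. exp ((w - 1) * of_real (ln y))) has_integral (exp (w * of_real (ln v)) / w)) {0..v}"
    using v by (simp add: F_def)
  hence "((\<lambda>y. exp ((w - 1) * of_real (ln y))) has_integral (exp (w * of_real (ln v)) / w)) {0<..v}"
    by (rule has_integral_spike_set_eq[THEN iffD1, rotated 2])
       (auto intro!: negligible_subset[OF negligible_sing[of 0]])
  from integral_unique[OF this] set_borel_integral_eq_integral(2)[OF int]
  show "(LINT y:{0<..v}|lborel. exp ((w - 1) * of_real (ln y))) = exp (w * of_real (ln v)) / w" by simp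
qed

text \<open>Write v^w / w as the integral of y^(w - 1) over (0, v], exchange integrals by Fubini,
  and use \<open>mellin_base\<close> for each y. Only c = 0 and c = 1 are called on, for the factors
  1/z and 1/(z + 1).\<close>

lemma mellin_integrated:
  fixes c :: real
  assumes v: "v > 0" and c: "c \<ge> 0"
  shows "(LINT t|lborel. exp ((3/2 + \<i> * of_real t + of_real c) * of_real (ln v)) / (3/2 + \<i> * of_real t + of_real c) / of_real (cosh (pi * t)))
    = (LINT y:{0<..v}|lborel. complex_of_real (2 * y powr (c + 1) / (1 + y)))"
proof -
  define f where "f t y = indicator {0<..v} y *\<^sub>R (exp ((3/2 + \<i> * of_real t + of_real c - 1) * of_real (ln y)) / complex_of_real (cosh (pi * t)))" for t y
  have [measurable]: "(\<lambda>t. cosh (pi * t)) \<in> borel_measurable borel"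
    by (intro borel_measurable_continuous_onI continuous_intros)
  have meas [measurable]: "case_prod f \<in> borel_measurable (lborel \<Otimes>\<^sub>M lborel)"
    unfolding f_def case_prod_unfold by measurable
  have inner_int: "integrable lborel (f t)" and inner: "(LINT y|lborel. f t y) =
      exp ((3/2 + \<i> * of_real t + of_real c) * of_real (ln v)) / (3/2 + \<i> * of_real t + of_real c) / of_real (cosh (pi * t))" for t
  proof -
    have w: "Re (3/2 + \<i> * of_real t + of_real c) \<ge> 1" using c by simp
    have eq: "f t = (\<lambda>y. (indicator {0<..v} y *\<^sub>R exp ((3/2 + \<i> * of_real t + of_real c - 1) * of_real (ln y))) / complex_of_real (cosh (pi * t)))"
      by (auto simp: f_def fun_eq_iff indicator_def)
    show "integrable lborel (f t)" unfolding eq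
      using integral_exp_ln(1)[OF v w] unfolding set_integrable_def by (rule integrable_divide)
    show "(LINT y|lborel. f t y) =
      exp ((3/2 + \<i> * of_real t + of_real c) * of_real (ln v)) / (3/2 + \<i> * of_real t + of_real c) / of_real (cosh (pi * t))"
      unfolding eq using integral_exp_ln(2)[OF v w] unfolding set_lebesgue_integral_def by simp
  qed
  have norm_f: "norm (f t y) = indicator {0<..v} y * y powr (1/2 + c) / cosh (pi * t)" for t y
    by (auto simp: f_def indicator_def norm_divide powr_def algebra_simps)
  have "integrable (lborel \<Otimes>\<^sub>M lborel) (case_prod f)"
  proof (rule lborel_pair.Fubini_integrable[OF meas])
    define K where "K = (LINT y|lborel. indicator {0<..v} y * y powr (1/2 + c))"
    have "(LINT y|lborel. norm (f t y)) = K / cosh (pi * t)" for t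
      unfolding norm_f K_def by simp
    moreover have "integrable lborel (\<lambda>t. K / cosh (pi * t))"
    proof -
      have "integrable lborel (\<lambda>t. Re (of_real K * (1 / complex_of_real (cosh (pi * t)))))"
        by (intro integrable_Re integrable_mult_right integrable_sech)
      thus ?thesis by (simp add: Re_divide_of_real flip: of_real_mult of_real_divide)
    qed
    ultimately show "integrable lborel (\<lambda>t. LINT y|lborel. norm (case (t, y) of (t, y) \<Rightarrow> f t y))" by simp
  qed (simp add: inner_int)
  hence "(LINT y|lborel. LINT t|lborel. f t y) = (LINT t|lborel. LINT y|lborel. f t y)"
    by (rule lborel_pair.Fubini_integral)
  also have "(LINT y|lborel. LINT t|lborel. f t y) = (LINT y:{0<..v}|lborel. complex_of_real (2 * y powr (c + 1) / (1 + y)))"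
    unfolding set_lebesgue_integral_def
  proof (rule Bochner_Integration.integral_cong)
    fix y :: real
    show "(LINT t|lborel. f t y) = indicator {0<..v} y *\<^sub>R complex_of_real (2 * y powr (c + 1) / (1 + y))"
    proof (cases "y \<in> {0<..v}")
      case True
      hence y: "y > 0" by simp
      have "f t y = of_real (y powr (c - 1)) * (exp ((3/2 + \<i> * of_real t) * of_real (ln y)) / complex_of_real (cosh (pi * t)))" for t
      proof -
        have "(3/2 + \<i> * of_real t + of_real c - 1) * complex_of_real (ln y) =
            of_real ((c - 1) * ln y) + (3/2 + \<i> * of_real t) * of_real (ln y)" by (simp add: algebra_simps)
        moreover have "exp (complex_of_real ((c - 1) * ln y)) = of_real (y powr (c - 1))"
          using y by (simp add: powr_def exp_of_real del: of_real_mult of_real_diff)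
        ultimately show ?thesis using True by (simp add: f_def exp_add)
      qed
      hence "(LINT t|lborel. f t y) = of_real (y powr (c - 1)) * of_real (2 * y ^ 2 / (1 + y))"
        using mellin_base[OF y] by (simp only: integral_mult_right_zero)
      also have "\<dots> = complex_of_real (2 * (y powr (c - 1) * y ^ 2) / (1 + y))" by simp
      also have "y powr (c - 1) * y ^ 2 = y powr (c + 1)"
        using y powr_add[of y "c - 1" 2] by (simp add: add.commute)
      finally show ?thesis using True by simp
    qed (simp add: f_def)
  qed simp
  finally show ?thesis unfolding inner ..
qed

lemma LINT_of_real_Ioc:
  fixes F :: "real \<Rightarrow> real"
  assumes v: "v \<ge> 0" and F: "\<And>y. 0 \<le> y \<Longrightarrow> (F has_real_derivative f y) (at y)"
    and f: "continuous_on {0..v} f"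
  shows "(LINT y:{0<..v}|lborel. complex_of_real (f y)) = of_real (F v - F 0)"
proof -
  have "(f has_integral (F v - F 0)) {0..v}"
    by (rule fundamental_theorem_of_calculus)
       (use v F in \<open>auto intro: DERIV_subset simp flip: has_real_derivative_iff_has_vector_derivative\<close>)
  hence hi: "((\<lambda>y. complex_of_real (f y)) has_integral of_real (F v - F 0)) {0..v}"
    by (rule has_integral_of_real)
  have "set_integrable lborel {0..v} (\<lambda>y. complex_of_real (f y))"
    unfolding set_integrable_def by (rule borel_integrable_compact) (auto intro!: continuous_intros f)
  hence si: "set_integrable lborel {0<..v} (\<lambda>y. complex_of_real (f y))"
    by (rule set_integrable_subset) auto
  have "((\<lambda>y. complex_of_real (f y)) has_integral of_real (F v - F 0)) {0<..v}"
    using hi by (rule has_integral_spike_set_eq[THEN iffD1, rotated 2])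
       (auto intro!: negligible_subset[OF negligible_sing[of 0]])
  from integral_unique[OF this] set_borel_integral_eq_integral(2)[OF si] show ?thesis by simp
qed

lemma mellin_integrated_0:
  assumes v: "v > 0"
  shows "(LINT t|lborel. exp ((3/2 + \<i> * of_real t) * of_real (ln v)) / (3/2 + \<i> * of_real t) / of_real (cosh (pi * t)))
    = of_real (2 * (v - ln (1 + v)))"
proof -
  have "(LINT y:{0<..v}|lborel. complex_of_real (2 * y / (1 + y))) = of_real (2 * (v - ln (1 + v)) - 2 * (0 - ln (1 + 0)))"
    by (rule LINT_of_real_Ioc) (use v in \<open>auto intro!: derivative_eq_intros continuous_intros simp: field_simps\<close>)
  moreover have "(LINT y:{0<..v}|lborel. complex_of_real (2 * y powr (0 + 1) / (1 + y))) = (LINT y:{0<..v}|lborel. complex_of_real (2 * y / (1 + y)))"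
    by (rule set_lebesgue_integral_cong) auto
  ultimately show ?thesis using mellin_integrated[OF v, of 0] by simp
qed

lemma mellin_integrated_1:
  assumes v: "v > 0"
  shows "(LINT t|lborel. exp ((5/2 + \<i> * of_real t) * of_real (ln v)) / (5/2 + \<i> * of_real t) / of_real (cosh (pi * t)))
    = of_real (2 * (v ^ 2 / 2 - v + ln (1 + v)))"
proof -
  have "(LINT y:{0<..v}|lborel. complex_of_real (2 * y ^ 2 / (1 + y))) = of_real (2 * (v ^ 2 / 2 - v + ln (1 + v)) - 2 * (0 ^ 2 / 2 - 0 + ln (1 + 0)))"
    by (rule LINT_of_real_Ioc) (use v in \<open>auto intro!: derivative_eq_intros continuous_intros simp: field_simps power2_eq_square\<close>)
  moreover have "(LINT y:{0<..v}|lborel. complex_of_real (2 * y powr (1 + 1) / (1 + y))) = (LINT y:{0<..v}|lborel. complex_of_real (2 * y ^ 2 / (1 + y)))"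
    by (rule set_lebesgue_integral_cong) auto
  moreover have "3/2 + \<i> * of_real t + of_real 1 = 5/2 + \<i> * of_real t" for t by simp
  ultimately show ?thesis using mellin_integrated[OF v, of 1] by (simp only:) simp
qed

section \<open>The Stirling error and its sums\<close>

definition stirling_err :: "nat \<Rightarrow> real" where
  "stirling_err n = ln (fact n) - (real n + 1 / 2) * ln (real n) + real n - 1 / (12 * real n) - ln (2 * pi) / 2"

lemma stirling_err_diff:
  assumes "k \<ge> 1"
  shows "stirling_err k - stirling_err (Suc k) =
    (real k + 1 / 2) * (ln (real k + 1) - ln (real k)) - 1 - 1 / (12 * real k) + 1 / (12 * (real k + 1))"
proof -
  have "ln (fact (Suc k) :: real) = ln (real k + 1) + ln (fact k)"
    by (simp add: ln_mult add_ac)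
  thus ?thesis unfolding stirling_err_def by (simp add: algebra_simps)
qed

text \<open>The majorant is chosen telescoping, so that summing it gives the rate 1/n^2
  directly.\<close>

lemma stirling_err_diff_bound:
  obtains D where "D > 0"
    "eventually (\<lambda>k. \<bar>stirling_err k - stirling_err (Suc k)\<bar> \<le> D * (1 / real k ^ 2 - 1 / real (Suc k) ^ 2)) sequentially"
proof -
  have "(\<lambda>x::real. (x + 1 / 2) * (ln (x + 1) - ln x) - 1 - 1 / (12 * x) + 1 / (12 * (x + 1)))
      \<in> O[at_top](\<lambda>x. 1 / x ^ 2 - 1 / (x + 1) ^ 2)"
    by real_asymp
  then obtain D where D: "D > 0" "eventually (\<lambda>x::real. norm ((x + 1 / 2) * (ln (x + 1) - ln x) - 1 - 1 / (12 * x) + 1 / (12 * (x + 1)))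
      \<le> D * norm (1 / x ^ 2 - 1 / (x + 1) ^ 2)) at_top"
    by (elim landau_o.bigE)
  have "eventually (\<lambda>k. norm ((real k + 1 / 2) * (ln (real k + 1) - ln (real k)) - 1 - 1 / (12 * real k) + 1 / (12 * (real k + 1)))
      \<le> D * norm (1 / real k ^ 2 - 1 / (real k + 1) ^ 2)) sequentially"
    using D(2) filterlim_real_sequentially by (rule eventually_compose_filterlim)
  hence "eventually (\<lambda>k. \<bar>stirling_err k - stirling_err (Suc k)\<bar> \<le> D * (1 / real k ^ 2 - 1 / real (Suc k) ^ 2)) sequentially"
    using eventually_ge_at_top[of 1]
  proof eventually_elim
    case (elim k)
    have "1 / (real k + 1) ^ 2 \<le> 1 / real k ^ 2" using elim by (intro divide_left_mono) auto
    thus ?case using elim stirling_err_diff[of k] by (simp add: add_ac)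
  qed
  with D(1) show ?thesis by (rule that)
qed

text \<open>Adding and subtracting D / n^2 gives an eventually decreasing and an eventually
  increasing sequence with the same limit, which enclose the error. The rate matters because
  \<open>stirling_err_sums\<close> multiplies the error by n.\<close>

lemma stirling_err_rate:
  obtains L D where "stirling_err \<longlonglongrightarrow> L" "eventually (\<lambda>n. \<bar>stirling_err n - L\<bar> \<le> D / real n ^ 2) sequentially"
proof -
  obtain D where D: "D > 0"
    "eventually (\<lambda>k. \<bar>stirling_err k - stirling_err (Suc k)\<bar> \<le> D * (1 / real k ^ 2 - 1 / real (Suc k) ^ 2)) sequentially"
    by (rule stirling_err_diff_bound)
  then obtain N where N: "\<And>k. k \<ge> N \<Longrightarrow> \<bar>stirling_err k - stirling_err (Suc k)\<bar> \<le> D * (1 / real k ^ 2 - 1 / real (Suc k) ^ 2)"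
    by (auto simp: eventually_sequentially)
  define a where "a n = stirling_err n - D / real n ^ 2" for n
  define b where "b n = stirling_err n + D / real n ^ 2" for n
  have ab_step: "a k \<le> a (Suc k)" "b (Suc k) \<le> b k" if "k \<ge> N" for k
    using N[OF that] unfolding a_def b_def by (auto simp: right_diff_distrib abs_le_iff)
  have a_mono: "a m \<le> a n" if "m \<ge> N" "n \<ge> m" for m n
    using that(2) by (induction n rule: dec_induct) (use that(1) ab_step(1) in \<open>auto intro: order_trans\<close>)
  have b_mono: "b n \<le> b m" if "m \<ge> N" "n \<ge> m" for m n
    using that(2) by (induction n rule: dec_induct) (use that(1) ab_step(2) in \<open>auto intro: order_trans\<close>)
  have ab: "a n \<le> b n" for n using D(1) unfolding a_def b_def by simp
  have D0: "(\<lambda>n. D / real n ^ 2) \<longlonglongrightarrow> 0" by real_asymp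
  have "convergent (\<lambda>n. a (n + N))"
  proof (rule Bseq_mono_convergent)
    have "a (n + N) \<in> {a N..b N}" for n
      using a_mono[of N "n + N"] b_mono[of N "n + N"] ab[of "n + N"] by auto
    hence "norm (a (n + N)) \<le> max \<bar>a N\<bar> \<bar>b N\<bar>" for n
      by (smt (verit) atLeastAtMost_iff real_norm_def)
    thus "Bseq (\<lambda>n. a (n + N))" by (rule BseqI')
    show "\<forall>m n. m \<le> n \<longrightarrow> a (m + N) \<le> a (n + N)" using a_mono by auto
  qed
  then obtain L where "(\<lambda>n. a (n + N)) \<longlonglongrightarrow> L" by (auto simp: convergent_def)
  hence a_lim: "a \<longlonglongrightarrow> L" by (rule LIMSEQ_offset)
  have lim: "stirling_err \<longlonglongrightarrow> L" using tendsto_add[OF a_lim D0] by (simp add: a_def)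
  have b_lim: "b \<longlonglongrightarrow> L" using tendsto_add[OF lim D0] by (simp add: b_def[abs_def])
  have "\<bar>stirling_err n - L\<bar> \<le> D / real n ^ 2" if n: "n \<ge> N" for n
  proof -
    have "a n \<le> L" by (rule LIMSEQ_le_const[OF a_lim]) (use a_mono n in blast)
    moreover have "L \<le> b n" by (rule LIMSEQ_le_const2[OF b_lim]) (use b_mono n in blast)
    ultimately show ?thesis unfolding a_def b_def by (simp add: abs_le_iff)
  qed
  hence "eventually (\<lambda>n. \<bar>stirling_err n - L\<bar> \<le> D / real n ^ 2) sequentially"
    by (auto simp: eventually_sequentially)
  with lim show ?thesis by (rule that)
qed

lemma wallis_prod: "(\<Prod>k=1..n. (4 * real k ^ 2) / (4 * real k ^ 2 - 1)) =
    16 ^ n * fact n ^ 4 / (fact (2 * n) ^ 2 * (2 * real n + 1))"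
proof (induction n)
  case (Suc n)
  have f: "fact (2 * Suc n) = (2 * real n + 2) * (2 * real n + 1) * fact (2 * n)"
    by (simp add: algebra_simps)
  have g: "4 * real (Suc n) ^ 2 - 1 = (2 * real n + 1) * (2 * real n + 3)"
    by (simp add: power2_eq_square algebra_simps)
  have h: "fact (Suc n) = (real n + 1) * fact n" by (simp add: algebra_simps)
  have "(\<Prod>k=1..Suc n. (4 * real k ^ 2) / (4 * real k ^ 2 - 1)) =
     16 ^ n * fact n ^ 4 / (fact (2 * n) ^ 2 * (2 * real n + 1)) * (4 * (real n + 1) ^ 2 / ((2 * real n + 1) * (2 * real n + 3)))"
    using Suc.IH unfolding prod.cl_ivl_Suc g by (simp add: add_ac)
  also have "\<dots> = 16 ^ Suc n * ((real n + 1) * fact n) ^ 4 / (((2 * real n + 2) * (2 * real n + 1) * fact (2 * n)) ^ 2 * (2 * real n + 3))"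
  proof -
    define F G x where "F = (fact n :: real)" and "G = (fact (2 * n) :: real)" and "x = real n + 1"
    have "G > 0" "x > 0" by (auto simp: G_def x_def)
    moreover have "2 * real n + 2 = 2 * x" "2 * real n + 1 = 2 * x - 1" "2 * real n + 3 = 2 * x + 1" by (auto simp: x_def)
    moreover have "2 * x - 1 > 0" by (auto simp: x_def)
    ultimately show ?thesis unfolding F_def [symmetric] G_def [symmetric] x_def [symmetric]
      by (simp add: divide_simps power_mult_distrib) (simp add: power_numeral_reduce algebra_simps)
  qed
  finally show ?case unfolding f h by (simp add: algebra_simps)
qed simp

text \<open>The constant in Stirling's formula from Wallis' product: ln W_n is 4 E(n) - 2 E(2n) plus
  explicit terms, so the limit L satisfies 2 L + ln (pi/2) = ln (pi/2).\<close>

lemma stirling_err_tendsto: "stirling_err \<longlonglongrightarrow> 0"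
  and stirling_err_times_tendsto: "(\<lambda>n. real n * stirling_err n) \<longlonglongrightarrow> 0"
proof -
  obtain L D where L: "stirling_err \<longlonglongrightarrow> L" "eventually (\<lambda>n. \<bar>stirling_err n - L\<bar> \<le> D / real n ^ 2) sequentially"
    by (rule stirling_err_rate)
  define W where "W n = (\<Prod>k=1..n. (4 * real k ^ 2) / (4 * real k ^ 2 - 1))" for n
  have W: "W \<longlonglongrightarrow> pi / 2" unfolding W_def by (rule wallis)
  have lnW: "(\<lambda>n. ln (W n)) \<longlonglongrightarrow> ln (pi / 2)" by (intro tendsto_ln W) auto
  have eq: "ln (W n) = 4 * stirling_err n - 2 * stirling_err (2 * n) + (ln (real n) - ln 2 - ln (2 * real n + 1) + 1 / (4 * real n) + ln (2 * pi))"
    if n: "n \<ge> 1" for n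
  proof -
    have "ln (W n) = real n * (4 * ln 2) + 4 * ln (fact n) - 2 * ln (fact (2 * n)) - ln (2 * real n + 1)"
    proof -
      have "ln (16 :: real) = 4 * ln 2" using ln_realpow[of 2 4] by simp
      moreover have "2 * real n + 1 > 0" by simp
      ultimately show ?thesis unfolding W_def wallis_prod
        by (simp add: ln_div ln_mult ln_realpow del: fact_Suc)
    qed
    moreover have "ln (real (2 * n)) = ln 2 + ln (real n)" using n by (simp add: ln_mult)
    moreover have "1 / (12 * real n) = (1 / real n) / 12" "1 / (12 * real (2 * n)) = (1 / real n) / 24" "1 / (4 * real n) = (1 / real n) / 4"
      by simp_all
    ultimately show ?thesis unfolding stirling_err_def
      by (simp only: of_nat_mult of_nat_numeral) (simp add: algebra_simps)
  qed
  have "(\<lambda>n. 4 * stirling_err n - 2 * stirling_err (2 * n) + (ln (real n) - ln 2 - ln (2 * real n + 1) + 1 / (4 * real n) + ln (2 * pi)))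
      \<longlonglongrightarrow> 4 * L - 2 * L + (- 2 * ln 2 + ln (2 * pi))"
  proof -
    have "(\<lambda>n. stirling_err (2 * n)) \<longlonglongrightarrow> L"
      by (rule filterlim_compose[OF L(1)]) real_asymp
    moreover have "(\<lambda>n. ln (real n) - ln 2 - ln (2 * real n + 1) + 1 / (4 * real n) + ln (2 * pi)) \<longlonglongrightarrow> - 2 * ln 2 + ln (2 * pi)"
      by real_asymp
    ultimately show ?thesis using L(1)
      by (intro tendsto_add[OF tendsto_diff[OF tendsto_mult_left tendsto_mult_left]])
  qed
  moreover have "eventually (\<lambda>n. 4 * stirling_err n - 2 * stirling_err (2 * n) + (ln (real n) - ln 2 - ln (2 * real n + 1) + 1 / (4 * real n) + ln (2 * pi)) = ln (W n)) sequentially"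
    using eventually_ge_at_top[of 1] by eventually_elim (simp add: eq)
  ultimately have "(\<lambda>n. ln (W n)) \<longlonglongrightarrow> 4 * L - 2 * L + (- 2 * ln 2 + ln (2 * pi))"
    by (rule Lim_transform_eventually)
  from LIMSEQ_unique[OF this lnW] have L0: "L = 0" by (simp add: ln_mult ln_div)
  thus "stirling_err \<longlonglongrightarrow> 0" using L by simp
  show "(\<lambda>n. real n * stirling_err n) \<longlonglongrightarrow> 0"
  proof (rule Lim_null_comparison)
    show "\<forall>\<^sub>F n in sequentially. norm (real n * stirling_err n) \<le> D / real n"
      using L(2) eventually_gt_at_top[of 0]
    proof eventually_elim
      case (elim n)
      have "real n * \<bar>stirling_err n\<bar> \<le> real n * (D / real n ^ 2)"
        using elim L0 by (intro mult_left_mono) auto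
      thus ?case using elim by (simp add: abs_mult power2_eq_square)
    qed
    show "(\<lambda>n. D / real n) \<longlonglongrightarrow> 0" by real_asymp
  qed
qed

text \<open>Behind the induction is summation by parts: the sum of ln k! for k <= n is (n + 1) ln n!
  minus the sum of k ln k.\<close>

lemma sum_stirling_err:
  "(\<Sum>k=1..n. stirling_err k) = (real n + 1 / 2) * ln (fact n) - 2 * (\<Sum>k=1..n. real k * ln (real k))
     + real n * (real n + 1) / 2 - real n / 2 * ln (2 * pi) - harm n / 12"
proof (induction n)
  case (Suc n)
  have f: "ln (fact (Suc n) :: real) = ln (real n + 1) + ln (fact n)" by (simp add: ln_mult add_ac)
  have r: "real (Suc n) = real n + 1" "1 / (12 * (real n + 1)) = inverse (real n + 1) / 12" by (simp_all add: field_simps)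
  show ?case unfolding sum.cl_ivl_Suc harm_Suc stirling_err_def[of "Suc n"] f r using Suc.IH
    by (simp add: algebra_simps add_divide_distrib diff_divide_distrib)
qed (simp_all add: harm_def)

text \<open>The even-indexed analogue. Sums of k ln k up to 2 n and up to n both occur, since ln
  (2k) = ln 2 + ln k.\<close>

lemma sum_stirling_err_double:
  "(\<Sum>k=1..n. stirling_err (2 * k)) = (real n + 1 / 2) * ln (fact (2 * n))
     - (\<Sum>k=1..2 * n. real k * ln (real k)) / 2 - 2 * (\<Sum>k=1..n. real k * ln (real k))
     - real n * (real n + 1) * ln 2 + real n * (real n + 1) - real n / 2 * ln (2 * pi) - harm n / 24"
proof (induction n)
  case (Suc n)
  define a b c where "a = ln (real n + 1)" and "b = ln (2 * real n + 1)" and "c = ln (fact (2 * n) :: real)"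
  have l: "ln (2 * real n + 2) = ln 2 + a" using ln_mult[of 2 "real n + 1"] by (simp add: a_def)
  have f: "ln (fact (2 * Suc n) :: real) = ln 2 + a + b + c"
  proof -
    have "fact (2 * Suc n) = (2 * real n + 2) * ((2 * real n + 1) * fact (2 * n))" by (simp add: algebra_simps)
    moreover have p: "2 * real n + 2 > 0" "2 * real n + 1 > 0" "(fact (2 * n) :: real) > 0" by simp_all
    have "ln ((2 * real n + 2) * ((2 * real n + 1) * fact (2 * n))) = ln (2 * real n + 2) + (ln (2 * real n + 1) + c)"
      using p unfolding c_def by (subst ln_mult, simp, simp, subst ln_mult) simp_all
    ultimately show ?thesis unfolding l b_def by (simp only: add.assoc)
  qed
  have s: "(\<Sum>k=1..2 * Suc n. real k * ln (real k)) = (\<Sum>k=1..2 * n. real k * ln (real k)) + (2 * real n + 1) * b + (2 * real n + 2) * (ln 2 + a)"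
    using l by (simp add: b_def add_ac)
  have r: "real (2 * Suc n) = 2 * real n + 2" "real (Suc n) = real n + 1"
     "1 / (12 * (2 * real n + 2)) = inverse (real n + 1) / 24" by (simp_all add: field_simps)
  show ?case unfolding s unfolding sum.cl_ivl_Suc[of _ 1 n] harm_Suc stirling_err_def[of "2 * Suc n"] f r l
    unfolding a_def [symmetric] using Suc.IH [folded c_def]
    by (simp add: algebra_simps add_divide_distrib diff_divide_distrib)
qed (simp_all add: harm_def)

text \<open>Insert Stirling's formula for ln n! and \<open>glaisher_seq\<close> for the sum of k ln
  k. All growing terms cancel except H_n - ln n, which gives gamma, and (n + 1/2) times the error
  tends to 0.\<close>

lemma stirling_err_sums:
  assumes z: "glaisher_seq \<longlonglongrightarrow> z"
  shows "(\<lambda>n. stirling_err (Suc n)) sums (ln (2 * pi) / 4 - (1 + euler_mascheroni) / 12 + 2 * z)"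
    and "(\<lambda>n. stirling_err (2 * Suc n)) sums
       (ln (2 * pi) / 4 - 1 / 6 + 5 / 24 * ln 2 + 5 / 2 * z - euler_mascheroni / 24)"
proof -
  have H: "(\<Sum>k=1..n. real k * ln (real k)) = - glaisher_seq n + (real n ^ 2 / 2 + real n / 2 + 1 / 12) * ln (real n) - real n ^ 2 / 4 + 1 / 12" for n
    by (simp add: glaisher_seq_def)
  have F: "ln (fact n) = stirling_err n + (real n + 1 / 2) * ln (real n) - real n + 1 / (12 * real n) + ln (2 * pi) / 2" for n
    by (simp add: stirling_err_def)
  have half: "(\<lambda>n. (real n + 1 / 2) * stirling_err n) \<longlonglongrightarrow> 0"
    using tendsto_add[OF stirling_err_times_tendsto tendsto_mult_right_zero[OF stirling_err_tendsto, of "1/2"]]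
    by (simp add: algebra_simps)
  have dbl: "filterlim (\<lambda>n::nat. 2 * n) sequentially sequentially" by real_asymp
  have half2: "(\<lambda>n. (real n + 1 / 2) * stirling_err (2 * n)) \<longlonglongrightarrow> 0"
    using tendsto_add[OF tendsto_mult_right_zero[OF filterlim_compose[OF stirling_err_times_tendsto dbl], of "1/2"]
       tendsto_mult_right_zero[OF filterlim_compose[OF stirling_err_tendsto dbl], of "1/2"]]
    by (simp add: algebra_simps)
  have inv: "(\<lambda>n. 1 / (24 * real n)) \<longlonglongrightarrow> 0" "(\<lambda>n. 1 / (48 * real n)) \<longlonglongrightarrow> 0" by real_asymp+
  have "(\<lambda>n. (real n + 1 / 2) * stirling_err n + 2 * glaisher_seq n - (harm n - ln (real n)) / 12 + ln (2 * pi) / 4 - 1 / 12 + 1 / (24 * real n))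
     \<longlonglongrightarrow> 0 + 2 * z - euler_mascheroni / 12 + ln (2 * pi) / 4 - 1 / 12 + 0"
    by (intro tendsto_intros half z euler_mascheroni_LIMSEQ inv) simp_all
  moreover have "eventually (\<lambda>n. (real n + 1 / 2) * stirling_err n + 2 * glaisher_seq n - (harm n - ln (real n)) / 12 + ln (2 * pi) / 4 - 1 / 12 + 1 / (24 * real n)
      = (\<Sum>k=1..n. stirling_err k)) sequentially"
    using eventually_gt_at_top[of 0]
  proof eventually_elim
    case (elim n)
    show ?case unfolding sum_stirling_err H F using elim by (simp add: field_simps power2_eq_square)
  qed
  ultimately have "(\<lambda>n. \<Sum>k=1..n. stirling_err k) \<longlonglongrightarrow> 0 + 2 * z - euler_mascheroni / 12 + ln (2 * pi) / 4 - 1 / 12 + 0"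
    by (rule Lim_transform_eventually)
  moreover have "(\<Sum>k=1..n. stirling_err k) = (\<Sum>k<n. stirling_err (Suc k))" for n
    by (simp add: sum.shift_bounds_Suc_ivl atLeast0LessThan [symmetric] sum.atLeast1_atMost_eq)
  moreover have "0 + 2 * z - euler_mascheroni / 12 + ln (2 * pi) / 4 - 1 / 12 + 0 = ln (2 * pi) / 4 - (1 + euler_mascheroni) / 12 + 2 * z"
    by (simp add: add_divide_distrib)
  ultimately show "(\<lambda>n. stirling_err (Suc n)) sums (ln (2 * pi) / 4 - (1 + euler_mascheroni) / 12 + 2 * z)"
    unfolding sums_def by (simp only:)
  have "(\<lambda>n. (real n + 1 / 2) * stirling_err (2 * n) + glaisher_seq (2 * n) / 2 + 2 * glaisher_seq n - (harm n - ln (real n)) / 24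
        + 5 / 24 * ln 2 - 1 / 6 + ln (2 * pi) / 4 + 1 / (48 * real n))
     \<longlonglongrightarrow> 0 + z / 2 + 2 * z - euler_mascheroni / 24 + 5 / 24 * ln 2 - 1 / 6 + ln (2 * pi) / 4 + 0"
    by (intro tendsto_intros half2 z euler_mascheroni_LIMSEQ inv filterlim_compose[OF z dbl]) simp_all
  moreover have "eventually (\<lambda>n. (real n + 1 / 2) * stirling_err (2 * n) + glaisher_seq (2 * n) / 2 + 2 * glaisher_seq n - (harm n - ln (real n)) / 24
        + 5 / 24 * ln 2 - 1 / 6 + ln (2 * pi) / 4 + 1 / (48 * real n)
      = (\<Sum>k=1..n. stirling_err (2 * k))) sequentially"
    using eventually_gt_at_top[of 0]
  proof eventually_elim
    case (elim n)
    have "ln (real (2 * n)) = ln 2 + ln (real n)" using elim by (simp add: ln_mult)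
    thus ?case unfolding sum_stirling_err_double H F using elim by (simp add: field_simps power2_eq_square)
  qed
  ultimately have "(\<lambda>n. \<Sum>k=1..n. stirling_err (2 * k)) \<longlonglongrightarrow> 0 + z / 2 + 2 * z - euler_mascheroni / 24 + 5 / 24 * ln 2 - 1 / 6 + ln (2 * pi) / 4 + 0"
    by (rule Lim_transform_eventually)
  moreover have "(\<Sum>k=1..n. stirling_err (2 * k)) = (\<Sum>k<n. stirling_err (2 * Suc k))" for n
    by (simp add: sum.shift_bounds_Suc_ivl atLeast0LessThan [symmetric] sum.atLeast1_atMost_eq)
  moreover have "0 + z / 2 + 2 * z - euler_mascheroni / 24 + 5 / 24 * ln 2 - 1 / 6 + ln (2 * pi) / 4 + 0 =
       ln (2 * pi) / 4 - 1 / 6 + 5 / 24 * ln 2 + 5 / 2 * z - euler_mascheroni / 24" by simp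
  ultimately show "(\<lambda>n. stirling_err (2 * Suc n)) sums
       (ln (2 * pi) / 4 - 1 / 6 + 5 / 24 * ln 2 + 5 / 2 * z - euler_mascheroni / 24)"
    unfolding sums_def by (simp only:)
qed

section \<open>The integral of the integrand of the theorem\<close>

definition zline :: "real \<Rightarrow> complex" where "zline t = 3/2 + \<i> * of_real t"

lemma Re_zline [simp]: "Re (zline t) = 3/2" and Im_zline [simp]: "Im (zline t) = t"
  by (simp_all add: zline_def)

lemma zline_nonzero [simp]: "zline t \<noteq> 0" "zline t + 1 \<noteq> 0"
  by (auto simp: complex_eq_iff)

lemma norm_zline_ge: "norm (zline t) \<ge> 1" "norm (zline t + 1) \<ge> 1"
  using complex_Re_le_cmod[of "zline t"] complex_Re_le_cmod[of "zline t + 1"] by simp_all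

lemma zline_measurable [measurable]: "zline \<in> borel_measurable borel"
  unfolding zline_def[abs_def] by measurable

text \<open>For f(x) = x^z / z this is an antiderivative of f plus f'(x) / 12, the part of
  Euler-Maclaurin that telescopes.\<close>

definition zeta_bdry :: "real \<Rightarrow> complex \<Rightarrow> complex" where
  "zeta_bdry x z = of_real x powr (z + 1) / (z * (z + 1)) + of_real x powr (z - 1) / 12"

text \<open>Trapezoidal mean of f(x) = x^z / z on [k, k + 1] minus its integral and minus the 1/12
  correction. Unlike the zeta series it starts at k = 0, where \<open>0 powr z = 0\<close>; that
  first cell supplies the explicit terms of zeta(-z)/z, so no separate boundary terms
  remain.\<close>

definition zeta_cell :: "nat \<Rightarrow> complex \<Rightarrow> complex" where
  "zeta_cell k z = (of_real (real k) powr z / z + of_real (real k + 1) powr z / z) / 2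
     + (zeta_bdry (real k) z - zeta_bdry (real k + 1) z)"

lemma zeta_cell_0: "z \<noteq> 0 \<Longrightarrow> z + 1 \<noteq> 0 \<Longrightarrow> zeta_cell 0 z = (1 / (- z - 1) + 1 / 2 - z / 12) / z"
proof -
  assume z: "z \<noteq> 0" "z + 1 \<noteq> 0"
  have "1 / (- z - 1) = - (1 / (z + 1))" by (simp add: divide_simps) (use z in \<open>auto simp: add_eq_0_iff\<close>)
  thus ?thesis using z by (simp add: zeta_cell_def zeta_bdry_def diff_divide_distrib add_divide_distrib mult.commute)
qed

lemma zeta_cell_Suc:
  assumes "z \<noteq> 0" "z + 1 \<noteq> 0"
  shows "zeta_cell (Suc i) z = pw_rem 3 (- z) 0 0 (real (1 + i)) / z"
proof -
  define k where "k = real (1 + i)"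
  have k: "k > 0" by (simp add: k_def)
  have z1: "- z \<noteq> 1" using assms by (metis add.right_inverse add.commute)
  define a b c d e f where "a = complex_of_real k powr z" "b = complex_of_real (k + 1) powr z"
    "c = complex_of_real k powr (z + 1)" "d = complex_of_real (k + 1) powr (z + 1)"
    "e = complex_of_real k powr (z - 1)" "f = complex_of_real (k + 1) powr (z - 1)"
  have "pw_rem 3 (- z) 0 0 k = (a + b) / 2 - (c - d) / (- z - 1) + - z / 12 * (f - e)"
    unfolding pw_rem_3_eq[OF k] pw_rem_0_closed[OF k z1] a_b_c_d_e_f_def
    by (simp add: add.commute)
  moreover have "(c - d) / (- z - 1) = - ((c - d) / (z + 1))"
    by (metis minus_add_distrib minus_divide_right uminus_add_conv_diff add.commute)
  moreover have "zeta_cell (Suc i) z = (a / z + b / z) / 2 + ((c / (z * (z + 1)) + e / 12) - (d / (z * (z + 1)) + f / 12))"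
    unfolding zeta_cell_def zeta_bdry_def a_b_c_d_e_f_def k_def by (simp add: add_ac)
  moreover have "((a + b) / 2 + (c - d) / (z + 1) + - z / 12 * (f - e)) / z =
      (a / z + b / z) / 2 + ((c / (z * (z + 1)) + e / 12) - (d / (z * (z + 1)) + f / 12))"
  proof -
    have 1: "(c - d) / (z + 1) / z = c / (z * (z + 1)) - d / (z * (z + 1))"
      by (simp add: diff_divide_distrib mult.commute)
    have 2: "(- z / 12 * (f - e)) / z = e / 12 - f / 12" using assms by (simp add: field_simps)
    have 3: "((a + b) / 2 + X + Y) / z = (a / z + b / z) / 2 + X / z + Y / z" for X Y
      by (simp add: add_divide_distrib mult.commute)
    show ?thesis unfolding 3 1 2 by simp
  qed
  ultimately show ?thesis unfolding k_def by simp
qed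

text \<open>The general bound \<open>norm_pw_rem_le\<close> grows exponentially in the norm of s.
  Here the third derivative is explicit, which gives the polynomial growth that
  \<open>sech_integrable\<close> asks for.\<close>

lemma norm_pw_rem_3_le:
  obtains B where "B \<ge> 0" "\<And>s k. k \<ge> 1 \<Longrightarrow> Re s > - 3 \<Longrightarrow>
      norm (pw_rem 3 s 0 0 k) \<le> B * norm (s * (s + 1) * (s + 2)) * k powr (- Re s - 3)"
proof -
  obtain B where B: "\<And>t. t \<in> {0..1} \<Longrightarrow> \<bar>poly (em_kernel 3) t\<bar> \<le> B" using em_kernel_bounded by blast
  have B0: "B \<ge> 0" using B[of 0] by simp
  have "norm (pw_rem 3 s 0 0 k) \<le> B * norm (s * (s + 1) * (s + 2)) * k powr (- Re s - 3)"
    if k: "k \<ge> 1" and s: "Re s > -3" for s k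
  proof -
    have "norm (integral {0..1} (\<lambda>t. complex_of_real (poly (em_kernel 3) t) * pw_deriv 3 s 0 (of_real 0) (of_real (k + t))))
      \<le> (B * norm (s * (s + 1) * (s + 2)) * k powr (- Re s - 3)) * (1 - 0)"
    proof (rule integral_bound)
      show "continuous_on {0..1} (\<lambda>t. complex_of_real (poly (em_kernel 3) t) * pw_deriv 3 s 0 (of_real 0) (of_real (k + t)))"
        using k by (intro continuous_intros continuous_on_pw_deriv) auto
      fix t :: real assume t: "t \<in> {0..1}"
      have "complex_of_real (k + t) \<noteq> 0" using t k by (simp del: of_real_add)
      from pw_deriv_3_0[OF this, of s]
      have "norm (pw_deriv 3 s 0 (of_real 0) (of_real (k + t))) = norm (s * (s + 1) * (s + 2)) * (k + t) powr (- Re s - 3)"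
        using t k by (simp add: norm_mult norm_powr_real_powr del: of_real_add)
      also have "\<dots> \<le> norm (s * (s + 1) * (s + 2)) * k powr (- Re s - 3)"
        using t k s by (intro mult_left_mono powr_mono2') auto
      finally have "norm (complex_of_real (poly (em_kernel 3) t)) * norm (pw_deriv 3 s 0 (of_real 0) (of_real (k + t)))
          \<le> B * (norm (s * (s + 1) * (s + 2)) * k powr (- Re s - 3))"
        using t B B0 by (intro mult_mono) auto
      thus "norm (complex_of_real (poly (em_kernel 3) t) * pw_deriv 3 s 0 (of_real 0) (of_real (k + t)))
          \<le> B * norm (s * (s + 1) * (s + 2)) * k powr (- Re s - 3)"
        by (simp add: norm_mult mult.assoc)
    qed simp
    thus ?thesis by (simp add: pw_rem_def em_rem_def)
  qed
  with B0 show ?thesis by (rule that)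
qed

text \<open>The factor z of the cubic in \<open>norm_pw_rem_3_le\<close> cancels against the
  division by z, leaving quadratic growth in t and the summable decay k^(-3/2).\<close>

lemma zeta_cell_bound:
  obtains B where "B \<ge> 0" "\<And>i t. norm (zeta_cell (Suc i) (zline t)) \<le> B * (1 + \<bar>t\<bar>) ^ 2 * real (1 + i) powr (- 3/2)"
    "\<And>t. norm (zeta_cell 0 (zline t)) \<le> 2 * (1 + \<bar>t\<bar>) ^ 2"
proof -
  obtain B where B: "B \<ge> 0" "\<And>s k. k \<ge> 1 \<Longrightarrow> Re s > - 3 \<Longrightarrow>
      norm (pw_rem 3 s 0 0 k) \<le> B * norm (s * (s + 1) * (s + 2)) * k powr (- Re s - 3)"
    by (rule norm_pw_rem_3_le) (rule that)
  have c1: "norm (zeta_cell (Suc i) (zline t)) \<le> B * (1 + \<bar>t\<bar>) ^ 2 * real (1 + i) powr (- 3/2)" for i t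
  proof -
    let ?z = "zline t"
    have "norm (pw_rem 3 (- ?z) 0 0 (real (1 + i))) \<le> B * norm (- ?z * (- ?z + 1) * (- ?z + 2)) * real (1 + i) powr (- Re (- ?z) - 3)"
      by (rule B(2)) auto
    hence "norm (pw_rem 3 (- ?z) 0 0 (real (1 + i)) / ?z) \<le> (B * norm (- ?z * (- ?z + 1) * (- ?z + 2)) * real (1 + i) powr (- 3/2)) / norm ?z"
      unfolding norm_divide by (intro divide_right_mono) auto
    also have "\<dots> = B * (norm (- ?z + 1) * norm (- ?z + 2)) * real (1 + i) powr (- 3/2)"
      by (simp add: norm_mult)
    also have "\<dots> \<le> B * ((1 + \<bar>t\<bar>) * (1 + \<bar>t\<bar>)) * real (1 + i) powr (- 3/2)"
    proof -
      have "- ?z + 1 = - of_real (1/2) - \<i> * of_real t" "- ?z + 2 = of_real (1/2) - \<i> * of_real t" by (simp_all add: zline_def)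
      hence "norm (- ?z + 1) \<le> 1 + \<bar>t\<bar>" "norm (- ?z + 2) \<le> 1 + \<bar>t\<bar>"
        using norm_triangle_ineq4[of "- complex_of_real (1/2)" "\<i> * of_real t"] norm_triangle_ineq4[of "complex_of_real (1/2)" "\<i> * of_real t"]
        by (auto simp: norm_mult)
      thus ?thesis using B by (intro mult_right_mono mult_left_mono mult_mono) auto
    qed
    finally show ?thesis by (simp add: zeta_cell_Suc power2_eq_square)
  qed
  have c0: "norm (zeta_cell 0 (zline t)) \<le> 2 * (1 + \<bar>t\<bar>) ^ 2" for t
  proof -
    let ?z = "zline t"
    have "zeta_cell 0 ?z = (1 / ?z) / 2 - (1 / (?z * (?z + 1)) + 1 / 12)"
      by (simp add: zeta_cell_def zeta_bdry_def)
    also have "norm \<dots> \<le> norm ((1 / ?z) / 2) + (norm (1 / (?z * (?z + 1))) + norm (1 / 12 :: complex))"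
      by (intro order_trans[OF norm_triangle_ineq4] add_left_mono norm_triangle_ineq)
    also have "norm ((1 / ?z) / 2) \<le> 1 / 2" using norm_zline_ge(1)[of t] by (simp add: norm_divide divide_simps)
    also have "norm (1 / (?z * (?z + 1))) \<le> 1"
      using mult_mono[OF norm_zline_ge[of t]] by (simp add: norm_divide norm_mult divide_simps)
    also have "1 / 2 + (1 + norm (1 / 12 :: complex)) \<le> 2 * 1" by simp
    also have "\<dots> \<le> 2 * (1 + \<bar>t\<bar>) ^ 2" by (intro mult_left_mono one_le_power) auto
    finally show ?thesis by simp
  qed
  show ?thesis using B(1) c1 c0 by (rule that)
qed

lemma zeta_cell_sums: "(\<lambda>k. zeta_cell k (zline t)) sums (zeta (- zline t) / zline t)"
proof -
  let ?z = "zline t"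
  have "summable (\<lambda>i. norm (pw_rem 3 (- ?z) 0 0 (real (1 + i))))"
    using pw_rem_summable[of 1 0 "- ?z" 0 3] by simp
  hence "(\<lambda>i. pw_rem 3 (- ?z) 0 0 (real (1 + i))) sums (\<Sum>i. pw_rem 3 (- ?z) 0 0 (real (1 + i)))"
    by (rule summable_sums[OF summable_norm_cancel])
  hence "(\<lambda>i. zeta_cell (Suc i) ?z) sums ((\<Sum>i. pw_rem 3 (- ?z) 0 0 (real (1 + i))) / ?z)"
    unfolding zeta_cell_Suc[OF zline_nonzero] by (rule sums_divide)
  hence "(\<lambda>k. zeta_cell k ?z) sums ((\<Sum>i. pw_rem 3 (- ?z) 0 0 (real (1 + i))) / ?z + zeta_cell 0 ?z)"
    by (rule sums_Suc)
  also have "(\<Sum>i. pw_rem 3 (- ?z) 0 0 (real (1 + i))) / ?z + zeta_cell 0 ?z = zeta (- ?z) / ?z"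
  proof -
    have "- ?z \<noteq> 1" by (auto simp: complex_eq_iff)
    hence "zeta (- ?z) = 1 / (- ?z - 1) + (1 / 2 + (- ?z) / 12 + (\<Sum>i. pw_rem 3 (- ?z) 0 0 (real (1 + i))))"
      using zeta_eq_eta[of "- ?z"] eta_eq[of "- ?z"] pw_rem_infsum_eq_suminf[of "- ?z" 3] by simp
    thus ?thesis unfolding zeta_cell_0[OF zline_nonzero] by (simp add: add_divide_distrib diff_divide_distrib)
  qed
  finally show ?thesis .
qed

lemma zline_kernel_integrable:
  assumes v: "v > 0"
  shows "integrable lborel (\<lambda>t. exp (zline t * of_real (ln v)) / of_real (cosh (pi * t)))"
    and "integrable lborel (\<lambda>t. exp (zline t * of_real (ln v)) / zline t / of_real (cosh (pi * t)))"
    and "integrable lborel (\<lambda>t. exp ((zline t + 1) * of_real (ln v)) / (zline t + 1) / of_real (cosh (pi * t)))"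
proof -
  have n0: "norm (exp (zline t * of_real (ln v))) = v powr (3/2)" "norm (exp ((zline t + 1) * of_real (ln v))) = v powr (5/2)" for t
    using v by (simp_all add: powr_def)
  show "integrable lborel (\<lambda>t. exp (zline t * of_real (ln v)) / of_real (cosh (pi * t)))"
    by (rule sech_integrable[where K = "v powr (3/2)" and m = 0]) (simp_all add: n0 del: norm_exp_eq_Re)
  show "integrable lborel (\<lambda>t. exp (zline t * of_real (ln v)) / zline t / of_real (cosh (pi * t)))"
  proof (rule sech_integrable[where K = "v powr (3/2)" and m = 0])
    show "norm (exp (zline t * of_real (ln v)) / zline t) \<le> v powr (3/2) * (1 + \<bar>t\<bar>) ^ 0" for t
      unfolding norm_divide n0 using norm_zline_ge(1)[of t] by (simp add: divide_le_eq mult_le_cancel_left1)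
  qed simp
  show "integrable lborel (\<lambda>t. exp ((zline t + 1) * of_real (ln v)) / (zline t + 1) / of_real (cosh (pi * t)))"
  proof (rule sech_integrable[where K = "v powr (5/2)" and m = 0])
    show "norm (exp ((zline t + 1) * of_real (ln v)) / (zline t + 1)) \<le> v powr (5/2) * (1 + \<bar>t\<bar>) ^ 0" for t
      unfolding norm_divide n0 using norm_zline_ge(2)[of t] by (simp add: divide_le_eq mult_le_cancel_left1)
  qed simp
qed

text \<open>With v = x / n the integrand is v^z / z over cosh. The point x = 0 is needed for the
  cell k = 0.\<close>

lemma has_bochner_integral_power:
  assumes n: "n > 0" and x: "x \<ge> 0"
  shows "has_bochner_integral lborel (\<lambda>t. exp (- zline t * of_real (ln n)) * (of_real x powr zline t / zline t) / of_real (cosh (pi * t)))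
     (of_real (2 * (x / n - (ln (n + x) - ln n))))"
proof (cases "x = 0")
  case False
  define v where "v = x / n"
  have v: "v > 0" using False n x by (simp add: v_def)
  have eq: "exp (- zline t * of_real (ln n)) * (of_real x powr zline t / zline t) / of_real (cosh (pi * t)) =
      exp (zline t * of_real (ln v)) / zline t / of_real (cosh (pi * t))" for t
  proof -
    have "of_real x powr zline t = exp (zline t * of_real (ln x))" using False x by (intro of_real_powr_exp) auto
    moreover have lv: "ln v = ln x - ln n" using False n x by (simp add: v_def ln_div)
    have "exp (zline t * of_real (ln v)) = exp (- zline t * of_real (ln n)) * exp (zline t * of_real (ln x))"
      unfolding lv by (simp add: algebra_simps flip: exp_add)
    ultimately show ?thesis by simp
  qed
  have "1 + v = (n + x) / n" "n + x > 0" using n x by (simp_all add: v_def field_simps)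
  hence "ln (1 + v) = ln (n + x) - ln n" using n by (simp add: ln_div)
  thus ?thesis unfolding eq has_bochner_integral_iff
    using zline_kernel_integrable(2)[OF v] mellin_integrated_0[OF v] by (simp add: zline_def v_def)
qed (use n in \<open>simp add: has_bochner_integral_iff\<close>)

text \<open>The partial fractions 1/(z (z + 1)) = 1/z - 1/(z + 1) split the integrand into the three
  Mellin integrals at v = x / n.\<close>

lemma has_bochner_integral_bdry:
  assumes n: "n > 0" and x: "x \<ge> 0"
  shows "has_bochner_integral lborel (\<lambda>t. exp (- zline t * of_real (ln n)) * zeta_bdry x (zline t) / of_real (cosh (pi * t)))
     (of_real (2 * (x ^ 2 / (2 * n) + x - (n + x) * (ln (n + x) - ln n) + (1 / n - 1 / (n + x)) / 12)))"
proof (cases "x = 0")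
  case True
  have "zeta_bdry 0 (zline t) = 0" for t by (simp add: zeta_bdry_def)
  thus ?thesis using True n by (simp add: has_bochner_integral_iff)
next
  case False
  define v where "v = x / n"
  have x: "x > 0" using x False by simp
  have v: "v > 0" using n x by (simp add: v_def)
  have lv: "ln v = ln x - ln n" using n x by (simp add: v_def ln_div)
  define E where "E t = exp (zline t * of_real (ln v))" for t
  have eq: "exp (- zline t * of_real (ln n)) * zeta_bdry x (zline t) / of_real (cosh (pi * t)) =
      of_real x * (exp (zline t * of_real (ln v)) / zline t / of_real (cosh (pi * t)))
      - of_real n * (exp ((zline t + 1) * of_real (ln v)) / (zline t + 1) / of_real (cosh (pi * t)))
      + of_real (1 / (12 * x)) * (exp (zline t * of_real (ln v)) / of_real (cosh (pi * t)))" for t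
  proof -
    define z where "z = zline t"
    have z: "z \<noteq> 0" "z + 1 \<noteq> 0" by (simp_all add: z_def)
    define C where "C = complex_of_real (cosh (pi * t))"
    define G H where "G = exp (- z * of_real (ln n))" and "H = exp (z * of_real (ln x))"
    have p1: "of_real x powr (z + 1) = H * of_real x" and p2: "of_real x powr (z - 1) = H / of_real x"
      using x by (simp_all add: of_real_powr_exp H_def distrib_right left_diff_distrib exp_add exp_diff exp_of_real)
    have e1: "exp (z * of_real (ln v)) = G * H" by (simp add: lv G_def H_def algebra_simps flip: exp_add)
    have e2: "exp ((z + 1) * of_real (ln v)) = G * H * (of_real x / of_real n)"
      using n x by (simp add: distrib_right exp_add e1) (simp add: lv exp_diff exp_of_real)
    have frac: "1 / (z * (z + 1)) = 1 / z - 1 / (z + 1)" using z by (simp add: field_simps)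
    have "zeta_bdry x z = H * of_real x * (1 / z - 1 / (z + 1)) + H / of_real x / 12"
      unfolding zeta_bdry_def p1 p2 frac [symmetric] by simp
    hence "G * zeta_bdry x z / C = G * (H * of_real x * (1 / z - 1 / (z + 1)) + H / of_real x / 12) / C"
      by (simp only:)
    also have "\<dots> = of_real x * (G * H / z / C) - of_real x * (G * H) / (z + 1) / C + of_real (1 / (12 * x)) * (G * H / C)"
    proof -
      have "G * (H * X * (p - q) + H * Y / 12) * c = X * (G * H * p * c) - X * (G * H) * q * c + (Y / 12) * (G * H * c)"
        for X Y p q c by (simp add: algebra_simps add_divide_distrib diff_divide_distrib)
      from this[of "of_real x" "1 / z" "1 / (z + 1)" "1 / of_real x" "1 / C"] show ?thesis
        by (simp add: mult.commute)
    qed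
    finally have 1: "G * zeta_bdry x z / C = of_real x * (G * H / z / C) - of_real x * (G * H) / (z + 1) / C + of_real (1 / (12 * x)) * (G * H / C)" .
    have 2: "of_real n * (G * H * (of_real x / of_real n) / (z + 1) / C) = of_real x * (G * H) / (z + 1) / C"
      using n by simp
    show ?thesis unfolding z_def [symmetric] C_def [symmetric] e1 e2 G_def [symmetric] 1 2 ..
  qed
  have v1: "1 + v = (n + x) / n" "n + x > 0" using n x by (simp_all add: v_def field_simps)
  hence l1: "ln (1 + v) = ln (n + x) - ln n" using n by (simp add: ln_div)
  have i1: "(LINT t|lborel. exp (zline t * of_real (ln v)) / zline t / of_real (cosh (pi * t))) = of_real (2 * (v - ln (1 + v)))"
    using mellin_integrated_0[OF v] by (simp add: zline_def)
  have i2: "(LINT t|lborel. exp ((zline t + 1) * of_real (ln v)) / (zline t + 1) / of_real (cosh (pi * t))) = of_real (2 * (v ^ 2 / 2 - v + ln (1 + v)))"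
  proof -
    have "zline t + 1 = 5/2 + \<i> * of_real t" for t by (simp add: zline_def)
    thus ?thesis using mellin_integrated_1[OF v] by simp
  qed
  have i3: "(LINT t|lborel. exp (zline t * of_real (ln v)) / of_real (cosh (pi * t))) = of_real (2 * v ^ 2 / (1 + v))"
    using mellin_base[OF v] by (simp add: zline_def)
  note k = zline_kernel_integrable[OF v]
  have "has_bochner_integral lborel (\<lambda>t. exp (- zline t * of_real (ln n)) * zeta_bdry x (zline t) / of_real (cosh (pi * t)))
      (of_real x * of_real (2 * (v - ln (1 + v))) - of_real n * of_real (2 * (v ^ 2 / 2 - v + ln (1 + v)))
        + of_real (1 / (12 * x)) * of_real (2 * v ^ 2 / (1 + v)))"
    unfolding eq
    by (intro has_bochner_integral_add has_bochner_integral_diff has_bochner_integral_mult_right)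
       (use k i1 i2 i3 in \<open>simp_all add: has_bochner_integral_iff\<close>)
  also have "of_real x * of_real (2 * (v - ln (1 + v))) - of_real n * of_real (2 * (v ^ 2 / 2 - v + ln (1 + v)))
        + of_real (1 / (12 * x)) * of_real (2 * v ^ 2 / (1 + v)) =
      complex_of_real (x * (2 * (v - ln (1 + v))) - n * (2 * (v ^ 2 / 2 - v + ln (1 + v))) + 1 / (12 * x) * (2 * v ^ 2 / (1 + v)))"
    by (simp only: of_real_mult of_real_add of_real_diff)
  also have "x * (2 * (v - ln (1 + v))) - n * (2 * (v ^ 2 / 2 - v + ln (1 + v))) + 1 / (12 * x) * (2 * v ^ 2 / (1 + v))
     = 2 * (x ^ 2 / (2 * n) + x - (n + x) * (ln (n + x) - ln n) + (1 / n - 1 / (n + x)) / 12)"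
  proof -
    have "1 / (12 * x) * (2 * v ^ 2 / (1 + v)) = 2 * ((1 / n - 1 / (n + x)) / 12)"
    proof -
      have "1 / (12 * x) * (2 * v ^ 2 / (1 + v)) = 1 / (12 * x) * (2 * (x / n) ^ 2 / ((n + x) / n))"
        unfolding v1 by (simp add: v_def)
      also have "\<dots> = 2 * ((1 / n - 1 / (n + x)) / 12)"
        using n x v1(2) by (simp add: divide_simps power2_eq_square)
      finally show ?thesis .
    qed
    moreover have "x * (2 * (v - L)) - n * (2 * (v ^ 2 / 2 - v + L)) = 2 * (x ^ 2 / (2 * n) + x - (n + x) * L)" for L
      using n by (simp add: v_def field_simps power2_eq_square)
    ultimately show ?thesis unfolding l1 by (simp only: distrib_left)
  qed
  finally show ?thesis .
qed

text \<open>Integration replaces x^z / z by 2 (x/n - ln (1 + x/n)) inside the cell. What survives is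
  the cell of -2 ln on [n + k, n + k + 1], and trapezoid against integral of ln is the increment of
  Stirling's error.\<close>

lemma has_bochner_integral_cell:
  assumes n: "n \<ge> 1"
  shows "has_bochner_integral lborel (\<lambda>t. exp (- zline t * of_real (ln (real n))) * zeta_cell k (zline t) / of_real (cosh (pi * t)))
     (of_real (2 * (stirling_err (n + k) - stirling_err (Suc (n + k)))))"
proof -
  define N K where "N = real n" and "K = real k"
  have N: "N > 0" "K \<ge> 0" using n by (simp_all add: N_def K_def)
  define j where "j x = 2 * (x / N - (ln (N + x) - ln N))" for x
  define q where "q x = 2 * (x ^ 2 / (2 * N) + x - (N + x) * (ln (N + x) - ln N) + (1 / N - 1 / (N + x)) / 12)" for x
  define e where "e t = exp (- zline t * of_real (ln N))" for t
  define C where "C t = complex_of_real (cosh (pi * t))" for t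
  have eq: "e t * zeta_cell k (zline t) / C t =
    (e t * (of_real K powr zline t / zline t) / C t + e t * (of_real (K + 1) powr zline t / zline t) / C t) / 2
    + (e t * zeta_bdry K (zline t) / C t - e t * zeta_bdry (K + 1) (zline t) / C t)" for t
    unfolding zeta_cell_def K_def by (simp add: algebra_simps add_divide_distrib diff_divide_distrib)
  have "has_bochner_integral lborel (\<lambda>t. e t * zeta_cell k (zline t) / C t)
      ((of_real (j K) + of_real (j (K + 1))) / 2 + (of_real (q K) - of_real (q (K + 1))))"
    unfolding eq unfolding e_def C_def j_def q_def
    by (intro has_bochner_integral_add has_bochner_integral_diff has_bochner_integral_divide
        has_bochner_integral_power has_bochner_integral_bdry) (use N in auto)
  also have "(of_real (j K) + of_real (j (K + 1))) / 2 + (of_real (q K) - of_real (q (K + 1))) =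
      complex_of_real ((j K + j (K + 1)) / 2 + (q K - q (K + 1)))" by simp
  also have "(j K + j (K + 1)) / 2 + (q K - q (K + 1)) = 2 * (stirling_err (n + k) - stirling_err (Suc (n + k)))"
  proof -
    define M where "M = N + K"
    have M: "M > 0" using N by (simp add: M_def)
    have r: "real (n + k) = M" by (simp add: M_def N_def K_def)
    have 1: "stirling_err (n + k) - stirling_err (Suc (n + k)) =
      (M + 1 / 2) * (ln (M + 1) - ln M) - 1 - (1 / M) / 12 + (1 / (M + 1)) / 12"
      using stirling_err_diff[of "n + k"] n unfolding r by (simp add: distrib_left mult.commute)
    have 2: "N + K = M" "N + (K + 1) = M + 1" by (simp_all add: M_def)
    \<comment> \<open>The contribution of the linear part x/n: the trapezoidal rule is exact on
      linear functions.\<close>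
    have 3: "K / N + (K + 1) / N + (K ^ 2 / N - (K + 1) ^ 2 / N) = 0" by (simp add: power2_eq_square algebra_simps add_divide_distrib)
    show ?thesis unfolding 1 j_def q_def 2 using 3 by (simp add: algebra_simps add_divide_distrib diff_divide_distrib)
  qed
  finally show ?thesis unfolding e_def C_def N_def .
qed

text \<open>Interchange of sum and integral under a common quadratic majorant in t.\<close>

lemma sech_weighted_sums:
  fixes f :: "nat \<Rightarrow> real \<Rightarrow> complex"
  assumes [measurable]: "\<And>i. f i \<in> borel_measurable borel"
    and bound: "\<And>i t. norm (f i t) \<le> c i * (1 + \<bar>t\<bar>) ^ 2" and c: "summable c"
  shows "(\<lambda>i. LINT t|lborel. f i t / of_real (cosh (pi * t))) sums (LINT t|lborel. (\<Sum>i. f i t) / of_real (cosh (pi * t)))"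
    and "integrable lborel (\<lambda>t. (\<Sum>i. f i t) / of_real (cosh (pi * t)))"
proof -
  define W where "W = (LINT t|lborel. norm (complex_of_real ((1 + \<bar>t\<bar>) ^ 2) / of_real (cosh (pi * t))))"
  have Wint: "integrable lborel (\<lambda>t. complex_of_real ((1 + \<bar>t\<bar>) ^ 2) / of_real (cosh (pi * t)))"
    by (rule sech_integrable[where K = 1 and m = 2]) (simp_all del: of_real_power of_real_add)
  have int: "integrable lborel (\<lambda>t. f i t / of_real (cosh (pi * t)))" for i
    by (rule sech_integrable[where K = "c i" and m = 2]) (simp_all add: bound)
  have nb: "norm (f i t / of_real (cosh (pi * t))) \<le> c i * norm (complex_of_real ((1 + \<bar>t\<bar>) ^ 2) / of_real (cosh (pi * t)))" for i t
    using divide_right_mono[OF bound[of i t], of "cosh (pi * t)"] by (simp add: norm_divide del: of_real_power of_real_add)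
  have summ: "summable (\<lambda>i. norm (f i t))" for t
    by (rule summable_comparison_test'[OF summable_mult2[OF c, of "(1 + \<bar>t\<bar>) ^ 2"]]) (use bound in auto)
  have A: "AE t in lborel. summable (\<lambda>i. norm (f i t / of_real (cosh (pi * t))))"
    by (rule AE_I2) (use summ in \<open>auto simp: norm_divide intro: summable_divide\<close>)
  have B: "summable (\<lambda>i. LINT t|lborel. norm (f i t / of_real (cosh (pi * t))))"
  proof (rule summable_comparison_test'[OF summable_mult2[OF c, of W]])
    fix i
    have "(LINT t|lborel. norm (f i t / of_real (cosh (pi * t)))) \<le> (LINT t|lborel. c i * norm (complex_of_real ((1 + \<bar>t\<bar>) ^ 2) / of_real (cosh (pi * t))))"
      by (rule integral_mono) (use int Wint nb in auto)
    also have "\<dots> = c i * W" unfolding W_def by simp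
    finally show "norm (LINT t|lborel. norm (f i t / of_real (cosh (pi * t)))) \<le> c i * W" by simp
  qed
  have eq: "(\<Sum>i. f i t / of_real (cosh (pi * t))) = (\<Sum>i. f i t) / of_real (cosh (pi * t))" for t
    by (rule suminf_divide[OF summable_norm_cancel[OF summ]])
  show "(\<lambda>i. LINT t|lborel. f i t / of_real (cosh (pi * t))) sums (LINT t|lborel. (\<Sum>i. f i t) / of_real (cosh (pi * t)))"
    using sums_integral[OF int A B] unfolding eq .
  show "integrable lborel (\<lambda>t. (\<Sum>i. f i t) / of_real (cosh (pi * t)))"
    using integrable_suminf[OF int A B] unfolding eq .
qed

lemma summable_powr_Suc: "summable (\<lambda>i. real (1 + i) powr (- 3/2))"
  by (rule summable_powr_shift) simp

lemma zeta_cell_measurable [measurable]: "(\<lambda>t. zeta_cell k (zline t)) \<in> borel_measurable borel"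
  unfolding zeta_cell_def zeta_bdry_def powr_def by measurable

lemma zeta_minus_zline_measurable [measurable]: "(\<lambda>t. zeta (- zline t) / zline t) \<in> borel_measurable borel"
proof -
  have "(\<lambda>t. \<Sum>k. zeta_cell k (zline t)) \<in> borel_measurable borel" by measurable
  thus ?thesis using sums_unique[OF zeta_cell_sums] by simp
qed

lemma norm_zeta_minus_zline:
  obtains K where "\<And>t. norm (zeta (- zline t) / zline t) \<le> K * (1 + \<bar>t\<bar>) ^ 2"
proof -
  obtain B where B: "B \<ge> 0" "\<And>i t. norm (zeta_cell (Suc i) (zline t)) \<le> B * (1 + \<bar>t\<bar>) ^ 2 * real (1 + i) powr (- 3/2)"
    "\<And>t. norm (zeta_cell 0 (zline t)) \<le> 2 * (1 + \<bar>t\<bar>) ^ 2"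
    by (rule zeta_cell_bound) (rule that)
  define S where "S = (\<Sum>i. real (1 + i) powr (- 3/2))"
  have "norm (zeta (- zline t) / zline t) \<le> (2 + B * S) * (1 + \<bar>t\<bar>) ^ 2" for t
  proof -
    have b: "summable (\<lambda>i. B * (1 + \<bar>t\<bar>) ^ 2 * real (1 + i) powr (- 3/2))"
      by (intro summable_mult summable_powr_Suc)
    have n: "summable (\<lambda>i. norm (zeta_cell (Suc i) (zline t)))"
      by (rule summable_comparison_test'[OF b]) (use B in auto)
    have "zeta (- zline t) / zline t = zeta_cell 0 (zline t) + (\<Sum>i. zeta_cell (Suc i) (zline t))"
      using zeta_cell_sums[of t] suminf_split_head[of "\<lambda>k. zeta_cell k (zline t)"] by (simp add: sums_iff)
    also have "norm \<dots> \<le> 2 * (1 + \<bar>t\<bar>) ^ 2 + (\<Sum>i. norm (zeta_cell (Suc i) (zline t)))"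
      by (intro order_trans[OF norm_triangle_ineq] add_mono B summable_norm n)
    also have "(\<Sum>i. norm (zeta_cell (Suc i) (zline t))) \<le> (\<Sum>i. B * (1 + \<bar>t\<bar>) ^ 2 * real (1 + i) powr (- 3/2))"
      by (intro suminf_le n b B)
    also have "(\<Sum>i. B * (1 + \<bar>t\<bar>) ^ 2 * real (1 + i) powr (- 3/2)) = B * (1 + \<bar>t\<bar>) ^ 2 * S"
      unfolding S_def by (intro suminf_mult summable_powr_Suc)
    finally show ?thesis by (simp add: algebra_simps)
  qed
  thus ?thesis by (rule that)
qed

text \<open>Summing \<open>has_bochner_integral_cell\<close> over k telescopes, and the error tends
  to 0.\<close>

lemma integral_zeta_power:
  assumes n: "n \<ge> 1"
  shows "(LINT t|lborel. exp (- zline t * of_real (ln (real n))) * (zeta (- zline t) / zline t) / of_real (cosh (pi * t)))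
    = of_real (2 * stirling_err n)"
proof -
  obtain B where B: "B \<ge> 0" "\<And>i t. norm (zeta_cell (Suc i) (zline t)) \<le> B * (1 + \<bar>t\<bar>) ^ 2 * real (1 + i) powr (- 3/2)"
    "\<And>t. norm (zeta_cell 0 (zline t)) \<le> 2 * (1 + \<bar>t\<bar>) ^ 2"
    by (rule zeta_cell_bound) (rule that)
  define c where "c k = (if k = 0 then 2 else B * real k powr (- 3/2))" for k
  have "summable (\<lambda>i. c (Suc i))"
    using summable_mult[OF summable_powr_Suc, of B] unfolding c_def by simp
  hence c: "summable c" by (simp only: summable_Suc_iff)
  let ?e = "\<lambda>t. exp (- zline t * of_real (ln (real n)))"
  have e: "norm (?e t) \<le> 1" for t using n by simp
  have cb: "norm (?e t * zeta_cell k (zline t)) \<le> c k * (1 + \<bar>t\<bar>) ^ 2" for k t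
  proof -
    have "norm (?e t * zeta_cell k (zline t)) \<le> 1 * norm (zeta_cell k (zline t))"
      unfolding norm_mult by (rule mult_right_mono[OF e]) simp
    also have "\<dots> \<le> c k * (1 + \<bar>t\<bar>) ^ 2"
      using B(2)[of "k - 1" t] B(3)[of t] by (cases k) (simp_all add: c_def mult_ac)
    finally show ?thesis .
  qed
  have "(\<lambda>k. LINT t|lborel. ?e t * zeta_cell k (zline t) / of_real (cosh (pi * t))) sums
      (LINT t|lborel. (\<Sum>k. ?e t * zeta_cell k (zline t)) / of_real (cosh (pi * t)))"
    by (rule sech_weighted_sums(1)[OF _ cb c]) measurable
  moreover have "(LINT t|lborel. ?e t * zeta_cell k (zline t) / of_real (cosh (pi * t))) =
      of_real (2 * (stirling_err (n + k) - stirling_err (n + Suc k)))" for k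
    using has_bochner_integral_integral_eq[OF has_bochner_integral_cell[OF n, of k]] by simp
  moreover have "(\<Sum>k. ?e t * zeta_cell k (zline t)) = ?e t * (zeta (- zline t) / zline t)" for t
    using sums_mult[OF zeta_cell_sums[of t], of "?e t"] by (simp add: sums_iff)
  moreover have "(\<lambda>k. complex_of_real (2 * (stirling_err (n + k) - stirling_err (n + Suc k)))) sums of_real (2 * (stirling_err (n + 0) - 0))"
  proof (intro sums_of_real sums_mult telescope_sums')
    show "(\<lambda>k. stirling_err (n + k)) \<longlonglongrightarrow> 0"
      using LIMSEQ_ignore_initial_segment[OF stirling_err_tendsto, of n] by (simp add: add.commute)
  qed
  ultimately show ?thesis by (simp add: sums_iff)
qed

lemma zeta_zline_sums: "(\<lambda>n. exp (- zline t * of_real (ln (real (Suc n))))) sums zeta (zline t)"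
proof -
  have "norm (exp (- zline t * of_real (ln (real (Suc n))))) = real (1 + n) powr (- 3/2)" for n
    by (simp add: powr_def)
  hence s: "summable (\<lambda>n. norm (exp (- zline t * of_real (ln (real (Suc n))))))"
    using summable_powr_Suc by simp
  have "of_nat (Suc n) powr (- zline t) = exp (- zline t * of_real (ln (real (Suc n))))" for n
    using of_real_powr_exp[of "real (Suc n)" "- zline t"] by simp
  hence "zeta (zline t) = (\<Sum>n. exp (- zline t * of_real (ln (real (Suc n)))))"
    using zeta_eq_series[of "zline t"] by (simp add: zeta_series_def)
  thus ?thesis using summable_sums[OF summable_norm_cancel[OF s]] by simp
qed

text \<open>Expand zeta(3/2 + it) in its absolutely convergent Dirichlet series and integrate each
  term by \<open>integral_zeta_power\<close>.\<close>

lemma omega_integrand_integral: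
  shows "integrable lborel omega_integrand"
    and "(\<lambda>n. of_real (2 * stirling_err (Suc n))) sums (LINT t|lborel. omega_integrand t)"
proof -
  obtain K where K: "\<And>t. norm (zeta (- zline t) / zline t) \<le> K * (1 + \<bar>t\<bar>) ^ 2"
    by (rule norm_zeta_minus_zline) (rule that)
  define f where "f n t = exp (- zline t * of_real (ln (real (Suc n)))) * (zeta (- zline t) / zline t)" for n t
  have fb: "norm (f n t) \<le> (K * real (1 + n) powr (- 3/2)) * (1 + \<bar>t\<bar>) ^ 2" for n t
  proof -
    have "norm (f n t) = real (1 + n) powr (- 3/2) * norm (zeta (- zline t) / zline t)"
      unfolding f_def norm_mult by (simp add: powr_def)
    also have "\<dots> \<le> real (1 + n) powr (- 3/2) * (K * (1 + \<bar>t\<bar>) ^ 2)" by (intro mult_left_mono K) simp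
    finally show ?thesis by (simp only: mult_ac)
  qed
  have eq: "(\<Sum>n. f n t) / of_real (cosh (pi * t)) = omega_integrand t" for t
  proof -
    have "(\<lambda>n. f n t) sums (zeta (zline t) * (zeta (- zline t) / zline t))"
      unfolding f_def by (rule sums_mult2[OF zeta_zline_sums])
    thus ?thesis by (simp add: sums_iff omega_integrand_def zline_def)
  qed
  have m: "f n \<in> borel_measurable borel" for n unfolding f_def by measurable
  note S = sech_weighted_sums[OF m fb summable_mult[OF summable_powr_Suc]]
  show "integrable lborel omega_integrand" using S(2) unfolding eq .
  have "(LINT t|lborel. f n t / of_real (cosh (pi * t))) = of_real (2 * stirling_err (Suc n))" for n
    unfolding f_def by (rule integral_zeta_power) simp
  thus "(\<lambda>n. of_real (2 * stirling_err (Suc n))) sums (LINT t|lborel. omega_integrand t)"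
    using S(1) unfolding eq by simp
qed

section \<open>Rows of the double series and the continuation of omega\<close>

lemma summable_on_powr_prod:
  assumes p: "p > 1"
  shows "(\<lambda>(j, k). real j powr (- p) * real k powr (- p)) summable_on ({1..} \<times> {1..})"
proof -
  have "summable (\<lambda>i. norm (real (i + 0) powr (- p)))"
    using summable_powr_shift[of "- p" 0] p by simp
  hence "(\<lambda>k. real k powr (- p)) summable_on UNIV"
    by (intro norm_summable_imp_summable_on) simp
  hence s: "(\<lambda>k. real k powr (- p)) summable_on {1..}" by (rule summable_on_subset) simp
  show ?thesis
  proof (rule summable_on_SigmaI)
    fix j :: nat assume "j \<in> {1..}"
    show "((\<lambda>k. case (j, k) of (j, k) \<Rightarrow> real j powr (- p) * real k powr (- p)) has_sum
        (real j powr (- p) * (\<Sum>\<^sub>\<infinity>k\<in>{1..}. real k powr (- p)))) {1..}"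
      using has_sum_cmult_right[OF has_sum_infsum[OF s]] by simp
  next
    show "(\<lambda>j. real j powr (- p) * (\<Sum>\<^sub>\<infinity>k\<in>{1..}. real k powr (- p))) summable_on {1..}"
      by (rule summable_on_cmult_left[OF s])
  qed auto
qed

lemma of_nat_prod_powr:
  assumes "j \<ge> 1" "k \<ge> 1"
  shows "omega_term s (j, k) = of_real (real j) powr (- s) * pw_deriv 0 s s (of_real (real j)) (of_real (real k))"
proof -
  have pos: "real j > 0" "real k > 0" "real k + real j > 0" "real j * real k * (real j + real k) > 0"
    using assms by auto
  have "ln (real j * real k * (real j + real k)) = ln (real j) + ln (real k) + ln (real k + real j)"
    using pos by (subst ln_mult; (subst ln_mult)?; simp add: add_ac)
  hence "complex_of_real (real j * real k * (real j + real k)) powr (- s) =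
      of_real (real j) powr (- s) * (of_real (real k) powr (- s) * of_real (real k + real j) powr (- s))"
    unfolding of_real_powr_exp[OF pos(1)] of_real_powr_exp[OF pos(2)] of_real_powr_exp[OF pos(3)] of_real_powr_exp[OF pos(4)]
    by (simp add: algebra_simps flip: exp_add)
  thus ?thesis unfolding omega_term_def by simp
qed

text \<open>Since (j k)^(1/2) <= j + k, the term is at most (j k)^(-3 Re s / 2), a product of two
  convergent series.\<close>

lemma omega_term_summable:
  assumes "Re s > 2 / 3"
  shows "(\<lambda>x. norm (omega_term s x)) summable_on ({1..} \<times> {1..})"
proof (rule summable_on_comparison_test)
  let ?p = "3 / 2 * Re s"
  show "(\<lambda>(j, k). real j powr (- ?p) * real k powr (- ?p)) summable_on ({1..} \<times> {1..})"
    by (rule summable_on_powr_prod) (use assms in auto)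
  fix x :: "nat \<times> nat" assume "x \<in> {1..} \<times> {1..}"
  then obtain j k where x: "x = (j, k)" "j \<ge> 1" "k \<ge> 1" by auto
  define a where "a = real j * real k"
  have a: "a > 0" using x by (simp add: a_def)
  have "a powr (1/2) \<le> real j + real k"
  proof -
    have "a \<le> (real j + real k) ^ 2" by (simp add: a_def power2_eq_square algebra_simps)
    hence "sqrt a \<le> real j + real k" by (intro real_le_lsqrt) auto
    thus ?thesis using a by (simp add: powr_half_sqrt)
  qed
  hence "a * a powr (1/2) \<le> a * (real j + real k)" using a by (intro mult_left_mono) auto
  moreover have "a * a powr (1/2) = a powr (3/2)" using a powr_add[of a 1 "1/2"] by simp
  ultimately have "(a * (real j + real k)) powr (- Re s) \<le> (a powr (3/2)) powr (- Re s)"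
    using a assms by (intro powr_mono2') auto
  also have "\<dots> = a powr (- ?p)" by (simp add: powr_powr)
  also have "\<dots> = real j powr (- ?p) * real k powr (- ?p)" unfolding a_def using x by (simp add: powr_mult)
  finally have "(a * (real j + real k)) powr (- Re s) \<le> real j powr (- ?p) * real k powr (- ?p)" .
  moreover have "norm (omega_term s x) = (a * (real j + real k)) powr (- Re s)"
    using x norm_powr_real_powr[of "of_nat (j * k * (j + k))" "- s"] unfolding omega_term_def a_def by simp
  ultimately show "norm (omega_term s x) \<le> (case x of (j, k) \<Rightarrow> real j powr (- ?p) * real k powr (- ?p))"
    using x by simp
qed auto

lemma has_sum_Suc_imp_sums:
  fixes f :: "nat \<Rightarrow> 'a :: {topological_comm_monoid_add, t2_space}"
  assumes "(f has_sum S) {1..}"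
  shows "(\<lambda>n. f (Suc n)) sums S"
proof -
  have "((\<lambda>n. f (Suc n)) has_sum S) UNIV"
    using assms by (subst has_sum_reindex_bij_witness[where i = "\<lambda>n. n - 1" and j = Suc and T = "{1..}" and h = f]) auto
  thus ?thesis by (rule has_sum_imp_sums)
qed

text \<open>Restricting to j <= k keeps c = j below y >= j, the regime of
  \<open>norm_pw_deriv_le\<close>.\<close>

definition tri :: "(nat \<times> nat) set" where "tri = Sigma {1..} (\<lambda>j. {j..})"

definition em_lattice_sum :: "complex \<Rightarrow> nat \<Rightarrow> complex" where
  "em_lattice_sum s j = (\<Sum>i. pw_deriv 0 s s (of_real (real j)) (of_real (real (j + i))))
      - pw_deriv 0 s s (of_real (real j)) (of_real (real j)) / 2"

text \<open>By symmetry the series is twice the sum over \<open>tri\<close> minus the diagonal. This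
  gives the diagonal half weight, which is the half first term of Euler-Maclaurin.\<close>

lemma omega_series_sums:
  assumes s: "Re s > 2 / 3"
  shows "(\<lambda>n. 2 * (of_real (real (Suc n)) powr (- s) * em_lattice_sum s (Suc n))) sums omega_series s"
proof -
  let ?t = "omega_term s"
  define D where "D = {(j, k). 1 \<le> j \<and> j < (k::nat)}"
  define D' where "D' = {(j, k). 1 \<le> k \<and> k < (j::nat)}"
  define E where "E = {(j, k). 1 \<le> j \<and> j = (k::nat)}"
  have all: "{1..} \<times> {1..} = (D \<union> E) \<union> D'" by (auto simp: D_def D'_def E_def)
  have tri: "tri = D \<union> E" by (auto simp: D_def E_def tri_def)
  have summ: "?t summable_on ({1..} \<times> {1..})" using abs_summable_summable[OF omega_term_summable[OF s]] .
  have sD: "?t summable_on D" "?t summable_on E" and sD': "?t summable_on D'" and sDE: "?t summable_on (D \<union> E)"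
    using summable_on_subset[OF summ[unfolded all]] by blast+
  have "omega_series s = infsum ?t (D \<union> E) + infsum ?t D'"
    unfolding omega_series_def all using sD' sDE by (intro infsum_Un_disjoint) (auto simp: D_def D'_def E_def)
  also have "infsum ?t D' = infsum ?t D"
    by (rule infsum_reindex_bij_witness[where i = prod.swap and j = prod.swap])
       (auto simp: D_def D'_def omega_term_def mult_ac add_ac)
  also have "infsum ?t D = infsum ?t (D \<union> E) - infsum ?t E"
  proof -
    have "D \<inter> E = {}" by (auto simp: D_def E_def)
    from infsum_Un_disjoint[OF sD this] show ?thesis by simp
  qed
  finally have om: "omega_series s = 2 * infsum ?t tri - infsum ?t E" by (simp add: tri)
  have f: "((\<lambda>k. ?t (j, k)) has_sum (of_real (real j) powr (- s) * (\<Sum>i. pw_deriv 0 s s (of_real (real j)) (of_real (real (j + i)))))) {j..}"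
    if j: "j \<in> {1..}" for j
  proof -
    have "summable (\<lambda>i. norm (pw_deriv 0 s s (of_real (real j)) (of_real (real (j + i)))))"
      using pw_deriv_0_summable[of j "real j" s s] j s by simp
    from norm_summable_imp_has_sum[OF this summable_sums[OF summable_norm_cancel[OF this]]]
    have "((\<lambda>i. of_real (real j) powr (- s) * pw_deriv 0 s s (of_real (real j)) (of_real (real (j + i)))) has_sum
       (of_real (real j) powr (- s) * (\<Sum>i. pw_deriv 0 s s (of_real (real j)) (of_real (real (j + i)))))) UNIV"
      by (rule has_sum_cmult_right)
    also have "?this = ?thesis"
      by (rule has_sum_reindex_bij_witness[where i = "\<lambda>k. k - j" and j = "\<lambda>i. j + i"])
         (use j in \<open>auto simp: of_nat_prod_powr simp del: pw_deriv.simps of_nat_add\<close>)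
    finally show ?thesis .
  qed
  have "(?t has_sum infsum ?t tri) (Sigma {1..} (\<lambda>j. {j..}))"
    using has_sum_infsum[OF sDE] unfolding tri [symmetric] tri_def .
  hence A: "((\<lambda>j. of_real (real j) powr (- s) * (\<Sum>i. pw_deriv 0 s s (of_real (real j)) (of_real (real (j + i))))) has_sum infsum ?t tri) {1..}"
    by (rule has_sum_SigmaD) (use f in auto)
  have "(?t has_sum infsum ?t E) E" by (rule has_sum_infsum[OF sD(2)])
  also have "?this = ((\<lambda>j. of_real (real j) powr (- s) * pw_deriv 0 s s (of_real (real j)) (of_real (real j))) has_sum infsum ?t E) {1..}"
    by (rule has_sum_reindex_bij_witness[where i = "\<lambda>j. (j, j)" and j = fst])
       (auto simp: E_def of_nat_prod_powr simp del: pw_deriv.simps)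
  finally have B: "((\<lambda>j. of_real (real j) powr (- s) * pw_deriv 0 s s (of_real (real j)) (of_real (real j))) has_sum infsum ?t E) {1..}" .
  from sums_diff[OF sums_mult[OF has_sum_Suc_imp_sums[OF A], of 2] has_sum_Suc_imp_sums[OF B]]
  show ?thesis unfolding om em_lattice_sum_def by (simp add: algebra_simps del: pw_deriv.simps)
qed

definition em_lattice_rem :: "nat \<Rightarrow> complex \<Rightarrow> complex" where
  "em_lattice_rem q s = (\<Sum>\<^sub>\<infinity>(j, k)\<in>tri. of_real (real j) powr (- s) * pw_rem q s s (real j) (real k))"

text \<open>For j <= k a term is at most a constant times k^eps k^(2 eps - q). The total exponent is
  -2 p, and half of the decay is passed from k to j to obtain the summable product j^(-p)
  k^(-p).\<close>

lemma em_lattice_rem_bound: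
  fixes \<epsilon> N :: real
  assumes \<epsilon>: "\<epsilon> \<ge> 0" "real q > 3 * \<epsilon> + 2" and N: "N \<ge> 0"
  obtains M where "M summable_on tri"
    "\<And>s j k. norm s \<le> N \<Longrightarrow> Re s \<ge> - \<epsilon> \<Longrightarrow> (j, k) \<in> tri \<Longrightarrow>
       norm (of_real (real j) powr (- s) * pw_rem q s s (real j) (real k)) \<le> M (j, k)"
proof -
  obtain B where B: "\<And>t. t \<in> {0..1} \<Longrightarrow> \<bar>poly (em_kernel q) t\<bar> \<le> B" using em_kernel_bounded by blast
  have B0: "B \<ge> 0" using B[of 0] by simp
  define C where "C = B * pw_const q N"
  have C: "C \<ge> 0" unfolding C_def using B0 N by (simp add: pw_const_nonneg)
  define p where "p = (real q - 3 * \<epsilon>) / 2"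
  have p: "p > 1" using \<epsilon> by (simp add: p_def)
  define M where "M = (\<lambda>x. C * (case x of (j, k) \<Rightarrow> real j powr (- p) * real k powr (- p)))"
  have "(\<lambda>(j, k). real j powr (- p) * real k powr (- p)) summable_on tri"
    by (rule summable_on_subset[OF summable_on_powr_prod[OF p]]) (auto simp: tri_def)
  hence sM: "M summable_on tri" unfolding M_def by (rule summable_on_cmult_right)
  have "norm (of_real (real j) powr (- s) * pw_rem q s s (real j) (real k)) \<le> M (j, k)"
    if s: "norm s \<le> N" "Re s \<ge> - \<epsilon>" and jk: "(j, k) \<in> tri" for s j k
  proof -
    have jk': "1 \<le> j" "j \<le> k" using jk by (auto simp: tri_def)
    have q: "2 * Re s + real q \<ge> 0" using s \<epsilon> by linarith
    have 1: "norm (pw_rem q s s (real j) (real k)) \<le> C * real k powr (- (Re s + Re s) - real q)"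
      unfolding C_def by (rule norm_pw_rem_le) (use jk' s q B in auto)
    have 2: "norm (complex_of_real (real j) powr (- s)) = real j powr (- Re s)"
      using jk' by (simp add: norm_powr_real_powr)
    have 3: "real j powr (- Re s) \<le> real k powr \<epsilon>"
    proof -
      have "real j powr (- Re s) \<le> real j powr \<epsilon>" using jk' s by (intro powr_mono) auto
      also have "\<dots> \<le> real k powr \<epsilon>" using jk' \<epsilon> by (intro powr_mono2) auto
      finally show ?thesis .
    qed
    have 4: "real k powr (- (Re s + Re s) - real q) \<le> real k powr (2 * \<epsilon> - real q)"
      using jk' s by (intro powr_mono) auto
    have "norm (of_real (real j) powr (- s) * pw_rem q s s (real j) (real k))
        \<le> real k powr \<epsilon> * (C * real k powr (2 * \<epsilon> - real q))"
      unfolding norm_mult 2 using 1 3 4 C by (intro mult_mono order_trans[OF 1] mult_left_mono) auto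
    also have "\<dots> = C * (real k powr (- p) * real k powr (- p))"
    proof -
      have "real k powr \<epsilon> * real k powr (2 * \<epsilon> - real q) = real k powr (- p) * real k powr (- p)"
        unfolding powr_add [symmetric] by (simp add: p_def)
      thus ?thesis by (simp add: mult_ac)
    qed
    also have "\<dots> \<le> C * (real j powr (- p) * real k powr (- p))"
      using jk' p C by (intro mult_left_mono mult_right_mono powr_mono2') auto
    finally show ?thesis by (simp add: M_def)
  qed
  with sM show ?thesis by (rule that)
qed

lemma em_lattice_rem_holomorphic:
  fixes \<epsilon> :: real
  assumes \<epsilon>: "\<epsilon> \<ge> 0" "real q > 3 * \<epsilon> + 2"
  shows "em_lattice_rem q holomorphic_on {s. Re s > - \<epsilon>}"
    and "Re s > - \<epsilon> \<Longrightarrow> ((\<lambda>x. deriv (\<lambda>s. case x of (j, k) \<Rightarrow> of_real (real j) powr (- s) * pw_rem q s s (real j) (real k)) s)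
      has_sum deriv (em_lattice_rem q) s) tri"
proof -
  let ?f = "\<lambda>x s. case x of (j, k) \<Rightarrow> complex_of_real (real j) powr (- s) * pw_rem q s s (real j) (real k)"
  have eq: "em_lattice_rem q = (\<lambda>s. \<Sum>\<^sub>\<infinity>x\<in>tri. ?f x s)"
    unfolding em_lattice_rem_def by (simp add: case_prod_unfold)
  have hol: "?f x holomorphic_on {s. Re s > - \<epsilon>}" if "x \<in> tri" for x
  proof -
    obtain j k where x: "x = (j, k)" "1 \<le> j" "j \<le> k" using \<open>x \<in> tri\<close> by (auto simp: tri_def)
    have "(\<lambda>s. pw_rem q s (1 * s) (real j) (real k)) holomorphic_on {s. Re s > - \<epsilon>}"
      by (rule pw_rem_holomorphic) (use x in auto)
    thus ?thesis unfolding x using x by (auto intro!: holomorphic_intros simp: powr_def)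
  qed
  have bound: "\<exists>r>0. \<exists>M. cball z r \<subseteq> {s. Re s > - \<epsilon>} \<and> M summable_on tri \<and> (\<forall>x\<in>tri. \<forall>w\<in>cball z r. norm (?f x w) \<le> M x)"
    if z: "z \<in> {s. Re s > - \<epsilon>}" for z
  proof -
    obtain r where r: "r > 0" "cball z r \<subseteq> {s. Re s > - \<epsilon>}"
      using z open_halfspace_Re_gt[of "- \<epsilon>"] by (meson open_contains_cball)
    obtain M where M: "M summable_on tri" "\<And>s j k. norm s \<le> norm z + r \<Longrightarrow> Re s \<ge> - \<epsilon> \<Longrightarrow> (j, k) \<in> tri \<Longrightarrow>
       norm (of_real (real j) powr (- s) * pw_rem q s s (real j) (real k)) \<le> M (j, k)"
      by (rule em_lattice_rem_bound[OF \<epsilon>, of "norm z + r"]) (use r that in auto)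
    have "norm (?f x w) \<le> M x" if x: "x \<in> tri" and w: "w \<in> cball z r" for x w
    proof -
      have "norm w \<le> norm z + r" using w norm_triangle_ineq2[of w z] by (simp add: dist_norm norm_minus_commute)
      moreover have "Re w \<ge> - \<epsilon>" using r w by force
      ultimately show ?thesis using M(2)[of w "fst x" "snd x"] x by (simp add: case_prod_unfold)
    qed
    thus ?thesis using r M(1) by blast
  qed
  note H = holomorphic_infsum[OF open_halfspace_Re_gt hol bound]
  show "em_lattice_rem q holomorphic_on {s. Re s > - \<epsilon>}" unfolding eq by (rule H(1))
  show "((\<lambda>x. deriv (?f x) s) has_sum deriv (em_lattice_rem q) s) tri" if "Re s > - \<epsilon>"
    unfolding eq by (rule H(2)) (use that in auto)
qed

text \<open>Homogeneity in (c, w): it separates the dependence on the row j as a pure power, which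
  the sum over j turns into a zeta value.\<close>

lemma pw_deriv_scale:
  assumes j: "j > 0" and y: "y > 0"
  shows "pw_deriv r a b (of_real j) (of_real j * of_real y) = of_real j powr (- (a + b) - of_nat r) * pw_deriv r a b 1 (of_real y)"
proof (induction r arbitrary: a b)
  case 0
  have p: "y + 1 > 0" "j * y > 0" "j * (y + 1) > 0" using y j by (auto intro!: mult_pos_pos)
  have e: "of_real j * of_real y = complex_of_real (j * y)" "complex_of_real (j * y) + of_real j = of_real (j * (y + 1))"
    "complex_of_real y + 1 = of_real (y + 1)" by (simp_all add: algebra_simps)
  have l: "ln (j * y) = ln j + ln y" "ln (j * (y + 1)) = ln j + ln (y + 1)" using j y p by (simp_all add: ln_mult)
  show ?case unfolding pw_deriv.simps e of_real_powr_exp[OF p(1)] of_real_powr_exp[OF p(2)] of_real_powr_exp[OF p(3)]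
      of_real_powr_exp[OF j] of_real_powr_exp[OF y] l
    by (simp add: algebra_simps flip: exp_add)
next
  case (Suc r)
  have e: "- (a + 1 + b) - of_nat r = - (a + b) - of_nat (Suc r)" "- (a + (b + 1)) - of_nat r = - (a + b) - of_nat (Suc r)"
    by (simp_all add: algebra_simps)
  show ?case unfolding pw_deriv.simps(2) Suc.IH e by (simp add: algebra_simps)
qed

lemma pw_rem_0_eq_integral:
  "pw_rem 0 a b c k = integral {k..k+1} (\<lambda>y. pw_deriv 0 a b (of_real c) (of_real y))"
proof -
  have "integral {k..k+1} (\<lambda>y. pw_deriv 0 a b (of_real c) (of_real y)) = integral {0..1} (\<lambda>t. pw_deriv 0 a b (of_real c) (of_real (t + k)))"
    using integral_shift_real_ivl[of k k "k+1" "\<lambda>y. pw_deriv 0 a b (of_real c) (of_real y)"]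
    by (simp del: pw_deriv.simps of_real_add)
  thus ?thesis by (simp add: pw_rem_def em_rem_def add.commute del: pw_deriv.simps of_real_add)
qed

lemma sum_pw_rem_0:
  assumes "m > 0" "c \<ge> 0"
  shows "(\<Sum>i<n. pw_rem 0 a b c (m + real i)) = integral {m..m + real n} (\<lambda>y. pw_deriv 0 a b (of_real c) (of_real y))"
proof (induction n)
  case (Suc n)
  have "(\<lambda>y. pw_deriv 0 a b (of_real c) (of_real y)) integrable_on {m..m + real (Suc n)}"
    using assms by (intro integrable_continuous_real continuous_on_pw_deriv) auto
  from Henstock_Kurzweil_Integration.integral_combine[OF _ _ this, of "m + real n"] show ?case
    using Suc.IH unfolding sum.lessThan_Suc pw_rem_0_eq_integral by (simp add: add_ac del: pw_deriv.simps)
qed simp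

text \<open>The integral of (y (y + 1))^(-s) over [1, infinity), an incomplete beta integral; as a
  sum over unit cells it inherits holomorphy from \<open>pw_rem_infsum\<close>.\<close>

definition beta_int :: "complex \<Rightarrow> complex" where
  "beta_int s = (\<Sum>\<^sub>\<infinity>i. pw_rem 0 s s 1 (real (1 + i)))"

lemma beta_int_holomorphic: "beta_int holomorphic_on {s. Re s > 1 / 2}"
proof -
  have "(\<lambda>s. \<Sum>\<^sub>\<infinity>i. pw_rem 0 s (of_real 1 * s) 1 (real (1 + i))) holomorphic_on {s. Re s > 1 / 2}"
    by (rule holomorphic_on_subset[OF pw_rem_infsum(1)]) auto
  thus ?thesis unfolding beta_int_def[abs_def] by simp
qed

lemma beta_int_sums:
  assumes "Re s > 1 / 2"
  shows "(\<lambda>i. pw_rem 0 s s 1 (real (1 + i))) sums beta_int s"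
proof -
  have "summable (\<lambda>i. norm (pw_rem 0 s s 1 (real (1 + i))))"
    using pw_rem_summable[of 1 1 s s 0] assms by simp
  moreover have "beta_int s = (\<Sum>i. pw_rem 0 s s 1 (real (1 + i)))"
    using pw_rem_infsum(3)[of 1 1 s 0] assms unfolding beta_int_def by simp
  ultimately show ?thesis by (simp only: summable_sums[OF summable_norm_cancel])
qed

text \<open>Substitution y = j x in the integral of (y (y + j))^(-s) over [j, infinity).\<close>

lemma pw_rem_0_scaled_suminf:
  assumes j: "j \<ge> 1" and s: "Re s > 1 / 2"
  shows "(\<Sum>i. pw_rem 0 s s (real j) (real (j + i))) = of_real (real j) powr (1 - 2 * s) * beta_int s"
proof -
  have J: "real j > 0" using j by simp
  let ?S = "\<Sum>i. pw_rem 0 s s (real j) (real (j + i))"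
  have "summable (\<lambda>i. norm (pw_rem 0 s s (real j) (real (j + i))))"
    using pw_rem_summable[of j "real j" s s 0] j s by simp
  hence "(\<lambda>n. \<Sum>i<n. pw_rem 0 s s (real j) (real (j + i))) \<longlonglongrightarrow> ?S"
    by (rule summable_LIMSEQ[OF summable_norm_cancel])
  hence "(\<lambda>n. integral {real j..real j + real n} (\<lambda>y. pw_deriv 0 s s (of_real (real j)) (of_real y))) \<longlonglongrightarrow> ?S"
    using sum_pw_rem_0[of "real j" "real j" s s] j by (simp del: pw_deriv.simps)
  \<comment> \<open>Along multiples of j the substitution maps [j, j + j n] onto [1, 1 + n], a whole
    number of unit cells.\<close>
  moreover have "filterlim (\<lambda>n. j * n) sequentially sequentially"
    using j by (simp add: filterlim_subseq strict_mono_def)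
  ultimately have l1: "(\<lambda>n. integral {real j..real j + real (j * n)} (\<lambda>y. pw_deriv 0 s s (of_real (real j)) (of_real y))) \<longlonglongrightarrow> ?S"
    by (rule filterlim_compose)
  have eq: "integral {real j..real j + real (j * n)} (\<lambda>y. pw_deriv 0 s s (of_real (real j)) (of_real y)) =
      of_real (real j) powr (1 - 2 * s) * (\<Sum>i<n. pw_rem 0 s s 1 (real (1 + i)))" for n
  proof -
    let ?f = "\<lambda>y. pw_deriv 0 s s (of_real (real j)) (of_real y)"
    define I where "I = integral {real j..real j + real (j * n)} ?f"
    have "?f integrable_on {real j..real j + real (j * n)}"
      using J by (intro integrable_continuous_real continuous_on_pw_deriv) auto
    hence "(?f has_integral I) (cbox (real j) (real j + real (j * n)))"
      unfolding I_def by (simp add: integrable_integral del: pw_deriv.simps)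
    from has_integral_affinity'[OF this J, of 0]
    have "((\<lambda>x. ?f (real j * x)) has_integral (I /\<^sub>R real j)) (cbox ((real j - 0) /\<^sub>R real j) ((real j + real (j * n) - 0) /\<^sub>R real j))"
      by (simp del: pw_deriv.simps of_real_mult)
    moreover have "(real j - 0) /\<^sub>R real j = 1" "(real j + real (j * n) - 0) /\<^sub>R real j = 1 + real n"
      using J by (simp_all add: field_simps)
    ultimately have "((\<lambda>x. ?f (real j * x)) has_integral (I /\<^sub>R real j)) {1..1 + real n}"
      by (simp only: cbox_interval)
    hence "integral {1..1 + real n} (\<lambda>x. ?f (real j * x)) = I /\<^sub>R real j" by (rule integral_unique)
    also have "integral {1..1 + real n} (\<lambda>x. ?f (real j * x)) =
       integral {1..1 + real n} (\<lambda>x. of_real (real j) powr (- 2 * s) * pw_deriv 0 s s 1 (of_real x))"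
    proof (rule integral_cong)
      fix x assume "x \<in> {1..1 + real n}"
      hence "x > 0" by simp
      from pw_deriv_scale[OF J this, of 0 s s] show "?f (real j * x) = of_real (real j) powr (- 2 * s) * pw_deriv 0 s s 1 (of_real x)"
        by (simp del: pw_deriv.simps)
    qed
    also have "\<dots> = of_real (real j) powr (- 2 * s) * integral {1..1 + real n} (\<lambda>x. pw_deriv 0 s s 1 (of_real x))"
      by (rule integral_mult_right)
    also have "integral {1..1 + real n} (\<lambda>x. pw_deriv 0 s s 1 (of_real x)) = (\<Sum>i<n. pw_rem 0 s s 1 (real (1 + i)))"
      using sum_pw_rem_0[of 1 1 s s n] by (simp del: pw_deriv.simps)
    finally have "I = of_real (real j) * (of_real (real j) powr (- 2 * s) * (\<Sum>i<n. pw_rem 0 s s 1 (real (1 + i))))"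
      using J by (simp add: scaleR_conv_of_real field_simps)
    moreover have "of_real (real j) * complex_of_real (real j) powr (- 2 * s) = of_real (real j) powr (1 - 2 * s)"
      unfolding of_real_powr_exp[OF J] using J exp_of_real_ln[of "real j"]
      by (simp add: left_diff_distrib exp_diff exp_minus field_simps)
    ultimately show ?thesis unfolding I_def by (simp only: mult.assoc [symmetric])
  qed
  have "(\<lambda>n. of_real (real j) powr (1 - 2 * s) * (\<Sum>i<n. pw_rem 0 s s 1 (real (1 + i)))) \<longlonglongrightarrow> of_real (real j) powr (1 - 2 * s) * beta_int s"
    using beta_int_sums[OF s] by (intro tendsto_mult_left) (simp add: sums_def)
  from LIMSEQ_unique[OF l1[unfolded eq] this] show ?thesis .
qed

text \<open>Integrate the derivative of D(y) = (2 y + 1) (y (y + 1))^(-s), using (2 y + 1)^2 = 4 y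
  (y + 1) + 1. The boundary value D(1) = 3 * 2^(-s) is the inhomogeneous term. The recursion
  continues \<open>beta_int\<close> to the left one unit at a time.\<close>

lemma beta_int_rec:
  assumes s: "Re s > 1 / 2"
  shows "(4 * s - 2) * beta_int s = 3 * 2 powr (- s) - s * beta_int (s + 1)"
proof -
  define D where "D y = (2 * of_real y + 1) * pw_deriv 0 s s 1 (of_real y)" for y :: real
  have der: "(D has_vector_derivative ((2 - 4 * s) * pw_deriv 0 s s 1 (of_real y) - s * pw_deriv 0 (s + 1) (s + 1) 1 (of_real y))) (at y)"
    if y: "y > 0" for y
  proof -
    have w: "complex_of_real y \<notin> \<real>\<^sub>\<le>\<^sub>0" "complex_of_real y + 1 \<notin> \<real>\<^sub>\<le>\<^sub>0"
      using y by (auto simp: complex_nonpos_Reals_iff)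
    have "((\<lambda>w. (2 * w + 1) * pw_deriv 0 s s 1 w) has_field_derivative
        (2 * pw_deriv 0 s s 1 (of_real y) + (2 * of_real y + 1) * pw_deriv 1 s s 1 (of_real y))) (at (of_real y))"
      using pw_deriv_has_field_derivative[OF w, of 0 s s]
      by (auto intro!: derivative_eq_intros simp: algebra_simps simp del: pw_deriv.simps)
    also have "2 * pw_deriv 0 s s 1 (of_real y) + (2 * of_real y + 1) * pw_deriv 1 s s 1 (of_real y) =
        (2 - 4 * s) * pw_deriv 0 s s 1 (of_real y) - s * pw_deriv 0 (s + 1) (s + 1) 1 (of_real y)"
    proof -
      define P where "P = pw_deriv 0 (s + 1) (s + 1) 1 (of_real y)"
      define Y where "Y = complex_of_real y"
      have nz: "Y \<noteq> 0" "Y + 1 \<noteq> 0" using w by (auto simp: Y_def)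
      have e: "- s = - (s + 1) + 1" by simp
      have p: "Y powr (- s) = Y powr (- (s + 1)) * Y" "(Y + 1) powr (- s) = (Y + 1) powr (- (s + 1)) * (Y + 1)"
        using nz by (simp_all only: e powr_add[of _ "- (s + 1)" 1]) (simp_all add: powr_to_1)
      have 1: "pw_deriv 0 s s 1 Y = P * (Y * (Y + 1))" "pw_deriv 0 (s + 1) s 1 Y = P * (Y + 1)" "pw_deriv 0 s (s + 1) 1 Y = P * Y"
        unfolding P_def pw_deriv.simps Y_def [symmetric] p by (simp_all add: mult_ac)
      have 2: "pw_deriv 1 s s 1 Y = - s * (P * (Y + 1)) - s * (P * Y)"
        unfolding One_nat_def pw_deriv.simps(2) 1 ..
      show ?thesis unfolding Y_def [symmetric] P_def [symmetric, folded Y_def] 1 2 by (simp add: algebra_simps)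
    qed
    finally show ?thesis unfolding D_def by (rule has_vector_derivative_real_field)
  qed
  have cell: "D (real (1 + Suc i)) - D (real (1 + i)) = (2 - 4 * s) * pw_rem 0 s s 1 (real (1 + i)) - s * pw_rem 0 (s + 1) (s + 1) 1 (real (1 + i))" for i
  proof -
    define k where "k = real (1 + i)"
    have k: "k > 0" by (simp add: k_def)
    have int: "(\<lambda>y. pw_deriv 0 a a 1 (of_real y)) integrable_on {k..k+1}" for a
      using k continuous_on_pw_deriv[of "{k..k+1}" "\<lambda>y. y" 1 0 a a]
      by (intro integrable_continuous_real) auto
    have "((\<lambda>y. (2 - 4 * s) * pw_deriv 0 s s 1 (of_real y) - s * pw_deriv 0 (s + 1) (s + 1) 1 (of_real y)) has_integral (D (k + 1) - D k)) {k..k+1}"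
      by (intro fundamental_theorem_of_calculus has_vector_derivative_at_within[OF der]) (use k in auto)
    moreover have "((\<lambda>y. (2 - 4 * s) * pw_deriv 0 s s 1 (of_real y) - s * pw_deriv 0 (s + 1) (s + 1) 1 (of_real y)) has_integral
        ((2 - 4 * s) * pw_rem 0 s s 1 k - s * pw_rem 0 (s + 1) (s + 1) 1 k)) {k..k+1}"
      unfolding pw_rem_0_eq_integral using int[of s] int[of "s + 1"]
      by (intro has_integral_diff has_integral_mult_right) (auto simp: integrable_integral simp del: pw_deriv.simps)
    ultimately have "D (k + 1) - D k = (2 - 4 * s) * pw_rem 0 s s 1 k - s * pw_rem 0 (s + 1) (s + 1) 1 k"
      by (rule has_integral_unique)
    thus ?thesis by (simp add: k_def add_ac)
  qed
  have "(\<lambda>i. D (real (1 + i))) \<longlonglongrightarrow> 0"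
  proof (rule Lim_null_comparison)
    let ?C = "pw_const 0 (norm s)"
    show "\<forall>\<^sub>F i in sequentially. norm (D (real (1 + i))) \<le> 3 * ?C * real (1 + i) powr (1 - 2 * Re s)"
    proof (intro always_eventually allI)
      fix i
      define k where "k = real (1 + i)"
      have k: "k \<ge> 1" by (simp add: k_def)
      have "norm (D k) = (2 * k + 1) * norm (pw_deriv 0 s s (of_real 1) (of_real k))"
      proof -
        have "2 * complex_of_real k + 1 = of_real (2 * k + 1)" by simp
        hence "norm (2 * complex_of_real k + 1) = 2 * k + 1" using k by (simp only: norm_of_real)
        thus ?thesis by (simp add: D_def norm_mult)
      qed
      also have "\<dots> \<le> (3 * k) * (?C * k powr (- (Re s + Re s) - real 0))"
        using k by (intro mult_mono norm_pw_deriv_le) auto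
      also have "\<dots> = 3 * ?C * k powr (1 - 2 * Re s)"
        using k powr_add[of k 1 "- 2 * Re s"] by (simp add: algebra_simps)
      finally show "norm (D (real (1 + i))) \<le> 3 * ?C * real (1 + i) powr (1 - 2 * Re s)" unfolding k_def .
    qed
    have "filterlim (\<lambda>i. real (1 + i)) at_top sequentially" by real_asymp
    hence "(\<lambda>i. real (1 + i) powr (1 - 2 * Re s)) \<longlonglongrightarrow> 0" using s by (intro tendsto_neg_powr) auto
    thus "(\<lambda>i. 3 * ?C * real (1 + i) powr (1 - 2 * Re s)) \<longlonglongrightarrow> 0" by (rule tendsto_mult_right_zero)
  qed
  hence "(\<lambda>i. D (real (1 + Suc i)) - D (real (1 + i))) sums (0 - D (real (1 + 0)))"
    by (rule telescope_sums)
  moreover have "(\<lambda>i. D (real (1 + Suc i)) - D (real (1 + i))) sums ((2 - 4 * s) * beta_int s - s * beta_int (s + 1))"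
    unfolding cell using s by (intro sums_diff sums_mult beta_int_sums) auto
  ultimately have "0 - D (real (1 + 0)) = (2 - 4 * s) * beta_int s - s * beta_int (s + 1)"
    by (rule sums_unique2)
  moreover have "D (real (1 + 0)) = 3 * 2 powr (- s)" by (simp add: D_def)
  ultimately show ?thesis by (simp add: algebra_simps)
qed

lemma beta_int_1: "beta_int 1 = of_real (ln 2)"
proof -
  define F where "F x = ln x - ln (x + 1)" for x :: real
  have cell: "pw_rem 0 1 1 1 k = of_real (F (k + 1) - F k)" if k: "k > 0" for k
  proof -
    have "((\<lambda>y. 1 / (y * (y + 1))) has_integral (F (k + 1) - F k)) {k..k+1}"
    proof (rule fundamental_theorem_of_calculus)
      fix y assume "y \<in> {k..k+1}"
      hence y: "y > 0" using k by simp
      have "(F has_real_derivative (1 / y - 1 / (y + 1))) (at y)"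
        unfolding F_def using y by (auto intro!: derivative_eq_intros)
      also have "1 / y - 1 / (y + 1) = 1 / (y * (y + 1))" using y by (simp add: field_simps)
      finally show "(F has_vector_derivative 1 / (y * (y + 1))) (at y within {k..k+1})"
        by (simp add: has_real_derivative_iff_has_vector_derivative has_vector_derivative_at_within)
    qed simp
    hence "((\<lambda>y. complex_of_real (1 / (y * (y + 1)))) has_integral of_real (F (k + 1) - F k)) {k..k+1}"
      by (rule has_integral_of_real)
    moreover have "integral {k..k+1} (\<lambda>y. pw_deriv 0 1 1 (of_real 1) (of_real y)) = integral {k..k+1} (\<lambda>y. complex_of_real (1 / (y * (y + 1))))"
    proof (rule integral_cong)
      fix y assume "y \<in> {k..k+1}"
      hence "y > 0" using k by simp
      hence "complex_of_real y \<noteq> 0" "complex_of_real y + 1 \<noteq> 0"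
        by (auto simp: complex_eq_iff)
      thus "pw_deriv 0 1 1 (of_real 1) (of_real y) = complex_of_real (1 / (y * (y + 1)))"
        by (simp add: powr_minus_divide powr_to_1)
    qed
    ultimately show ?thesis unfolding pw_rem_0_eq_integral by (simp add: integral_unique)
  qed
  have "(\<lambda>i. F (real (1 + i))) \<longlonglongrightarrow> 0" unfolding F_def by real_asymp
  hence "(\<lambda>i. F (real (1 + Suc i)) - F (real (1 + i))) sums (0 - F (real (1 + 0)))" by (rule telescope_sums)
  hence "(\<lambda>i. complex_of_real (F (real (1 + Suc i)) - F (real (1 + i)))) sums of_real (0 - F (real (1 + 0)))" by (rule sums_of_real)
  moreover have "complex_of_real (F (real (1 + Suc i)) - F (real (1 + i))) = pw_rem 0 1 1 1 (real (1 + i))" for i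
    using cell[of "real (1 + i)"] by (simp add: add_ac)
  ultimately have "(\<lambda>i. pw_rem 0 1 1 1 (real (1 + i))) sums of_real (ln 2)" by (simp add: F_def)
  with beta_int_sums[of 1] show ?thesis by (simp add: sums_unique2)
qed

lemma zeta_power_sums:
  assumes "Re s > 1"
  shows "(\<lambda>n. of_real (real (Suc n)) powr (- s)) sums zeta s"
proof -
  have "summable (\<lambda>i. norm (pw_deriv 0 s 0 (of_real 0) (of_real (real (1 + i)))))"
    by (rule pw_deriv_0_summable) (use assms in auto)
  moreover have "pw_deriv 0 s 0 (of_real 0) (of_real (real (1 + i))) = of_real (real (Suc i)) powr (- s)" for i
  proof -
    have "complex_of_real (real (Suc i)) \<noteq> 0" by (simp only: of_real_eq_0_iff of_nat_eq_0_iff)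
    from pw_deriv_0_0[OF this] show ?thesis by (simp only: of_real_0 plus_1_eq_Suc)
  qed
  ultimately have "summable (\<lambda>i. norm (complex_of_real (real (Suc i)) powr (- s)))" by (simp only:)
  hence "summable (\<lambda>n. complex_of_real (real (Suc n)) powr (- s))" by (rule summable_norm_cancel)
  moreover have "zeta s = (\<Sum>n. of_real (real (Suc n)) powr (- s))"
    using zeta_eq_series[OF assms] unfolding zeta_series_def by simp
  ultimately show ?thesis by (simp only: summable_sums)
qed

definition bern_coeff :: "nat \<Rightarrow> complex" where
  "bern_coeff r = (-1) ^ (r - 1) * of_real (poly (em_kernel (Suc r)) 0)"

text \<open>\<open>euler_maclaurin_series\<close> in row j with c = m = j; every piece but the
  remainder is a power of j times a constant, by homogeneity, so the sum over j gives zeta. The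
  condition q >= 2 makes the remainder of order q + 1 > 2 summable over \<open>tri\<close>.\<close>

lemma omega_series_formula:
  assumes s: "Re s > 2 / 3" and q: "q \<ge> 2"
  shows "omega_series s = 2 * (beta_int s * zeta (3 * s - 1)
     - (\<Sum>r=1..q. bern_coeff r * pw_deriv r s s 1 1 * zeta (3 * s + of_nat r))
     + (-1) ^ q * em_lattice_rem (Suc q) s)"
proof -
  let ?p = "\<lambda>n. complex_of_real (real (Suc n)) powr (- s)"
  have t1: "(\<lambda>n. ?p n * (\<Sum>i. pw_rem 0 s s (real (Suc n)) (real (Suc n + i)))) sums (beta_int s * zeta (3 * s - 1))"
  proof -
    have "?p n * (\<Sum>i. pw_rem 0 s s (real (Suc n)) (real (Suc n + i))) = beta_int s * of_real (real (Suc n)) powr (- (3 * s - 1))" for n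
    proof -
      have j: "real (Suc n) > 0" by simp
      have 1: "(\<Sum>i. pw_rem 0 s s (real (Suc n)) (real (Suc n + i))) = of_real (real (Suc n)) powr (1 - 2 * s) * beta_int s"
        by (rule pw_rem_0_scaled_suminf) (use s in auto)
      have 2: "?p n * of_real (real (Suc n)) powr (1 - 2 * s) = of_real (real (Suc n)) powr (- (3 * s - 1))"
        unfolding of_real_powr_exp[OF j] exp_add [symmetric] by (simp add: algebra_simps)
      show ?thesis unfolding 1 mult.assoc [symmetric] 2 by (rule mult.commute)
    qed
    thus ?thesis using sums_mult[OF zeta_power_sums[of "3 * s - 1"]] s by simp
  qed
  have t2: "(\<lambda>n. ?p n * (bern_coeff r * pw_deriv r s s (of_real (real (Suc n))) (of_real (real (Suc n))))) sums
      (bern_coeff r * pw_deriv r s s 1 1 * zeta (3 * s + of_nat r))" for r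
  proof -
    have e: "?p n * (bern_coeff r * pw_deriv r s s (of_real (real (Suc n))) (of_real (real (Suc n)))) =
        bern_coeff r * pw_deriv r s s 1 1 * of_real (real (Suc n)) powr (- (3 * s + of_nat r))" for n
    proof -
      have j: "real (Suc n) > 0" by simp
      have "pw_deriv r s s (of_real (real (Suc n))) (of_real (real (Suc n))) =
          of_real (real (Suc n)) powr (- (s + s) - of_nat r) * pw_deriv r s s 1 1"
        using pw_deriv_scale[OF j, of 1 r s s] by simp
      moreover have "?p n * of_real (real (Suc n)) powr (- (s + s) - of_nat r) = of_real (real (Suc n)) powr (- (3 * s + of_nat r))"
        unfolding of_real_powr_exp[OF j] exp_add [symmetric]
        by (rule arg_cong[where f = exp]) (simp add: algebra_simps)
      ultimately show ?thesis by (simp only: mult_ac)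
    qed
    show ?thesis unfolding e by (intro sums_mult zeta_power_sums) (use s in simp)
  qed
  have t3: "(\<lambda>n. ?p n * (\<Sum>i. pw_rem (Suc q) s s (real (Suc n)) (real (Suc n + i)))) sums em_lattice_rem (Suc q) s"
  proof -
    let ?f = "\<lambda>(j, k). complex_of_real (real j) powr (- s) * pw_rem (Suc q) s s (real j) (real k)"
    obtain M where M: "M summable_on tri" "\<And>w j k. norm w \<le> norm s \<Longrightarrow> Re w \<ge> - 0 \<Longrightarrow> (j, k) \<in> tri \<Longrightarrow>
       norm (of_real (real j) powr (- w) * pw_rem (Suc q) w w (real j) (real k)) \<le> M (j, k)"
      by (rule em_lattice_rem_bound[of 0 "Suc q" "norm s"]) (use q that in auto)
    have "(\<lambda>x. norm (?f x)) summable_on tri"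
      by (rule summable_on_comparison_test[OF M(1)]) (use M(2)[of s] s in auto)
    hence "?f summable_on tri" by (rule abs_summable_summable)
    hence hs: "(?f has_sum em_lattice_rem (Suc q) s) (Sigma {1..} (\<lambda>j. {j..}))"
      unfolding em_lattice_rem_def tri_def by (rule has_sum_infsum)
    have inner: "((\<lambda>k. ?f (j, k)) has_sum (of_real (real j) powr (- s) * (\<Sum>i. pw_rem (Suc q) s s (real j) (real (j + i))))) {j..}"
      if j: "j \<in> {1..}" for j
    proof -
      have "summable (\<lambda>i. norm (pw_rem (Suc q) s s (real j) (real (j + i))))"
        using pw_rem_summable[of j "real j" s s "Suc q"] j s by simp
      from norm_summable_imp_has_sum[OF this summable_sums[OF summable_norm_cancel[OF this]]]
      have "((\<lambda>i. of_real (real j) powr (- s) * pw_rem (Suc q) s s (real j) (real (j + i))) has_sum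
         (of_real (real j) powr (- s) * (\<Sum>i. pw_rem (Suc q) s s (real j) (real (j + i))))) UNIV"
        by (rule has_sum_cmult_right)
      also have "?this = ?thesis"
        by (rule has_sum_reindex_bij_witness[where i = "\<lambda>k. k - j" and j = "\<lambda>i. j + i"]) (use j in auto)
      finally show ?thesis .
    qed
    from has_sum_Suc_imp_sums[OF has_sum_SigmaD[OF hs inner]] show ?thesis by simp
  qed
  have eq: "2 * (?p n * em_lattice_sum s (Suc n)) = 2 * (?p n * (\<Sum>i. pw_rem 0 s s (real (Suc n)) (real (Suc n + i)))
      - (\<Sum>r=1..q. ?p n * (bern_coeff r * pw_deriv r s s (of_real (real (Suc n))) (of_real (real (Suc n)))))
      + (-1) ^ q * (?p n * (\<Sum>i. pw_rem (Suc q) s s (real (Suc n)) (real (Suc n + i)))))" for n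
  proof -
    have "em_lattice_sum s (Suc n) = (\<Sum>i. pw_rem 0 s s (real (Suc n)) (real (Suc n + i)))
      - (\<Sum>r=1..q. bern_coeff r * pw_deriv r s s (of_real (real (Suc n))) (of_real (real (Suc n))))
      + (-1) ^ q * (\<Sum>i. pw_rem (Suc q) s s (real (Suc n)) (real (Suc n + i)))"
      unfolding em_lattice_sum_def bern_coeff_def
      by (rule euler_maclaurin_series) (use s in auto)
    thus ?thesis by (simp only: distrib_left right_diff_distrib sum_distrib_left mult.left_commute[of _ "(-1) ^ q"])
  qed
  have "(\<lambda>n. 2 * (?p n * em_lattice_sum s (Suc n))) sums (2 * (beta_int s * zeta (3 * s - 1)
     - (\<Sum>r=1..q. bern_coeff r * pw_deriv r s s 1 1 * zeta (3 * s + of_nat r))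
     + (-1) ^ q * em_lattice_rem (Suc q) s))"
    unfolding eq by (intro sums_mult sums_add sums_diff sums_sum t1 t2 t3)
  with omega_series_sums[OF s] show ?thesis by (rule sums_unique2)
qed

lemma beta_int_meromorphic:
  "\<exists>B. B meromorphic_on {s. Re s > 1 / 2 - real n} \<and> (\<forall>s. Re s > 1 / 2 \<longrightarrow> B s = beta_int s)"
proof (induction n)
  case 0
  have "beta_int analytic_on {s. Re s > 1 / 2}"
    unfolding analytic_on_open[OF open_halfspace_Re_gt] by (rule beta_int_holomorphic)
  hence "beta_int meromorphic_on {s. Re s > 1 / 2}" by (rule analytic_on_imp_meromorphic_on)
  thus ?case by (intro exI[of _ beta_int]) simp
next
  case (Suc n)
  then obtain B where B: "B meromorphic_on {s. Re s > 1 / 2 - real n}" "\<And>s. Re s > 1 / 2 \<Longrightarrow> B s = beta_int s"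
    by blast
  define B' where "B' s = (3 * 2 powr (- s) - s * B (s + 1)) / (4 * s - 2)" for s
  have 1: "(\<lambda>s. B (s + 1)) meromorphic_on {s. Re s > 1 / 2 - real (Suc n)}"
    by (rule meromorphic_on_compose[OF B(1)]) (auto intro!: analytic_intros)
  have "(\<lambda>s. 2 powr (- s) :: complex) analytic_on {s. Re s > 1 / 2 - real (Suc n)}"
    by (auto intro!: analytic_intros)
  hence "B' meromorphic_on {s. Re s > 1 / 2 - real (Suc n)}"
    unfolding B'_def[abs_def] by (intro meromorphic_intros 1 analytic_on_imp_meromorphic_on[of "\<lambda>s. 2 powr (- s)"])
  moreover have "B' s = beta_int s" if s: "Re s > 1 / 2" for s
  proof -
    have "4 * s - 2 \<noteq> 0" using s by (auto simp: complex_eq_iff)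
    thus ?thesis using beta_int_rec[OF s] B(2)[of "s + 1"] s by (simp add: B'_def field_simps)
  qed
  ultimately show ?case by blast
qed

lemma pw_deriv_1_1_holomorphic: "(\<lambda>s. pw_deriv r s s 1 1) holomorphic_on A"
  by (auto intro!: holomorphic_intros)

lemma zeta_affine_meromorphic: "(\<lambda>s. zeta (3 * s + c)) meromorphic_on A"
  by (rule meromorphic_on_compose[OF zeta_meromorphic[of UNIV]]) (auto intro!: analytic_intros)

lemma omega_series_holomorphic: "omega_series holomorphic_on {s. Re s > 2 / 3}"
proof (rule holomorphic_transform)
  have z: "zeta holomorphic_on {s. Re s > 1}"
    by (rule holomorphic_transform[OF zeta_series_holomorphic]) (simp add: zeta_eq_series)
  have z': "(\<lambda>s. zeta (3 * s + c)) holomorphic_on {s. Re s > 2 / 3}" if "Re c \<ge> - 1" for c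
    by (rule holomorphic_on_compose_gen[OF _ z, of "\<lambda>s. 3 * s + c", unfolded o_def])
       (use that in \<open>auto intro!: holomorphic_intros\<close>)
  have b: "beta_int holomorphic_on {s. Re s > 2 / 3}"
    by (rule holomorphic_on_subset[OF beta_int_holomorphic]) auto
  have r: "em_lattice_rem (Suc 2) holomorphic_on {s. Re s > 2 / 3}"
    by (rule holomorphic_on_subset[OF em_lattice_rem_holomorphic(1)[of 0]]) auto
  show "(\<lambda>s. 2 * (beta_int s * zeta (3 * s + (- 1))
     - (\<Sum>r=1..2. bern_coeff r * pw_deriv r s s 1 1 * zeta (3 * s + of_nat r))
     + (-1) ^ 2 * em_lattice_rem (Suc 2) s)) holomorphic_on {s. Re s > 2 / 3}"
    by (intro holomorphic_intros b z' r pw_deriv_1_1_holomorphic) auto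
  show "2 * (beta_int s * zeta (3 * s + (- 1))
     - (\<Sum>r=1..2. bern_coeff r * pw_deriv r s s 1 1 * zeta (3 * s + of_nat r))
     + (-1) ^ 2 * em_lattice_rem (Suc 2) s) = omega_series s" if "s \<in> {s. Re s > 2 / 3}" for s
    using omega_series_formula[of s 2] that by simp
qed

text \<open>For each n the formula of sufficiently high order, with \<open>beta_int\<close>
  continued by its recursion, is meromorphic on Re s > -n.\<close>

lemma omega_is_continuation: "is_meromorphic_continuation {s. Re s > 2 / 3} omega_series omega"
  unfolding omega_def
proof (rule meromorphic_continuation_halfplane)
  fix n :: nat
  \<comment> \<open>The remainder of order q + 1 = 3 n + 3 exceeds the threshold 3 n + 2 of
    \<open>em_lattice_rem_holomorphic\<close>.\<close>
  define q where "q = 3 * n + 2"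
  let ?A = "{s. Re s > - real n}"
  obtain B where B: "B meromorphic_on {s. Re s > 1 / 2 - real (Suc n)}" "\<And>s. Re s > 1 / 2 \<Longrightarrow> B s = beta_int s"
    using beta_int_meromorphic[of "Suc n"] by (elim exE conjE) (rule that, assumption, simp)
  have b: "B meromorphic_on ?A" by (rule meromorphic_on_subset[OF B(1)]) auto
  have "em_lattice_rem (Suc q) holomorphic_on ?A"
    by (rule em_lattice_rem_holomorphic(1)) (auto simp: q_def)
  hence r: "em_lattice_rem (Suc q) meromorphic_on ?A"
    by (intro analytic_on_imp_meromorphic_on) (simp add: analytic_on_open open_halfspace_Re_gt)
  have p: "(\<lambda>s. pw_deriv r s s 1 1) meromorphic_on ?A" for r
    using pw_deriv_1_1_holomorphic[of r ?A]
    by (intro analytic_on_imp_meromorphic_on) (simp add: analytic_on_open open_halfspace_Re_gt)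
  define F where "F s = 2 * (B s * zeta (3 * s + (- 1))
     - (\<Sum>r=1..q. bern_coeff r * pw_deriv r s s 1 1 * zeta (3 * s + of_nat r))
     + (-1) ^ q * em_lattice_rem (Suc q) s)" for s
  have 1: "F meromorphic_on ?A"
    unfolding F_def[abs_def] by (intro meromorphic_intros b r p zeta_affine_meromorphic)
  have 2: "F s = omega_series s" if "Re s > 2 / 3" for s
    using omega_series_formula[OF that, of q] B(2)[of s] that by (simp add: F_def q_def)
  show "\<exists>F. F meromorphic_on ?A \<and> (\<forall>s. 2 / 3 < Re s \<longrightarrow> F s = omega_series s)"
    by (rule exI[of _ F]) (simp add: 1 2)
next
  show "omega_series holomorphic_on {s. Re s > 2 / 3}" by (rule omega_series_holomorphic)
qed simp

section \<open>The derivative of omega at 0\<close>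

text \<open>The derivative at s = 0 of (y (y + j))^(-s) is -ln y - ln (y + j), and the
  Euler-Maclaurin remainder of -ln on a unit cell is the increment of Stirling's error.\<close>

lemma deriv_em_lattice_term:
  assumes j: "j \<ge> 1" and k: "k \<ge> 1"
  shows "deriv (\<lambda>s. of_real (real j) powr (- s) * pw_rem 3 s s (real j) (real k)) 0 =
     of_real ((stirling_err k - stirling_err (Suc k)) + (stirling_err (k + j) - stirling_err (Suc (k + j))))"
proof -
  define J K where "J = real j" and "K = real k"
  have JK: "J > 0" "K > 0" using j k by (simp_all add: J_def K_def)
  define F where "F y s = exp (- s * of_real (ln y)) * exp (- s * of_real (ln (y + J)))" for y :: real and s :: complex
  have F0: "pw_deriv 0 s s (of_real J) (of_real y) = F y s" if y: "y > 0" for y s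
  proof -
    have "y + J > 0" using y JK by simp
    have "complex_of_real y + of_real J = of_real (y + J)" by simp
    thus ?thesis unfolding pw_deriv.simps F_def using of_real_powr_exp[OF y] of_real_powr_exp[OF \<open>y + J > 0\<close>] by metis
  qed
  have F1: "pw_deriv 1 s s (of_real J) (of_real y) = - s * ((of_real (1 / y) + of_real (1 / (y + J))) * F y s)" if y: "y > 0" for y s
  proof -
    define Y Z where "Y = complex_of_real y" and "Z = complex_of_real (y + J)"
    have nz: "Y \<noteq> 0" "Z \<noteq> 0" using y JK by (simp_all add: Y_def Z_def del: of_real_add)
    have Z: "Y + of_real J = Z" by (simp add: Y_def Z_def)
    have "pw_deriv 1 s s (of_real J) Y = - s * (Y powr (- s - 1) * Z powr (- s)) - s * (Y powr (- s) * Z powr (- s - 1))"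
      unfolding One_nat_def by (simp add: Z)
    also have "\<dots> = - s * ((1 / Y + 1 / Z) * (Y powr (- s) * Z powr (- s)))"
      using nz by (simp add: powr_diff powr_to_1 algebra_simps)
    also have "Y powr (- s) * Z powr (- s) = F y s"
      using F0[OF y, of s] unfolding pw_deriv.simps Y_def [symmetric] Z .
    finally show ?thesis by (simp add: Y_def Z_def)
  qed
  define R where "R s = pw_rem 0 s (1 * s) J K" for s
  have expand: "pw_rem 3 s s J K = (F K s + F (K + 1) s) / 2 - R s
     - 1 / 12 * (- s * ((of_real (1 / (K + 1)) + of_real (1 / (K + 1 + J))) * F (K + 1) s) + s * ((of_real (1 / K) + of_real (1 / (K + J))) * F K s))" for s
  proof -
    have "{1..2::nat} = {1, 2}" by auto
    hence "(pw_deriv 0 s s (of_real J) (of_real K) + pw_deriv 0 s s (of_real J) (of_real (K + 1))) / 2 =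
      pw_rem 0 s s J K + 1 / 12 * (pw_deriv 1 s s (of_real J) (of_real (K + 1)) - pw_deriv 1 s s (of_real J) (of_real K)) + pw_rem 3 s s J K"
      using pw_rem_expand[of K J s s 2] JK em_kernel_2 em_kernel_3
      by (simp add: numeral_3_eq_3 numeral_2_eq_2 del: pw_deriv.simps of_real_add)
    moreover have "K + 1 > 0" using JK by simp
    ultimately show ?thesis unfolding F0[OF JK(2)] F0[OF \<open>K + 1 > 0\<close>] F1[OF JK(2)] F1[OF \<open>K + 1 > 0\<close>] R_def
      by (simp add: algebra_simps)
  qed
  define G where "G x = x * ln x - x" for x :: real
  have G: "((\<lambda>t. complex_of_real (ln (x + t))) has_integral of_real (G (x + 1) - G x)) {0..1}" if x: "x > 0" for x
  proof (rule has_integral_of_real)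
    have "((\<lambda>t. ln (x + t)) has_integral (G (x + 1) - G (x + 0))) {0..1}"
      by (rule fundamental_theorem_of_calculus)
         (use x in \<open>auto intro!: derivative_eq_intros simp: G_def simp flip: has_real_derivative_iff_has_vector_derivative\<close>)
    thus "((\<lambda>t. ln (x + t)) has_integral (G (x + 1) - G x)) {0..1}" by simp
  qed
  have R0: "R 0 = 1"
  proof -
    have "R 0 = integral {0..1} (\<lambda>t::real. 1 :: complex)"
      unfolding R_def pw_rem_def em_rem_def
    proof (rule integral_cong)
      fix t :: real assume "t \<in> {0..1}"
      hence "complex_of_real (K + t) \<noteq> 0" "complex_of_real (K + t) + of_real J \<noteq> 0"
        using JK by (simp_all del: of_real_add add: of_real_add [symmetric])
      thus "of_real (poly (em_kernel 0) t) * pw_deriv 0 0 (1 * 0) (of_real J) (of_real (K + t)) = 1" by simp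
    qed
    thus ?thesis by simp
  qed
  have Rd: "(R has_field_derivative - of_real (G (K + 1) - G K + (G (K + J + 1) - G (K + J)))) (at 0)"
  proof -
    have "integral {0..1} (\<lambda>t. - (of_real (ln (K + t)) + 1 * of_real (ln (K + t + J))) *
        pw_deriv 0 0 (1 * 0) (of_real J) (of_real (K + t))) =
       integral {0..1} (\<lambda>t. - (complex_of_real (ln (K + t)) + of_real (ln (K + J + t))))"
    proof (rule integral_cong)
      fix t :: real assume "t \<in> {0..1}"
      hence "complex_of_real (K + t) \<noteq> 0" "complex_of_real (K + t) + of_real J \<noteq> 0"
        using JK by (simp_all del: of_real_add add: of_real_add [symmetric])
      thus "- (of_real (ln (K + t)) + 1 * of_real (ln (K + t + J))) * pw_deriv 0 0 (1 * 0) (of_real J) (of_real (K + t)) =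
         - (complex_of_real (ln (K + t)) + of_real (ln (K + J + t)))" by (simp add: add_ac)
    qed
    also have "\<dots> = - (of_real (G (K + 1) - G K) + of_real (G (K + J + 1) - G (K + J)))"
      using JK by (intro integral_unique has_integral_neg has_integral_add G) auto
    finally show ?thesis
      using pw_rem_0_has_field_derivative[of K J 1 0] JK unfolding R_def by simp
  qed
  define LK LK1 where "LK = complex_of_real (ln K + ln (K + J))" and "LK1 = complex_of_real (ln (K + 1) + ln (K + 1 + J))"
  have Fd: "(F y has_field_derivative - of_real (ln y + ln (y + J))) (at 0)" for y
    unfolding F_def by (auto intro!: derivative_eq_intros)
  have F_at_0: "F y 0 = 1" for y by (simp add: F_def)
  define T where "T = ((- LK + - LK1) / 2 + of_real (G (K + 1) - G K + (G (K + J + 1) - G (K + J)))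
      - 1 / 12 * (- (of_real (1 / (K + 1)) + of_real (1 / (K + 1 + J))) + (of_real (1 / K) + of_real (1 / (K + J)))))"
  have "((\<lambda>s. pw_rem 3 s s J K) has_field_derivative T) (at 0)"
    unfolding expand T_def LK_def LK1_def
    by (rule derivative_eq_intros Fd Rd refl | simp add: F_at_0)+
  \<comment> \<open>At s = 0 the function is the constant 1, on which the trapezoidal rule is exact.
    Hence differentiating the factor j^(-s) contributes nothing.\<close>
  moreover have "pw_rem 3 0 0 J K = 0" unfolding expand by (simp add: F_at_0 R0)
  moreover have "((\<lambda>s. exp (- s * of_real (ln J))) has_field_derivative (- of_real (ln J))) (at 0)"
    by (auto intro!: derivative_eq_intros)
  ultimately have "((\<lambda>s. exp (- s * of_real (ln J)) * pw_rem 3 s s J K) has_field_derivative T) (at 0)"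
    using DERIV_mult[of "\<lambda>s. exp (- s * of_real (ln J))" _ 0 UNIV "\<lambda>s. pw_rem 3 s s J K" T] by simp
  hence "deriv (\<lambda>s. of_real J powr (- s) * pw_rem 3 s s J K) 0 = T"
    unfolding of_real_powr_exp[OF JK(1)] by (rule DERIV_imp_deriv)
  also have "T = of_real ((stirling_err k - stirling_err (Suc k)) + (stirling_err (k + j) - stirling_err (Suc (k + j))))"
  proof -
    have "stirling_err k - stirling_err (Suc k) = (K + 1 / 2) * (ln (K + 1) - ln K) - 1 - (1 / K) / 12 + (1 / (K + 1)) / 12"
      using stirling_err_diff[OF k] by (simp add: K_def distrib_left mult.commute)
    moreover have "stirling_err (k + j) - stirling_err (Suc (k + j)) =
        (K + J + 1 / 2) * (ln (K + 1 + J) - ln (K + J)) - 1 - (1 / (K + J)) / 12 + (1 / (K + 1 + J)) / 12"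
      using stirling_err_diff[of "k + j"] k by (simp add: K_def J_def distrib_left mult.commute add_ac)
    moreover have "K + J + 1 = K + 1 + J" by simp
    ultimately have r: "((- (ln K + ln (K + J)) + - (ln (K + 1) + ln (K + 1 + J))) / 2 + (G (K + 1) - G K + (G (K + J + 1) - G (K + J)))
      - 1 / 12 * (- (1 / (K + 1) + 1 / (K + 1 + J)) + (1 / K + 1 / (K + J)))) =
      (stirling_err k - stirling_err (Suc k)) + (stirling_err (k + j) - stirling_err (Suc (k + j)))"
      unfolding G_def by (simp add: algebra_simps add_divide_distrib diff_divide_distrib)
    show ?thesis unfolding r [symmetric] T_def LK_def LK1_def by simp
  qed
  finally show ?thesis unfolding J_def K_def .
qed

text \<open>In row j the sum over k >= j telescopes to E(j) + E(2j), and both resulting series are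
  given by \<open>stirling_err_sums\<close>.\<close>

lemma deriv_em_lattice_rem_0:
  assumes z: "glaisher_seq \<longlonglongrightarrow> z"
  shows "deriv (em_lattice_rem 3) 0 = of_real (ln (2 * pi) / 4 - (1 + euler_mascheroni) / 12 + 2 * z +
     (ln (2 * pi) / 4 - 1 / 6 + 5 / 24 * ln 2 + 5 / 2 * z - euler_mascheroni / 24))"
proof -
  define d where "d k = stirling_err k - stirling_err (Suc k)" for k
  \<comment> \<open>Order 3 covers Re s > -1/4, since 3 > 3/4 + 2; 0 is an interior point of that
    half-plane.\<close>
  have "((\<lambda>x. deriv (\<lambda>s. case x of (j, k) \<Rightarrow> of_real (real j) powr (- s) * pw_rem 3 s s (real j) (real k)) 0)
      has_sum deriv (em_lattice_rem 3) 0) tri"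
    by (rule em_lattice_rem_holomorphic(2)[of "1 / 4"]) auto
  also have "?this = ((\<lambda>(j, k). complex_of_real (d k + d (k + j))) has_sum deriv (em_lattice_rem 3) 0) tri"
  proof (rule has_sum_cong)
    fix x assume "x \<in> tri"
    then obtain j k where x: "x = (j, k)" "j \<ge> 1" "k \<ge> 1" by (auto simp: tri_def)
    from deriv_em_lattice_term[OF x(2,3)]
    show "deriv (\<lambda>s. case x of (j, k) \<Rightarrow> of_real (real j) powr (- s) * pw_rem 3 s s (real j) (real k)) 0 =
        (case x of (j, k) \<Rightarrow> complex_of_real (d k + d (k + j)))"
      unfolding x d_def by (simp only: split_conv)
  qed
  finally have hs: "((\<lambda>(j, k). complex_of_real (d k + d (k + j))) has_sum deriv (em_lattice_rem 3) 0) (Sigma {1..} (\<lambda>j. {j..}))"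
    unfolding tri_def .
  have inner: "((\<lambda>k. case (j, k) of (j, k) \<Rightarrow> complex_of_real (d k + d (k + j))) has_sum of_real (stirling_err j + stirling_err (2 * j))) {j..}"
    if j: "j \<in> {1..}" for j
  proof -
    have "(\<lambda>k. complex_of_real (d k + d (k + j))) summable_on {j..}"
      using summable_on_SigmaD1[OF has_sum_imp_summable[OF hs] j] by simp
    then obtain S where S: "((\<lambda>k. complex_of_real (d k + d (k + j))) has_sum S) {j..}"
      by (auto simp: summable_on_def)
    also have "?this = ((\<lambda>i. complex_of_real (d (j + i) + d (j + i + j))) has_sum S) UNIV"
      by (rule has_sum_reindex_bij_witness[where i = "\<lambda>i. j + i" and j = "\<lambda>k. k - j"]) auto
    finally have s1: "(\<lambda>i. complex_of_real (d (j + i) + d (j + i + j))) sums S" by (rule has_sum_imp_sums)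
    have l: "(\<lambda>i. stirling_err (m + i)) \<longlonglongrightarrow> 0" for m
      using LIMSEQ_ignore_initial_segment[OF stirling_err_tendsto, of m] by (simp add: add.commute)
    have "(\<lambda>i. d (j + i) + d (2 * j + i)) sums ((stirling_err (j + 0) - 0) + (stirling_err (2 * j + 0) - 0))"
      using telescope_sums'[OF l[of j]] telescope_sums'[OF l[of "2 * j"]]
      unfolding d_def by (intro sums_add) simp_all
    hence "(\<lambda>i. complex_of_real (d (j + i) + d (2 * j + i))) sums of_real ((stirling_err (j + 0) - 0) + (stirling_err (2 * j + 0) - 0))"
      by (rule sums_of_real)
    moreover have "2 * j + i = j + i + j" for i by simp
    ultimately have "S = of_real (stirling_err j + stirling_err (2 * j))"
      using sums_unique2[OF s1] by simp
    thus ?thesis using S by simp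
  qed
  have "(\<lambda>n. complex_of_real (stirling_err (Suc n) + stirling_err (2 * Suc n))) sums deriv (em_lattice_rem 3) 0"
    by (rule has_sum_Suc_imp_sums[OF has_sum_SigmaD[OF hs inner]])
  moreover have "(\<lambda>n. complex_of_real (stirling_err (Suc n) + stirling_err (2 * Suc n))) sums
    of_real (ln (2 * pi) / 4 - (1 + euler_mascheroni) / 12 + 2 * z +
     (ln (2 * pi) / 4 - 1 / 6 + 5 / 24 * ln 2 + 5 / 2 * z - euler_mascheroni / 24))"
    by (intro sums_of_real sums_add stirling_err_sums z)
  ultimately show ?thesis by (rule sums_unique2)
qed

text \<open>The formula of order 2 with \<open>beta_int\<close> replaced through its recursion and
  zeta through \<open>eta\<close>. The pole of zeta(3 s + 1) at 0 is cancelled by the factor s of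
  its coefficient and leaves the term 2^(-s)/12, so the expression is analytic at 0.\<close>

definition omega_local :: "complex \<Rightarrow> complex" where
  "omega_local s = 2 * ((3 * 2 powr (- s) - s * beta_int (s + 1)) / (4 * s - 2)) * (1 / (3 * s - 2) + eta (3 * s - 1))
     + 2 powr (- s) / 12 + s * 2 powr (- s) * eta (3 * s + 1) / 4 + 2 * em_lattice_rem 3 s"

lemma omega_local_eq_series:
  assumes s: "Re s > 2 / 3"
  shows "omega_local s = omega_series s"
proof -
  have nz: "4 * s - 2 \<noteq> 0" "3 * s - 1 \<noteq> 1" "3 * s + 1 \<noteq> 1" "s \<noteq> 0" using s by (auto simp: complex_eq_iff)
  have b: "beta_int s = (3 * 2 powr (- s) - s * beta_int (s + 1)) / (4 * s - 2)"
    using beta_int_rec[of s] s nz by (simp add: field_simps)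
  have z1: "zeta (3 * s - 1) = 1 / (3 * s - 2) + eta (3 * s - 1)"
    using zeta_eq_eta[of "3 * s - 1"] s nz by simp
  have z2: "zeta (3 * s + 1) = 1 / (3 * s) + eta (3 * s + 1)"
    using zeta_eq_eta[of "3 * s + 1"] s nz by simp
  have p: "pw_deriv 1 s s 1 1 = - (3 / 2) * s * 2 powr (- s)"
  proof -
    have "(2 :: complex) powr (- (s + 1)) = 2 powr (- s) / 2" by (simp add: powr_diff)
    thus ?thesis unfolding One_nat_def by (simp add: algebra_simps)
  qed
  have "{1..2::nat} = {1, 2}" by auto
  hence "(\<Sum>r=1..2. bern_coeff r * pw_deriv r s s 1 1 * zeta (3 * s + of_nat r)) = bern_coeff 1 * pw_deriv 1 s s 1 1 * zeta (3 * s + 1)"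
    using em_kernel_3 by (simp add: bern_coeff_def numeral_3_eq_3 numeral_2_eq_2 del: pw_deriv.simps)
  also have "bern_coeff 1 = 1 / 12"
    using em_kernel_2 by (simp add: bern_coeff_def numeral_2_eq_2)
  finally have "omega_series s = 2 * (beta_int s * zeta (3 * s - 1) - 1 / 12 * (- (3 / 2) * s * 2 powr (- s)) * (1 / (3 * s) + eta (3 * s + 1)) + em_lattice_rem 3 s)"
    using omega_series_formula[OF s, of 2] unfolding p z2 by (simp add: numeral_3_eq_3 numeral_2_eq_2)
  also have "1 / 12 * (- (3 / 2) * s * 2 powr (- s)) * (1 / (3 * s) + eta (3 * s + 1)) =
     - (2 powr (- s) / 24 + s * 2 powr (- s) * eta (3 * s + 1) / 8)"
    using nz by (simp add: field_simps)
  finally show ?thesis unfolding omega_local_def z1 b [symmetric] by (simp add: algebra_simps)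
qed

lemma omega_local_holomorphic_pieces:
  shows "(\<lambda>s. beta_int (s + 1)) holomorphic_on {s. Re s > - 1 / 4}"
    and "(\<lambda>s. eta (3 * s - 1)) holomorphic_on {s. Re s > - 1 / 4}"
    and "(\<lambda>s. eta (3 * s + 1)) holomorphic_on {s. Re s > - 1 / 4}"
    and "em_lattice_rem 3 holomorphic_on {s. Re s > - 1 / 4}"
proof -
  show "(\<lambda>s. beta_int (s + 1)) holomorphic_on {s. Re s > - 1 / 4}"
    by (rule holomorphic_on_compose_gen[OF _ beta_int_holomorphic, of "\<lambda>s. s + 1", unfolded o_def]) (auto intro!: holomorphic_intros)
  show "(\<lambda>s. eta (3 * s - 1)) holomorphic_on {s. Re s > - 1 / 4}"
    by (rule holomorphic_on_compose_gen[OF _ zeta_em_holomorphic[of 2], of "\<lambda>s. 3 * s - 1", unfolded o_def]) (auto intro!: holomorphic_intros)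
  show "(\<lambda>s. eta (3 * s + 1)) holomorphic_on {s. Re s > - 1 / 4}"
    by (rule holomorphic_on_compose_gen[OF _ zeta_em_holomorphic[of 2], of "\<lambda>s. 3 * s + 1", unfolded o_def]) (auto intro!: holomorphic_intros)
  show "em_lattice_rem 3 holomorphic_on {s. Re s > - 1 / 4}"
    using em_lattice_rem_holomorphic(1)[of "1/4" 3] by simp
qed

lemma omega_eq_local:
  assumes s: "s \<in> ball 0 (1 / 4)"
  shows "omega s = omega_local s"
proof (rule meromorphic_continuation_eq[OF omega_is_continuation])
  let ?A = "{s. Re s > - 1 / 4}"
  have an: "f analytic_on ?A" if "f holomorphic_on ?A" for f
    using that analytic_on_open[OF open_halfspace_Re_gt] by blast
  note pieces = omega_local_holomorphic_pieces[THEN an]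
  have p: "(\<lambda>s. 2 powr (- s) :: complex) analytic_on ?A" by (auto intro!: analytic_intros)
  show "omega_local meromorphic_on ?A"
    unfolding omega_local_def[abs_def]
    by (intro meromorphic_intros pieces[THEN analytic_on_imp_meromorphic_on] p[THEN analytic_on_imp_meromorphic_on])
  have "Re s > - 1 / 4" using s abs_Re_le_cmod[of s] by (simp add: dist_norm)
  thus "Re s > - 1 / 4" .
  hence sub: "{s} \<subseteq> ?A" by simp
  have "4 * s - 2 \<noteq> 0" "3 * s - 2 \<noteq> 0"
    using s abs_Re_le_cmod[of s] by (auto simp: dist_norm complex_eq_iff)
  thus "omega_local analytic_on {s}"
    unfolding omega_local_def[abs_def]
    by (intro analytic_intros analytic_on_subset[OF pieces(1) sub] analytic_on_subset[OF pieces(2) sub]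
         analytic_on_subset[OF pieces(3) sub] analytic_on_subset[OF pieces(4) sub] analytic_on_subset[OF p sub]) auto
  show "omega_local s = omega_series s" if "Re s > 2 / 3" for s
    by (rule omega_local_eq_series[OF that])
qed (use omega_series_holomorphic in auto)

lemma omega_has_derivative_ln_2pi:
  "(omega has_field_derivative of_real (ln (2 * pi))) (at 0)"
proof -
  obtain z where z: "deriv zeta (-1) = of_real z" "glaisher_seq \<longlonglongrightarrow> z" by (rule deriv_zeta_minus_1)
  have e1: "eta (-1) = 5 / 12"
    using zeta_eq_eta[of "-1"] zeta_minus_1 by (simp add: complex_eq_iff)
  have e2: "deriv eta (-1) = of_real z + 1 / 4"
    using DERIV_imp_deriv[OF zeta_has_field_derivative[of "-1"]] z(1) by (simp add: complex_eq_iff)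
  define \<rho> where "\<rho> = deriv (em_lattice_rem 3) 0"
  have op: "open {s. Re s > - 1 / 4}" by (rule open_halfspace_Re_gt)
  have d0: "(em_lattice_rem 3 has_field_derivative \<rho>) (at 0)"
    unfolding \<rho>_def by (rule holomorphic_derivI[OF omega_local_holomorphic_pieces(4) op]) simp
  define b' where "b' = deriv (\<lambda>s. beta_int (s + 1)) 0"
  have d1: "((\<lambda>s. beta_int (s + 1)) has_field_derivative b') (at 0)"
    unfolding b'_def by (rule holomorphic_derivI[OF omega_local_holomorphic_pieces(1) op]) simp
  have d2: "((\<lambda>s. eta (3 * s - 1)) has_field_derivative (3 * (of_real z + 1 / 4))) (at 0)"
  proof -
    have "((\<lambda>s. 3 * s - 1) has_field_derivative (3 :: complex)) (at 0)" by (auto intro!: derivative_eq_intros)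
    moreover have "(eta has_field_derivative deriv eta (-1)) (at (3 * 0 - 1))"
      using eta_has_field_derivative[of "-1"] by simp
    ultimately show ?thesis using DERIV_chain2 e2 by (metis mult.commute)
  qed
  obtain e' where d3: "((\<lambda>s. eta (3 * s + 1)) has_field_derivative e') (at 0)"
    using holomorphic_derivI[OF omega_local_holomorphic_pieces(3) op, of 0] by auto
  have d4: "((\<lambda>s. 2 powr (- s)) has_field_derivative - of_real (ln 2)) (at (0 :: complex))"
  proof -
    have "2 powr (- s) = exp (- s * of_real (ln 2))" for s :: complex using of_real_powr_exp[of 2 "- s"] by simp
    thus ?thesis by (auto intro!: derivative_eq_intros)
  qed
  \<comment> \<open>Product rule at 0 with \<open>beta_int 1 = ln 2\<close>, eta(-1) = 5/12, eta(1)
    = gamma; the quotient continuing \<open>beta_int\<close> has value -3/2 there.\<close>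
  have "(omega_local has_field_derivative
      (2 * (((3 * - of_real (ln 2) - of_real (ln 2)) * (- 2) - 3 * 4) / 4) * (- 1 / 2 + 5 / 12) + 2 * (3 / (- 2)) * (- 3 / 4 + 3 * (of_real z + 1 / 4))
       - of_real (ln 2) / 12 + of_real euler_mascheroni / 4 + 2 * \<rho>)) (at 0)"
    unfolding omega_local_def[abs_def]
    by (rule derivative_eq_intros d0 d1 d2 d3 d4 refl | simp add: e1 eta_1 beta_int_1)+
  \<comment> \<open>Here zeta'(-1), gamma, ln 2 and the rational constants cancel against those in
    twice the derivative of the remainder.\<close>
  also have "(2 * (((3 * - of_real (ln 2) - of_real (ln 2)) * (- 2) - 3 * 4) / 4) * (- 1 / 2 + 5 / 12) + 2 * (3 / (- 2)) * (- 3 / 4 + 3 * (of_real z + 1 / 4))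
       - of_real (ln 2) / 12 + of_real euler_mascheroni / 4 + 2 * \<rho>) = complex_of_real (ln (2 * pi))"
    unfolding \<rho>_def deriv_em_lattice_rem_0[OF z(2)] by (simp add: complex_eq_iff field_simps)
  finally have "(omega_local has_field_derivative of_real (ln (2 * pi))) (at 0)" .
  thus ?thesis
    by (rule has_field_derivative_transform_within_open[where S = "ball 0 (1 / 4)"]) (simp_all add: omega_eq_local)
qed

text \<open>The integral is twice the sum of the Stirling errors, whose value contains zeta'(-1) and
  gamma in exactly the proportion that cancels the other terms.\<close>

lemma ln_2pi_eq_formula:
  "complex_of_real (ln (2 * pi)) = 1/12 * (1 + of_real euler_mascheroni) + 3/4 * of_real (ln (2 * pi))
               - 2 * deriv zeta (-1) + 1/2 * (LINT t|lborel. omega_integrand t)"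
proof -
  obtain z where z: "deriv zeta (-1) = of_real z" "glaisher_seq \<longlonglongrightarrow> z" by (rule deriv_zeta_minus_1)
  have "(\<lambda>n. complex_of_real (2 * stirling_err (Suc n))) sums of_real (2 * (ln (2 * pi) / 4 - (1 + euler_mascheroni) / 12 + 2 * z))"
    by (intro sums_of_real sums_mult stirling_err_sums(1) z)
  with omega_integrand_integral(2) have "(LINT t|lborel. omega_integrand t) = of_real (2 * (ln (2 * pi) / 4 - (1 + euler_mascheroni) / 12 + 2 * z))"
    by (rule sums_unique2)
  thus ?thesis unfolding z(1) by (simp add: complex_eq_iff field_simps)
qed

section \<open>Numerical bounds for pi and ln (2 pi)\<close>

text \<open>The signed error (-1)^n (arctan t - S t) vanishes at 0 and has the nonnegative
  derivative t^(2n) / (1 + t^2), by the geometric sum.\<close>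

lemma arctan_partial_sum_bounds:
  fixes x :: real
  assumes x: "x \<ge> 0"
  shows "even n \<Longrightarrow> (\<Sum>k<n. (-1) ^ k * x ^ (2 * k + 1) / real (2 * k + 1)) \<le> arctan x"
    and "odd n \<Longrightarrow> arctan x \<le> (\<Sum>k<n. (-1) ^ k * x ^ (2 * k + 1) / real (2 * k + 1))"
proof -
  define S where "S t = (\<Sum>k<n. (-1) ^ k * t ^ (2 * k + 1) / real (2 * k + 1))" for t :: real
  have der: "((\<lambda>t. (-1) ^ n * (arctan t - S t)) has_real_derivative (t ^ 2) ^ n / (1 + t ^ 2)) (at t)" for t
  proof -
    have p: "1 + t ^ 2 > 0" by (simp add: add_pos_nonneg)
    have "((\<lambda>t. (-1) ^ k * t ^ (2 * k + 1) / real (2 * k + 1)) has_real_derivative (- (t ^ 2)) ^ k) (at t)" for k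
    proof -
      have "((\<lambda>t. (-1) ^ k * t ^ (2 * k + 1) / real (2 * k + 1)) has_real_derivative ((-1) ^ k * (real (2 * k + 1) * t ^ (2 * k)) / real (2 * k + 1))) (at t)"
        using DERIV_cdivide[OF DERIV_cmult[OF DERIV_pow[of "2 * k + 1" t]], of "(-1) ^ k" "real (2 * k + 1)"] by simp
      also have "(-1) ^ k * (real (2 * k + 1) * t ^ (2 * k)) / real (2 * k + 1) = (-1) ^ k * t ^ (2 * k)"
      proof -
        have "a * (c * b) / c = a * b" if "c \<noteq> 0" for a b c :: real using that by simp
        thus ?thesis by (simp only: of_nat_eq_0_iff)
      qed
      also have "\<dots> = (- (t ^ 2)) ^ k" by (simp add: power_mult power_minus[of "t ^ 2" k])
      finally show ?thesis .
    qed
    hence "(S has_real_derivative (\<Sum>k<n. (- (t ^ 2)) ^ k)) (at t)"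
      unfolding S_def[abs_def] by (intro DERIV_sum)
    moreover have "(\<Sum>k<n. (- (t ^ 2)) ^ k) = (1 - (- (t ^ 2)) ^ n) / (1 + t ^ 2)"
    proof -
      have "- (t ^ 2) \<noteq> 1" using p by linarith
      thus ?thesis unfolding sum_gp_strict by simp
    qed
    ultimately have "((\<lambda>t. (-1) ^ n * (arctan t - S t)) has_real_derivative (-1) ^ n * (inverse (1 + t ^ 2) - (1 - (- (t ^ 2)) ^ n) / (1 + t ^ 2))) (at t)"
      by (auto intro!: derivative_eq_intros)
    also have "(-1) ^ n * (inverse (1 + t ^ 2) - (1 - (- (t ^ 2)) ^ n) / (1 + t ^ 2)) = (t ^ 2) ^ n / (1 + t ^ 2)"
    proof -
      have "E * (inverse P - (1 - E * T) / P) = T / P" if "E * E = 1" for E T P :: real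
      proof -
        have "E * (inverse P - (1 - E * T) / P) = (E * E) * T / P"
          by (simp add: diff_divide_distrib inverse_eq_divide)
        thus ?thesis using that by simp
      qed
      moreover have "(-1) ^ n * (-1) ^ n = (1 :: real)" by (simp flip: power_mult_distrib)
      ultimately show ?thesis unfolding power_minus[of "t ^ 2" n] by blast
    qed
    finally show ?thesis .
  qed
  have "(-1) ^ n * (arctan 0 - S 0) \<le> (-1) ^ n * (arctan x - S x)"
    using x by (rule DERIV_nonneg_imp_nondecreasing) (use der in \<open>auto intro!: exI divide_nonneg_nonneg add_nonneg_nonneg\<close>)
  moreover have "S 0 = 0" by (simp add: S_def)
  ultimately have "0 \<le> (-1) ^ n * (arctan x - S x)" by simp
  thus "even n \<Longrightarrow> (\<Sum>k<n. (-1) ^ k * x ^ (2 * k + 1) / real (2 * k + 1)) \<le> arctan x"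
    and "odd n \<Longrightarrow> arctan x \<le> (\<Sum>k<n. (-1) ^ k * x ^ (2 * k + 1) / real (2 * k + 1))"
    by (simp_all add: S_def)
qed

text \<open>Machin's formula pi = 16 arctan(1/5) - 4 arctan(1/239). The fractions come from the
  continued fraction of pi, a convergent below and an intermediate fraction above, which keeps them
  short for their accuracy.\<close>

lemma pi_bounds_20_digits:
  "21053343141 / 6701487259 \<le> pi" "pi \<le> 225418824097 / 71753040242"
proof -
  have l5: "(\<Sum>k<16. (-1) ^ k * (1 / 5 :: real) ^ (2 * k + 1) / real (2 * k + 1)) \<le> arctan (1 / 5)"
    and u5: "arctan (1 / 5) \<le> (\<Sum>k<17. (-1) ^ k * (1 / 5 :: real) ^ (2 * k + 1) / real (2 * k + 1))"
    by (rule arctan_partial_sum_bounds; simp)+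
  have l239: "(\<Sum>k<6. (-1) ^ k * (1 / 239 :: real) ^ (2 * k + 1) / real (2 * k + 1)) \<le> arctan (1 / 239)"
    and u239: "arctan (1 / 239) \<le> (\<Sum>k<5. (-1) ^ k * (1 / 239 :: real) ^ (2 * k + 1) / real (2 * k + 1))"
    by (rule arctan_partial_sum_bounds; simp)+
  have "21053343141 / 6701487259 \<le> 16 * (\<Sum>k<16. (-1) ^ k * (1 / 5 :: real) ^ (2 * k + 1) / real (2 * k + 1))
      - 4 * (\<Sum>k<5. (-1) ^ k * (1 / 239 :: real) ^ (2 * k + 1) / real (2 * k + 1))"
    by (simp add: eval_nat_numeral)
  thus "21053343141 / 6701487259 \<le> pi" using machin l5 u239 by linarith
  have "16 * (\<Sum>k<17. (-1) ^ k * (1 / 5 :: real) ^ (2 * k + 1) / real (2 * k + 1))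
      - 4 * (\<Sum>k<6. (-1) ^ k * (1 / 239 :: real) ^ (2 * k + 1) / real (2 * k + 1)) \<le> 225418824097 / 71753040242"
    by (simp add: eval_nat_numeral)
  thus "pi \<le> 225418824097 / 71753040242" using machin u5 l239 by linarith
qed

text \<open>The artanh series for ln x in y = (x - 1)/(x + 1) with a geometric bound for its tail,
  stated so that x, y, l, u and n can be supplied as numerals.\<close>

lemma ln_bounds_numeric:
  fixes x y l u :: real
  assumes "x > 1" "y = (x - 1) / (x + 1)"
    and "l \<le> (\<Sum>k<n. 2 * y ^ (2 * k + 1) / real (2 * k + 1))"
    and "(\<Sum>k<n. 2 * y ^ (2 * k + 1) / real (2 * k + 1)) + 2 * (y ^ (2 * n + 1) / (1 - y ^ 2) / real (2 * n + 1)) \<le> u"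
  shows "l \<le> ln x" "ln x \<le> u"
  using ln_approx_bounds[OF assms(1), of n] assms(2-4) by simp_all

text \<open>
  With 2 pi = 2^2 (5/4)^2 (176/175) (2485/2486) (113 pi / 355), every factor but the first
  two is so close to 1 that a few terms of the artanh series suffice.
\<close>

lemma ln_2pi_bounds:
  "1.83787706640934548356 \<le> ln (2 * pi)" "ln (2 * pi) < 1.83787706640934548357"
proof -
  have split: "ln (2 * pi) = 2 * ln 2 + 2 * ln (5 / 4) + ln (176 / 175) - ln (2486 / 2485) - ln (355 / 113 / pi)"
  proof -
    have "2 * pi = (2 ^ 2 * (5 / 4) ^ 2 * (176 / 175)) / ((2486 / 2485) * (355 / 113 / pi))" by (simp add: field_simps)
    hence "ln (2 * pi) = ln ((2 ^ 2 * (5 / 4) ^ 2 * (176 / 175)) / ((2486 / 2485) * (355 / 113 / pi)))" by (rule arg_cong)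
    also have "\<dots> = ln (2 ^ 2 * (5 / 4) ^ 2 * (176 / 175)) - ln ((2486 / 2485) * (355 / 113 / pi))"
      by (rule ln_divide_pos) auto
    also have "ln (2 ^ 2 * (5 / 4) ^ 2 * (176 / 175) :: real) = ln (2 ^ 2) + ln ((5 / 4) ^ 2) + ln (176 / 175)"
      by (simp only: ln_mult_pos zero_less_power mult_pos_pos zero_less_divide_iff zero_less_numeral simp_thms)
    also have "ln ((2486 / 2485) * (355 / 113 / pi)) = ln (2486 / 2485) + ln (355 / 113 / pi)"
      by (rule ln_mult_pos) auto
    finally show ?thesis using ln_realpow[of 2 2] ln_realpow[of "5 / 4" 2] by simp
  qed
  have b1: "0.693147180559945309417215 \<le> ln (2 :: real)" "ln (2 :: real) \<le> 0.693147180559945309417233"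
    by (rule ln_bounds_numeric[where l = "0.693147180559945309417215" and u = "0.693147180559945309417233" and y = "1 / 3" and n = 22]; simp add: eval_nat_numeral)+
  have b2: "0.223143551314209755766294 \<le> ln (5 / 4 :: real)" "ln (5 / 4 :: real) \<le> 0.223143551314209755766296"
    by (rule ln_bounds_numeric[where l = "0.223143551314209755766294" and u = "0.223143551314209755766296" and y = "1 / 9" and n = 12]; simp add: eval_nat_numeral)+
  have b3: "0.005698021114637727424000 \<le> ln (176 / 175 :: real)" "ln (176 / 175 :: real) \<le> 0.005698021114637727424001"
    by (rule ln_bounds_numeric[where l = "0.005698021114637727424000" and u = "0.005698021114637727424001" and y = "1 / 351" and n = 5]; simp add: eval_nat_numeral)+
  have b4: "0.000402333539927321025740 \<le> ln (2486 / 2485 :: real)" "ln (2486 / 2485 :: real) \<le> 0.000402333539927321025741"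
    by (rule ln_bounds_numeric[where l = "0.000402333539927321025740" and u = "0.000402333539927321025741" and y = "1 / 4971" and n = 3]; simp add: eval_nat_numeral)+
  \<comment> \<open>The fraction is 355/113 divided by the lower bound for pi; below, 25472329285910
    / 25472327122961 arises in the same way from the upper bound.\<close>
  have "ln (355 / 113 / pi) \<le> ln (2379027976945 / 2379027774933)" using pi_bounds_20_digits(1) by (intro ln_mono) (simp_all add: field_simps)
  also have "\<dots> \<le> 0.000000084913675053204739"
    by (rule ln_bounds_numeric(2)[where l = 0 and u = "0.000000084913675053204739" and y = "101006 / 2379027875939" and n = 2]; simp add: eval_nat_numeral)
  finally have u: "ln (355 / 113 / pi) \<le> 0.000000084913675053204739" .
  have "0.000000084913675053204076 \<le> ln (25472329285910 / 25472327122961 :: real)"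
    by (rule ln_bounds_numeric(1)[where l = "0.000000084913675053204076" and u = 1 and y = "2162949 / 50944656408871" and n = 2]; simp add: eval_nat_numeral)
  also have "\<dots> \<le> ln (355 / 113 / pi)" using pi_bounds_20_digits(2) by (intro ln_mono) (simp_all add: field_simps)
  finally have l: "0.000000084913675053204076 \<le> ln (355 / 113 / pi)" .
  have pow10: "(10 :: real) ^ 20 = 100000000000000000000" "(10 :: real) ^ 24 = 1000000000000000000000000" by simp_all
  show "1.83787706640934548356 \<le> ln (2 * pi)"
    using b1 b2 b3 b4 u unfolding split pow10 by linarith
  show "ln (2 * pi) < 1.83787706640934548357"
    using b1 b2 b3 b4 l unfolding split pow10 by linarith
qed

theorem theorem1p4:
  shows "(\<forall>s. Re s > 2/3 \<longrightarrow> omega_term s summable_on ({1..} \<times> {1..})) \<and>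
         is_meromorphic_continuation {s. Re s > 2/3} omega_series omega \<and>
         integrable lborel omega_integrand \<and>
         (omega has_field_derivative
            (1/12 * (1 + of_real euler_mascheroni) + 3/4 * of_real (ln (2 * pi))
               - 2 * deriv zeta (-1) + 1/2 * (LINT t|lborel. omega_integrand t))) (at 0) \<and>
         (\<exists>x::real. deriv omega 0 = of_real x \<and>
            1.83787706640934548356 \<le> x \<and> x < 1.83787706640934548357)"
proof (intro conjI)
  show "\<forall>s. Re s > 2/3 \<longrightarrow> omega_term s summable_on ({1..} \<times> {1..})"
    using omega_term_summable abs_summable_summable by blast
  show "is_meromorphic_continuation {s. Re s > 2/3} omega_series omega"
    by (rule omega_is_continuation)
  show "integrable lborel omega_integrand"
    by (rule omega_integrand_integral(1))
  show "(omega has_field_derivative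
      (1/12 * (1 + of_real euler_mascheroni) + 3/4 * of_real (ln (2 * pi))
         - 2 * deriv zeta (-1) + 1/2 * (LINT t|lborel. omega_integrand t))) (at 0)"
    using omega_has_derivative_ln_2pi by (rule back_subst[OF _ ln_2pi_eq_formula])
  show "\<exists>x::real. deriv omega 0 = of_real x \<and>
      1.83787706640934548356 \<le> x \<and> x < 1.83787706640934548357"
    using DERIV_imp_deriv[OF omega_has_derivative_ln_2pi] ln_2pi_bounds by blast
qed

end
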